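(* Let $\mathscr{C}$ be a polyhedral complex in $\mathbb{R}^r$. Then the real vector space $H^{p,q}_{d'}(|\mathscr{C}|)$ is finite dimensional for all $p,q\in\mathbb{N}_0$.
   Context: A polyhedron in $\mathbb{R}^r$ is a finite intersection of closed affine half-spaces (no rationality assumption). A polyhedral complex $\mathscr{C}$ in $\mathbb{R}^r$ is a finite set of polyhedra such that every face of a member is a member and the intersection of two members is a face of both (the empty set counts as a face). Its support $|\mathscr{C}|$ is the union of its members, with the subspace topology. For a polyhedron $\sigma$, $\mathbb{L}_\sigma\subset\mathbb{R}^r$ is the linear subspace parallel to its affine span. Superforms on open $U\subset\mathbb{R}^r$: $A^{p,q}(U):=A^p(U)\otimes_{\mathbb{R}}\Lambda^q(\mathbb{R}^r)^*$, where $A^p(U)$ is the space of smooth real $p$-forms; $d':=D\otimes\mathrm{id}:A^{p,q}(U)\to A^{p+1,q}(U)$ with $D$ the exterior derivative. $\langle\alpha(x);v_1,\dots,v_p,w_1,\dots,w_q\rangle$ denotes evaluation of the first factor at $x$ on the $v_i$ and of the second factor on the $w_j$. Superforms on open $\Omega\subset|\mathscr{C}|$: an element of $A^{p,q}(\Omega)$ is given by some $\alpha'\in A^{p,q}(V)$ with $V\subset\mathbb{R}^r$ open and $V\cap|\mathscr{C}|=\Omega$; $\alpha'\in A^{p,q}(V)$ and $\alpha''\in A^{p,q}(W)$ define the same element iff for all $\sigma\in\mathscr{C}$, $x\in\sigma\cap\Omega$, and $v_i,w_j\in\mathbb{L}_\sigma$ one has $\langle\alpha'(x);v_1,\dots,v_p,w_1,\dots,w_q\rangle=\langle\alpha''(x);v_1,\dots,v_p,w_1,\dots,w_q\rangle$.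 The operator $d'$ is induced by the one on representatives; $d'\circ d'=0$. $H^{p,q}_{d'}(\Omega):=\ker(d':A^{p,q}(\Omega)\to A^{p+1,q}(\Omega))/\operatorname{im}(d':A^{p-1,q}(\Omega)\to A^{p,q}(\Omega))$, with $A^{-1,q}:=0$. *)

theory Defs
  imports
    "HOL-Analysis.Analysis"
    "HOL-Library.Function_Algebras"
    "HOL-Algebra.Module"
begin

section \<open>Polyhedral complexes\<close>

text \<open>
  \<^const>\<open>polyhedron\<close> and \<^const>\<open>face_of\<close> are those of the library: a polyhedron is a finite
  intersection of closed affine half-spaces (the empty set and the whole space included), and
  the empty set is a face of every polyhedron.
\<close>

definition polyhedral_complex :: "'a::euclidean_space set set \<Rightarrow> bool" where
  "polyhedral_complex C \<longleftrightarrow>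
     finite C \<and>
     (\<forall>\<sigma>\<in>C. polyhedron \<sigma>) \<and>
     (\<forall>\<sigma>\<in>C. \<forall>F. F face_of \<sigma> \<longrightarrow> F \<in> C) \<and>
     (\<forall>\<sigma>\<in>C. \<forall>\<tau>\<in>C. (\<sigma> \<inter> \<tau>) face_of \<sigma> \<and> (\<sigma> \<inter> \<tau>) face_of \<tau>)"

definition supp :: "'a set set \<Rightarrow> 'a set" where
  "supp C = \<Union>C"

definition direction_space :: "'a::euclidean_space set \<Rightarrow> 'a set" where
  "direction_space \<sigma> = {x - y | x y. x \<in> affine hull \<sigma> \<and> y \<in> affine hull \<sigma>}"


section \<open>Function spaces as real vector spaces\<close>

instantiation "fun" :: (type, real_vector) real_vector
begin

definition scaleR_fun :: "real \<Rightarrow> ('a \<Rightarrow> 'b) \<Rightarrow> 'a \<Rightarrow> 'b" where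
  "scaleR_fun c f = (\<lambda>x. c *\<^sub>R f x)"

instance
  by standard (auto simp: scaleR_fun_def fun_eq_iff algebra_simps)

end

lemma scaleR_fun_apply [simp]: "(c *\<^sub>R f) x = c *\<^sub>R f x"
  by (simp add: scaleR_fun_def)


section \<open>Superforms on open subsets of a Euclidean space\<close>

fun Ck_on :: "nat \<Rightarrow> ('a::euclidean_space \<Rightarrow> real) \<Rightarrow> 'a set \<Rightarrow> bool" where
  "Ck_on 0 f U \<longleftrightarrow> continuous_on U f"
| "Ck_on (Suc k) f U \<longleftrightarrow>
     (\<forall>x\<in>U. f differentiable (at x)) \<and>
     (\<forall>v. Ck_on k (\<lambda>x. frechet_derivative f (at x) v) U)"

definition smooth_on :: "('a::euclidean_space \<Rightarrow> real) \<Rightarrow> 'a set \<Rightarrow> bool" where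
  "smooth_on f U \<longleftrightarrow> (\<forall>k. Ck_on k f U)"

text \<open>
  A \<open>p\<close>-linear form takes a sequence of vectors of which it only sees the entries
  \<open>0, \<dots>, p - 1\<close>.
\<close>

definition alternating_forms :: "nat \<Rightarrow> ((nat \<Rightarrow> 'a::euclidean_space) \<Rightarrow> real) set" where
  "alternating_forms p = {f.
     (\<forall>v w. (\<forall>i<p. v i = w i) \<longrightarrow> f v = f w) \<and>
     (\<forall>v. \<forall>i<p. linear (\<lambda>y. f (v(i := y)))) \<and>
     (\<forall>v i j. i < j \<and> j < p \<and> v i = v j \<longrightarrow> f v = 0)}"

text \<open>Forms on \<open>U\<close> are extended by zero, so that equality on \<open>U\<close> is equality of functions.\<close>

definition smooth_forms ::
    "nat \<Rightarrow> 'a::euclidean_space set \<Rightarrow> ('a \<Rightarrow> (nat \<Rightarrow> 'a) \<Rightarrow> real) set" where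
  "smooth_forms p U = {\<omega>.
     (\<forall>x\<in>U. \<omega> x \<in> alternating_forms p) \<and>
     (\<forall>v. smooth_on (\<lambda>x. \<omega> x v) U) \<and>
     (\<forall>x. x \<notin> U \<longrightarrow> \<omega> x = 0)}"

definition skip :: "nat \<Rightarrow> (nat \<Rightarrow> 'a) \<Rightarrow> nat \<Rightarrow> 'a" where
  "skip k v = (\<lambda>i. if i < k then v i else v (Suc i))"

definition exterior_derivative ::
    "nat \<Rightarrow> 'a::euclidean_space set \<Rightarrow> ('a \<Rightarrow> (nat \<Rightarrow> 'a) \<Rightarrow> real) \<Rightarrow> 'a \<Rightarrow> (nat \<Rightarrow> 'a) \<Rightarrow> real"
  where
  "exterior_derivative p U \<omega> = (\<lambda>x v.
     if x \<in> U
     then \<Sum>k\<le>p. (-1) ^ k * frechet_derivative (\<lambda>y. \<omega> y (skip k v)) (at x) (v k)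
     else 0)"

text \<open>
  \<open>\<alpha> x v w\<close> is the evaluation of the first tensor factor at \<open>x\<close> on \<open>v\<close> and of the second factor
  on \<open>w\<close>. The algebraic tensor product of a space of functions of \<open>(x, v)\<close> and a space of functions
  of \<open>w\<close> is the space of functions of \<open>(x, v, w)\<close> spanned by the products.
\<close>

type_synonym 'a superform = "'a \<Rightarrow> (nat \<Rightarrow> 'a) \<Rightarrow> (nat \<Rightarrow> 'a) \<Rightarrow> real"

definition tensor ::
    "('a \<Rightarrow> (nat \<Rightarrow> 'a) \<Rightarrow> real) \<Rightarrow> ((nat \<Rightarrow> 'a) \<Rightarrow> real) \<Rightarrow> 'a superform" where
  "tensor \<omega> \<eta> = (\<lambda>x v w. \<omega> x v * \<eta> w)"

definition superforms :: "nat \<Rightarrow> nat \<Rightarrow> 'a::euclidean_space set \<Rightarrow> 'a superform set" where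
  "superforms p q U =
     span {tensor \<omega> \<eta> | \<omega> \<eta>. \<omega> \<in> smooth_forms p U \<and> \<eta> \<in> alternating_forms q}"

text \<open>
  \<open>D \<otimes> id\<close> is \<open>D\<close> applied for each fixed argument \<open>w\<close> of the second factor; see the lemmas
  \<open>dprime_tensor\<close>, \<open>dprime_add\<close> and \<open>dprime_scaleR\<close> below.
\<close>

definition dprime ::
    "nat \<Rightarrow> 'a::euclidean_space set \<Rightarrow> 'a superform \<Rightarrow> 'a superform" where
  "dprime p U \<alpha> = (\<lambda>x v w. exterior_derivative p U (\<lambda>y u. \<alpha> y u w) x v)"

lemma superform_differentiable:
  assumes "\<alpha> \<in> superforms p q U" "x \<in> U"
  shows "(\<lambda>y. \<alpha> y v w) differentiable (at x)"
  using assms(1) unfolding superforms_def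
proof (induction rule: span_induct_alt)
  case base
  then show ?case by simp
next
  case (step c a b)
  then obtain \<omega> \<eta> where a: "a = tensor \<omega> \<eta>" and \<omega>: "\<omega> \<in> smooth_forms p U" by blast
  from \<omega> have "Ck_on (Suc 0) (\<lambda>x. \<omega> x v) U"
    unfolding smooth_forms_def smooth_on_def by blast
  with assms(2) have "(\<lambda>y. \<omega> y v) differentiable (at x)" by simp
  then have "(\<lambda>y. a y v w) differentiable (at x)"
    unfolding a tensor_def by simp
  with step show ?case by (simp add: differentiable_cmult_left_iff)
qed

lemma dprime_tensor:
  assumes "\<omega> \<in> smooth_forms p U"
  shows "dprime p U (tensor \<omega> \<eta>) = tensor (exterior_derivative p U \<omega>) \<eta>"
proof (intro ext)
  fix x v w
  have *: "frechet_derivative (\<lambda>y. \<omega> y u * \<eta> w) (at x) z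
         = frechet_derivative (\<lambda>y. \<omega> y u) (at x) z * \<eta> w" if "x \<in> U" for u z
  proof -
    have "Ck_on (Suc 0) (\<lambda>x. \<omega> x u) U"
      using assms unfolding smooth_forms_def smooth_on_def by blast
    then have "(\<lambda>y. \<omega> y u) differentiable (at x)" using that by simp
    then have "((\<lambda>y. \<omega> y u) has_derivative frechet_derivative (\<lambda>y. \<omega> y u) (at x)) (at x)"
      by (simp add: frechet_derivative_works)
    from fun_cong[OF frechet_derivative_at[OF has_derivative_mult_left[OF this, of "\<eta> w"]], of z]
    show ?thesis by simp
  qed
  show "dprime p U (tensor \<omega> \<eta>) x v w = tensor (exterior_derivative p U \<omega>) \<eta> x v w"
    by (simp add: dprime_def tensor_def exterior_derivative_def * sum_distrib_right mult.assoc)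
qed

lemma dprime_add:
  assumes "\<alpha> \<in> superforms p q U" "\<beta> \<in> superforms p q U"
  shows "dprime p U (\<alpha> + \<beta>) = dprime p U \<alpha> + dprime p U \<beta>"
proof (intro ext)
  fix x v w
  have *: "frechet_derivative (\<lambda>y. \<alpha> y u w + \<beta> y u w) (at x) z
         = frechet_derivative (\<lambda>y. \<alpha> y u w) (at x) z + frechet_derivative (\<lambda>y. \<beta> y u w) (at x) z"
    if "x \<in> U" for u z
  proof -
    have "((\<lambda>y. \<alpha> y u w) has_derivative frechet_derivative (\<lambda>y. \<alpha> y u w) (at x)) (at x)"
      "((\<lambda>y. \<beta> y u w) has_derivative frechet_derivative (\<lambda>y. \<beta> y u w) (at x)) (at x)"
      using assms superform_differentiable[where p = p and q = q and U = U] that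
      by (simp add: frechet_derivative_works[symmetric] superform_differentiable)+
    from fun_cong[OF frechet_derivative_at[OF has_derivative_add[OF this]], of z]
    show ?thesis by simp
  qed
  show "dprime p U (\<alpha> + \<beta>) x v w = (dprime p U \<alpha> + dprime p U \<beta>) x v w"
    by (simp add: dprime_def exterior_derivative_def * sum.distrib distrib_left)
qed

lemma dprime_scaleR:
  assumes "\<alpha> \<in> superforms p q U"
  shows "dprime p U (c *\<^sub>R \<alpha>) = c *\<^sub>R dprime p U \<alpha>"
proof (intro ext)
  fix x v w
  have *: "frechet_derivative (\<lambda>y. c * \<alpha> y u w) (at x) z
         = c * frechet_derivative (\<lambda>y. \<alpha> y u w) (at x) z" if "x \<in> U" for u z
  proof -
    have "((\<lambda>y. \<alpha> y u w) has_derivative frechet_derivative (\<lambda>y. \<alpha> y u w) (at x)) (at x)"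
      using assms superform_differentiable[where p = p and q = q and U = U] that
      by (simp add: frechet_derivative_works[symmetric] superform_differentiable)
    from fun_cong[OF frechet_derivative_at[OF has_derivative_mult_right[OF this, of c]], of z]
    show ?thesis by simp
  qed
  show "dprime p U (c *\<^sub>R \<alpha>) x v w = (c *\<^sub>R dprime p U \<alpha>) x v w"
    by (simp add: dprime_def exterior_derivative_def * sum_distrib_left mult_ac)
qed


section \<open>Superforms on open subsets of the support of a complex\<close>

text \<open>
  The element of \<open>A\<^sup>p\<^sup>,\<^sup>q(\<Omega>)\<close> given by a representative \<open>\<alpha>\<close> is encoded by the family of the values
  \<open>\<langle>\<alpha>(x); v, w\<rangle>\<close> for \<open>\<sigma> \<in> C\<close>, \<open>x \<in> \<sigma> \<inter> \<Omega>\<close> and \<open>v\<^sub>i, w\<^sub>j \<in> \<bbbL>\<^sub>\<sigma>\<close>, so that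
  representatives define the same element iff they have the same encoding (lemma
  \<open>restr_eq_iff\<close>).
\<close>

definition restr ::
    "'a::euclidean_space set set \<Rightarrow> 'a set \<Rightarrow> nat \<Rightarrow> nat \<Rightarrow> 'a superform \<Rightarrow> 'a set \<Rightarrow> 'a superform"
  where
  "restr C \<Omega> p q \<alpha> = (\<lambda>\<sigma> x v w.
     if \<sigma> \<in> C \<and> x \<in> \<sigma> \<inter> \<Omega> \<and>
        (\<forall>i<p. v i \<in> direction_space \<sigma>) \<and> (\<forall>j<q. w j \<in> direction_space \<sigma>)
     then \<alpha> x v w else 0)"

lemma restr_eq_iff:
  "restr C \<Omega> p q \<alpha> = restr C \<Omega> p q \<beta> \<longleftrightarrow>
    (\<forall>\<sigma>\<in>C. \<forall>x\<in>\<sigma> \<inter> \<Omega>. \<forall>v w.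
       (\<forall>i<p. v i \<in> direction_space \<sigma>) \<and> (\<forall>j<q. w j \<in> direction_space \<sigma>) \<longrightarrow>
       \<alpha> x v w = \<beta> x v w)"
  (is "?l \<longleftrightarrow> ?r")
proof
  assume l: ?l
  show ?r
  proof (intro ballI allI impI)
    fix \<sigma> x v w
    assume "\<sigma> \<in> C" "x \<in> \<sigma> \<inter> \<Omega>"
      "(\<forall>i<p. v i \<in> direction_space \<sigma>) \<and> (\<forall>j<q. w j \<in> direction_space \<sigma>)"
    moreover have "restr C \<Omega> p q \<alpha> \<sigma> x v w = restr C \<Omega> p q \<beta> \<sigma> x v w" by (simp add: l)
    ultimately show "\<alpha> x v w = \<beta> x v w" by (simp add: restr_def)
  qed
next
  assume ?r
  then show ?l unfolding restr_def by (intro ext if_cong refl) blast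
qed

definition represents ::
    "'a::euclidean_space set set \<Rightarrow> 'a set \<Rightarrow> nat \<Rightarrow> nat \<Rightarrow> 'a set \<Rightarrow> 'a superform \<Rightarrow>
     ('a set \<Rightarrow> 'a superform) \<Rightarrow> bool" where
  "represents C \<Omega> p q V \<alpha> \<theta> \<longleftrightarrow>
     open V \<and> V \<inter> supp C = \<Omega> \<and> \<alpha> \<in> superforms p q V \<and> \<theta> = restr C \<Omega> p q \<alpha>"

definition superforms_on ::
    "'a::euclidean_space set set \<Rightarrow> 'a set \<Rightarrow> nat \<Rightarrow> nat \<Rightarrow> ('a set \<Rightarrow> 'a superform) set" where
  "superforms_on C \<Omega> p q = {\<theta>. \<exists>V \<alpha>. represents C \<Omega> p q V \<alpha> \<theta>}"

text \<open>The operator induced by \<^const>\<open>dprime\<close>; it is well defined by \<open>dprime_on_restr\<close> below.\<close>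

definition dprime_on ::
    "'a::euclidean_space set set \<Rightarrow> 'a set \<Rightarrow> nat \<Rightarrow> nat \<Rightarrow>
     ('a set \<Rightarrow> 'a superform) \<Rightarrow> 'a set \<Rightarrow> 'a superform" where
  "dprime_on C \<Omega> p q \<theta> =
     (THE \<zeta>. \<exists>V \<alpha>. represents C \<Omega> p q V \<alpha> \<theta> \<and> \<zeta> = restr C \<Omega> (Suc p) q (dprime p V \<alpha>))"

lemma frechet_derivative_tangential:
  fixes f :: "'a::euclidean_space \<Rightarrow> real"
  assumes f: "f differentiable (at x)" and \<sigma>: "convex \<sigma>" "x \<in> \<sigma>"
    and N: "open N" "x \<in> N" "\<And>y. y \<in> \<sigma> \<inter> N \<Longrightarrow> f y = 0"
    and u: "u \<in> direction_space \<sigma>"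
  shows "frechet_derivative f (at x) u = 0"
proof -
  define D where "D = frechet_derivative f (at x)"
  have D: "(f has_derivative D) (at x)" using f by (simp add: frechet_derivative_works D_def)
  then have lin: "linear D" by (rule has_derivative_linear)
  have D0: "D (y - x) = 0" if y: "y \<in> \<sigma>" for y
  proof -
    define g where "g = (\<lambda>t::real. x + t *\<^sub>R (y - x))"
    have g: "(g has_vector_derivative (y - x)) (at 0 within {0..1})"
      unfolding g_def by (auto intro!: derivative_eq_intros simp: has_vector_derivative_def)
    have "(f has_derivative D) (at (g 0) within g ` {0..1})"
      using D by (simp add: g_def has_derivative_at_withinI)
    with g have 1: "((f \<circ> g) has_vector_derivative D (y - x)) (at 0 within {0..1})"
      using diff_chain_within[of g "\<lambda>t. t *\<^sub>R (y - x)" 0 "{0..1}" f D] lin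
      unfolding has_vector_derivative_def by (simp add: o_def linear_scale)
    obtain e where e: "e > 0" "ball x e \<subseteq> N" using N open_contains_ball by blast
    have "continuous (at 0) g" unfolding g_def by (intro continuous_intros)
    then obtain d where d: "d > 0" "\<And>t. dist t 0 < d \<Longrightarrow> dist (g t) (g 0) < e"
      using e(1) unfolding continuous_at_eps_delta by blast
    have "(f \<circ> g) t = 0" if "t \<in> {0..1}" "dist t 0 < d" for t
    proof -
      have "g t = (1 - t) *\<^sub>R x + t *\<^sub>R y" by (simp add: g_def algebra_simps)
      then have "g t \<in> \<sigma>" using that(1) \<sigma> y by (simp add: convexD)
      moreover have "g t \<in> N" using d(2)[OF that(2)] e(2) by (auto simp: g_def dist_commute)
      ultimately show ?thesis using N(3) by simp
    qed
    then have 2: "((f \<circ> g) has_vector_derivative 0) (at 0 within {0..1})"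
      by (intro has_vector_derivative_transform_within[OF has_vector_derivative_const[of 0] d(1)])
        auto
    have "at (0::real) within {0..1} \<noteq> bot" by (simp add: trivial_limit_within islimpt_Icc)
    from vector_derivative_unique_within[OF this 1 2] show ?thesis .
  qed
  have x: "x \<in> affine hull \<sigma>" using \<sigma>(2) by (rule hull_inc)
  obtain a b where ab: "u = a - b" "a \<in> affine hull \<sigma>" "b \<in> affine hull \<sigma>"
    using u unfolding direction_space_def by blast
  have hull: "affine hull \<sigma> = (+) x ` span ((\<lambda>y. - x + y) ` \<sigma>)"
    by (rule affine_hull_span_gen[OF x])
  have span0: "D z = 0" if "z \<in> span ((\<lambda>y. - x + y) ` \<sigma>)" for z
    using lin _ that by (rule linear_eq_0_on_span) (auto simp: D0)
  from ab hull obtain a' b' where "a = x + a'" "b = x + b'" "D a' = 0" "D b' = 0"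
    using span0 by blast
  then show ?thesis using ab(1) lin by (simp add: D_def linear_diff)
qed

lemma restr_dprime_cong:
  assumes C: "\<And>\<sigma>. \<sigma> \<in> C \<Longrightarrow> convex \<sigma>"
    and V: "represents C \<Omega> p q V \<alpha> \<theta>" and W: "represents C \<Omega> p q W \<beta> \<theta>"
  shows "restr C \<Omega> (Suc p) q (dprime p V \<alpha>) = restr C \<Omega> (Suc p) q (dprime p W \<beta>)"
  unfolding restr_eq_iff
proof (intro ballI allI impI)
  fix \<sigma> x v w
  assume \<sigma>: "\<sigma> \<in> C" and x: "x \<in> \<sigma> \<inter> \<Omega>"
    and vw: "(\<forall>i<Suc p. v i \<in> direction_space \<sigma>) \<and> (\<forall>j<q. w j \<in> direction_space \<sigma>)"
  have xVW: "x \<in> V" "x \<in> W" using x V W unfolding represents_def by auto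
  have "frechet_derivative (\<lambda>y. \<alpha> y (skip k v) w) (at x) (v k)
      = frechet_derivative (\<lambda>y. \<beta> y (skip k v) w) (at x) (v k)" if k: "k \<le> p" for k
  proof -
    have \<alpha>: "(\<lambda>y. \<alpha> y (skip k v) w) differentiable (at x)"
      and \<beta>: "(\<lambda>y. \<beta> y (skip k v) w) differentiable (at x)"
      using V W xVW superform_differentiable by (auto simp: represents_def)
    have eq: "\<alpha> y (skip k v) w - \<beta> y (skip k v) w = 0" if y: "y \<in> \<sigma> \<inter> (V \<inter> W)" for y
    proof -
      have "restr C \<Omega> p q \<alpha> = restr C \<Omega> p q \<beta>" using V W unfolding represents_def by simp
      moreover have "y \<in> \<sigma> \<inter> \<Omega>" using y \<sigma> V by (auto simp: represents_def supp_def)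
      moreover have "\<forall>i<p. skip k v i \<in> direction_space \<sigma>" using vw by (auto simp: skip_def)
      ultimately show ?thesis using \<sigma> vw unfolding restr_eq_iff by simp
    qed
    have "frechet_derivative (\<lambda>y. \<alpha> y (skip k v) w - \<beta> y (skip k v) w) (at x) (v k) = 0"
    proof (rule frechet_derivative_tangential)
      show "(\<lambda>y. \<alpha> y (skip k v) w - \<beta> y (skip k v) w) differentiable (at x)"
        using \<alpha> \<beta> by (rule differentiable_diff)
      show "convex \<sigma>" by (rule C[OF \<sigma>])
      show "x \<in> \<sigma>" using x by simp
      show "open (V \<inter> W)" using V W unfolding represents_def by (intro open_Int) simp_all
      show "x \<in> V \<inter> W" using xVW by simp
      show "v k \<in> direction_space \<sigma>" using vw k by simp
    qed (rule eq)
    moreover have "frechet_derivative (\<lambda>y. \<alpha> y (skip k v) w - \<beta> y (skip k v) w) (at x)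
        = (\<lambda>z. frechet_derivative (\<lambda>y. \<alpha> y (skip k v) w) (at x) z
               - frechet_derivative (\<lambda>y. \<beta> y (skip k v) w) (at x) z)"
      using frechet_derivative_at[OF has_derivative_diff[OF
          \<alpha>[unfolded frechet_derivative_works] \<beta>[unfolded frechet_derivative_works]]]
      by (rule sym)
    ultimately show ?thesis by simp
  qed
  then show "dprime p V \<alpha> x v w = dprime p W \<beta> x v w"
    using xVW by (simp add: dprime_def exterior_derivative_def)
qed

lemma dprime_on_restr:
  assumes "polyhedral_complex C" "open V" "V \<inter> supp C = \<Omega>" "\<alpha> \<in> superforms p q V"
  shows "dprime_on C \<Omega> p q (restr C \<Omega> p q \<alpha>) = restr C \<Omega> (Suc p) q (dprime p V \<alpha>)"
proof -
  have C: "convex \<sigma>" if "\<sigma> \<in> C" for \<sigma>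
    using assms(1) that unfolding polyhedral_complex_def by (simp add: polyhedron_imp_convex)
  have rep: "represents C \<Omega> p q V \<alpha> (restr C \<Omega> p q \<alpha>)"
    using assms unfolding represents_def by simp
  show ?thesis
    unfolding dprime_on_def
  proof (rule the_equality)
    fix \<zeta>
    assume "\<exists>W \<beta>. represents C \<Omega> p q W \<beta> (restr C \<Omega> p q \<alpha>) \<and>
      \<zeta> = restr C \<Omega> (Suc p) q (dprime p W \<beta>)"
    then obtain W \<beta> where W: "represents C \<Omega> p q W \<beta> (restr C \<Omega> p q \<alpha>)"
      and \<zeta>: "\<zeta> = restr C \<Omega> (Suc p) q (dprime p W \<beta>)" by (elim exE conjE)
    show "\<zeta> = restr C \<Omega> (Suc p) q (dprime p V \<alpha>)"
      unfolding \<zeta> using C W rep by (rule restr_dprime_cong)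
  qed (use rep in blast)
qed


section \<open>Cohomology\<close>

text \<open>
  The quotient of a subspace \<open>Z\<close> by a subspace \<open>B \<subseteq> Z\<close>. The fields \<open>mult\<close> and \<open>one\<close> of the record
  play no role in a module.
\<close>

definition quotient_space :: "'b::real_vector set \<Rightarrow> 'b set \<Rightarrow> (real, 'b set) module" where
  "quotient_space Z B =
     \<lparr>carrier = {{z + b | b. b \<in> B} | z. z \<in> Z},
      mult = undefined, one = undefined,
      zero = B,
      add = (\<lambda>X Y. {x + y | x y. x \<in> X \<and> y \<in> Y}),
      smult = (\<lambda>c X. {c *\<^sub>R x + b | x b. x \<in> X \<and> b \<in> B})\<rparr>"

lemma module_quotient_space:
  assumes Z: "subspace Z" and B: "subspace B" and BZ: "B \<subseteq> Z"
  shows "Module.module \<lparr>carrier = UNIV, mult = (*), one = 1, zero = 0, add = (+)\<rparr>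
    (quotient_space Z B)" (is "Module.module ?R ?M")
proof -
  define k where "k = (\<lambda>z. {z + b | b. b \<in> B})"
  have car: "carrier ?M = k ` Z" by (auto simp: quotient_space_def k_def)
  have B0: "0 \<in> B" using B by (rule subspace_0)
  have k_eq: "k x = k y \<longleftrightarrow> x - y \<in> B" for x y
  proof
    assume "k x = k y"
    moreover have "x \<in> k x" using B0 unfolding k_def by force
    ultimately show "x - y \<in> B" unfolding k_def by auto
  next
    assume "x - y \<in> B"
    then have 1: "x - y + b \<in> B" "y - x + b \<in> B" if "b \<in> B" for b
      using that subspace_add[OF B] subspace_neg[OF B, of "x - y"] by auto
    show "k x = k y" unfolding k_def
    proof (intro equalityI subsetI)
      fix z assume "z \<in> {x + b | b. b \<in> B}"
      then obtain b where "z = x + b" "b \<in> B" by blast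
      then show "z \<in> {y + b | b. b \<in> B}" using 1(1)[of b] by (intro CollectI exI[of _ "x - y + b"]) auto
    next
      fix z assume "z \<in> {y + b | b. b \<in> B}"
      then obtain b where "z = y + b" "b \<in> B" by blast
      then show "z \<in> {x + b | b. b \<in> B}" using 1(2)[of b] by (intro CollectI exI[of _ "y - x + b"]) auto
    qed
  qed
  have zero: "zero ?M = k 0" by (auto simp: quotient_space_def k_def)
  have add: "add ?M (k x) (k y) = k (x + y)" for x y
  proof -
    have "\<exists>a a'. x + y + b = (x + a) + (y + a') \<and> a \<in> B \<and> a' \<in> B" if "b \<in> B" for b
      using that B0 by (intro exI[of _ b] exI[of _ 0]) (simp add: add_ac)
    moreover have "\<exists>b. (x + a) + (y + a') = x + y + b \<and> b \<in> B" if "a \<in> B" "a' \<in> B" for a a'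
      using that by (intro exI[of _ "a + a'"]) (simp add: add_ac subspace_add[OF B])
    ultimately have "{u + u' | u u'. u \<in> k x \<and> u' \<in> k y} = k (x + y)"
      unfolding k_def by fast
    then show ?thesis by (simp add: quotient_space_def)
  qed
  have smult: "smult ?M c (k x) = k (c *\<^sub>R x)" for c x
  proof -
    have "\<exists>b. c *\<^sub>R (x + a) + a' = c *\<^sub>R x + b \<and> b \<in> B" if "a \<in> B" "a' \<in> B" for a a'
      using that by (intro exI[of _ "c *\<^sub>R a + a'"])
        (simp add: scaleR_add_right add.assoc subspace_add[OF B] subspace_scale[OF B])
    moreover have "\<exists>a a'. c *\<^sub>R x + b = c *\<^sub>R (x + a) + a' \<and> a \<in> B \<and> a' \<in> B" if "b \<in> B" for b
      using that B0 by (intro exI[of _ 0] exI[of _ b]) simp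
    ultimately have "{c *\<^sub>R u + b | u b. u \<in> k x \<and> b \<in> B} = k (c *\<^sub>R x)"
      unfolding k_def by fast
    then show ?thesis by (simp add: quotient_space_def)
  qed
  have neg: "\<exists>y\<in>Z. k (x + y) = k 0" if "x \<in> Z" for x
    using that Z by (intro bexI[of _ "- x"]) (auto simp: subspace_neg)
  have clos: "x + y \<in> Z" "c *\<^sub>R x \<in> Z" if "x \<in> Z" "y \<in> Z" for x y c
    using that Z by (auto simp: subspace_add subspace_scale)
  have "cring ?R"
    by (unfold_locales) (auto simp: algebra_simps Units_def, metis add.commute add.right_inverse)
  moreover have "abelian_group ?M"
    by (rule abelian_groupI)
      (auto simp: car zero add clos subspace_0[OF Z] add_ac dest: neg)
  ultimately show ?thesis
    by (rule Module.moduleI) (auto simp: car add smult clos algebra_simps)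
qed

definition finite_dimensional :: "(real, 'b) module \<Rightarrow> bool" where
  "finite_dimensional M \<longleftrightarrow>
     (\<exists>S. finite S \<and> S \<subseteq> carrier M \<and>
        (\<forall>h\<in>carrier M. \<exists>c. h = (\<Oplus>\<^bsub>M\<^esub> s\<in>S. c s \<odot>\<^bsub>M\<^esub> s)))"

definition cocycles ::
    "'a::euclidean_space set set \<Rightarrow> 'a set \<Rightarrow> nat \<Rightarrow> nat \<Rightarrow> ('a set \<Rightarrow> 'a superform) set" where
  "cocycles C \<Omega> p q = {\<theta> \<in> superforms_on C \<Omega> p q. dprime_on C \<Omega> p q \<theta> = 0}"

definition coboundaries ::
    "'a::euclidean_space set set \<Rightarrow> 'a set \<Rightarrow> nat \<Rightarrow> nat \<Rightarrow> ('a set \<Rightarrow> 'a superform) set" where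
  "coboundaries C \<Omega> p q =
     (case p of 0 \<Rightarrow> {0} | Suc p' \<Rightarrow> dprime_on C \<Omega> p' q ` superforms_on C \<Omega> p' q)"

definition cohomology ::
    "'a::euclidean_space set set \<Rightarrow> 'a set \<Rightarrow> nat \<Rightarrow> nat \<Rightarrow>
     (real, ('a set \<Rightarrow> 'a superform) set) module" where
  "cohomology C \<Omega> p q = quotient_space (cocycles C \<Omega> p q) (coboundaries C \<Omega> p q)"

end

theory Submission
  imports Defs
begin

text \<open>
  The sets \<open>open_star C A = |C| - \<Union>{\<tau> \<in> C. \<not> A \<subseteq> \<tau>}\<close> with \<open>A \<noteq> {}\<close> form a finite family of open
  subsets of \<open>|C|\<close> that covers \<open>|C|\<close> and is closed under intersection. A nonempty member contains
  a point \<open>z\<close> that lies in every cell meeting it and with respect to which its trace on each cell is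
  star-shaped, so the contraction to \<open>z\<close> respects all cells. The usual homotopy operator of the
  Poincare lemma, applied to the first factor of a superform, then shows that the cohomology in
  degree \<open>p > 0\<close> vanishes, while a closed form of degree \<open>p = 0\<close> is determined by its value at \<open>z\<close>.
  Mayer--Vietoris and induction on the number of members of the cover give the result. The
  partitions of unity are explicit: complements of unions of open stars are obtained from
  half-spaces by finite unions and intersections, hence are zero sets of smooth functions.
\<close>

section \<open>Differentiable functions\<close>

text \<open>An element of \<open>superforms_on\<close> needs one representative on an open subset of
  the ambient space, and a cocycle is closed only on vectors tangent to the cells; the
  representative itself is in general not closed. So the homotopy formula is applied to a form that
  is not closed, and its error term vanishes only because the segment from \<open>z\<close> to
  \<open>x\<close> stays in each cell through \<open>x\<close>, so that the direction
  \<open>x - z\<close> and the given vectors are tangential at all of its points. This is why a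
  centre has to lie in every cell that meets the star. The second tensor factor is carried along as
  a parameter: d' does not touch it, and the homotopy does not pull it back. Hence degree 0 leads to
  constant alternating \<open>q\<close>-forms on tangential arguments. As a single representative is
  required, even gluing is not automatic and costs a partition of unity. Its functions must vanish
  on open sets, not just on the points where a form is missing, since the products are extended by
  zero. Stars of vertices would not do as a cover, because polyhedra without vertices are
  allowed.\<close>

abbreviation dird :: "'a::euclidean_space \<Rightarrow> ('a \<Rightarrow> real) \<Rightarrow> 'a \<Rightarrow> real" where
  "dird v f \<equiv> \<lambda>x. frechet_derivative f (at x) v"

lemma has_dird:
  "f differentiable (at x) \<Longrightarrow> (f has_derivative (\<lambda>v. dird v f x)) (at x)"
  using frechet_derivative_works by blast

lemma dird_eqI: "(f has_derivative F) (at x) \<Longrightarrow> dird v f x = F v"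
  using frechet_derivative_at by metis

lemma dird_cong_open:
  assumes "open U" "x \<in> U" "\<And>y. y \<in> U \<Longrightarrow> f y = g y"
  shows "dird v f x = dird v g x" "f differentiable (at x) \<longleftrightarrow> g differentiable (at x)"
proof -
  have *: "(f has_derivative F) (at x) \<longleftrightarrow> (g has_derivative F) (at x)" for F
    using assms has_derivative_transform_within_open[of f F x UNIV U g]
      has_derivative_transform_within_open[of g F x UNIV U f] by auto
  \<comment> \<open>\<open>frechet_derivative\<close> is a choice among all derivatives, so having
    the same derivatives suffices, even at a point where there is none.\<close>
  show "dird v f x = dird v g x" unfolding frechet_derivative_def * ..
  show "f differentiable (at x) \<longleftrightarrow> g differentiable (at x)" unfolding differentiable_def * ..
qed

lemma dird_add:
  assumes "f differentiable (at x)" "g differentiable (at x)"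
  shows "dird v (\<lambda>x. f x + g x) x = dird v f x + dird v g x"
  using dird_eqI[OF has_derivative_add[OF has_dird[OF assms(1)] has_dird[OF assms(2)]]] .

lemma dird_mult:
  assumes "f differentiable (at x)" "g differentiable (at x)"
  shows "dird v (\<lambda>x. f x * g x) x = f x * dird v g x + dird v f x * g x"
  using dird_eqI[OF has_derivative_mult[OF has_dird[OF assms(1)] has_dird[OF assms(2)]]] .

lemma dird_cmult:
  assumes "f differentiable (at x)"
  shows "dird v (\<lambda>x. c * f x) x = c * dird v f x"
  using dird_eqI[OF has_derivative_mult_right[OF has_dird[OF assms]]] .

lemma dird_sum:
  assumes "\<And>i. i \<in> I \<Longrightarrow> f i differentiable (at x)"
  shows "dird v (\<lambda>x. \<Sum>i\<in>I. f i x) x = (\<Sum>i\<in>I. dird v (f i) x)"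
  using dird_eqI[OF has_derivative_sum[OF has_dird[OF assms]]] .

lemma dird_compose:
  assumes "f differentiable (at x)" "(\<phi> has_real_derivative d) (at (f x))"
  shows "dird v (\<lambda>x. \<phi> (f x)) x = d * dird v f x" "(\<lambda>x. \<phi> (f x)) differentiable (at x)"
proof -
  have *: "((\<lambda>x. \<phi> (f x)) has_derivative (\<lambda>v. d * dird v f x)) (at x)"
    using has_derivative_compose[OF has_dird[OF assms(1)]
        assms(2)[unfolded has_field_derivative_def]] by simp
  show "dird v (\<lambda>x. \<phi> (f x)) x = d * dird v f x" by (rule dird_eqI[OF *])
  show "(\<lambda>x. \<phi> (f x)) differentiable (at x)" using * by (rule differentiableI)
qed

lemma linear_dird: "f differentiable (at x) \<Longrightarrow> linear (\<lambda>v. dird v f x)"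
  using has_dird has_derivative_linear by blast

section \<open>Functions of class C^k and smooth functions\<close>

lemma Ck_on_cong:
  assumes "open U" "\<And>x. x \<in> U \<Longrightarrow> f x = g x" "Ck_on k f U"
  shows "Ck_on k g U"
  using assms(2,3)
proof (induction k arbitrary: f g)
  case 0
  then show ?case by (simp cong: continuous_on_cong)
next
  case (Suc k)
  have "dird v f x = dird v g x" if "x \<in> U" for x v
    using dird_cong_open(1)[OF assms(1) that, of f g] Suc.prems(1) by blast
  then have "Ck_on k (dird v g) U" for v
    using Suc.prems(2) by (intro Suc.IH[of "dird v f" "dird v g"]) auto
  moreover have "g differentiable (at x)" if "x \<in> U" for x
    using dird_cong_open(2)[OF assms(1) that, of f g] Suc.prems that by auto
  ultimately show ?case by simp
qed

lemma Ck_on_subset: "Ck_on k f U \<Longrightarrow> V \<subseteq> U \<Longrightarrow> Ck_on k f V"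
  by (induction k arbitrary: f) (auto intro: continuous_on_subset)

lemma Ck_on_Un:
  "open U \<Longrightarrow> open V \<Longrightarrow> Ck_on k f U \<Longrightarrow> Ck_on k f V \<Longrightarrow> Ck_on k f (U \<union> V)"
  by (induction k arbitrary: f) (auto intro: continuous_on_open_Un)

lemma Ck_on_Suc_imp: "Ck_on (Suc k) f U \<Longrightarrow> Ck_on k f U"
proof (induction k arbitrary: f)
  case 0
  then show ?case
    by (auto intro!: continuous_at_imp_continuous_on differentiable_imp_continuous_within)
qed auto

lemma Ck_on_const: "Ck_on k (\<lambda>x. c) U"
proof (induction k arbitrary: c)
  case (Suc k)
  then show ?case by (simp add: frechet_derivative_const)
qed simp

lemma Ck_on_linear: "linear f \<Longrightarrow> Ck_on k f U"
proof (cases k)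
  case 0
  then show "linear f \<Longrightarrow> Ck_on k f U" by (simp add: linear_continuous_on linear_linear)
next
  case (Suc j)
  assume "linear f"
  then have *: "(f has_derivative f) (at x)" for x
    by (simp add: linear_imp_has_derivative)
  then have "dird v f = (\<lambda>x. f v)" for v by (intro ext) (rule dird_eqI)
  then show ?thesis using * unfolding Suc by (auto simp: Ck_on_const intro: differentiableI)
qed

lemma Ck_on_add:
  "open U \<Longrightarrow> Ck_on k f U \<Longrightarrow> Ck_on k g U \<Longrightarrow> Ck_on k (\<lambda>x. f x + g x) U"
proof (induction k arbitrary: f g)
  case (Suc k)
  have "Ck_on k (dird v (\<lambda>x. f x + g x)) U" for v
    by (rule Ck_on_cong[OF Suc.prems(1) _ Suc.IH[of "dird v f" "dird v g"]])
      (use Suc.prems in \<open>auto simp: dird_add\<close>)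
  then show ?case using Suc.prems by auto
qed (auto intro: continuous_intros)

lemma Ck_on_mult:
  "open U \<Longrightarrow> Ck_on k f U \<Longrightarrow> Ck_on k g U \<Longrightarrow> Ck_on k (\<lambda>x. f x * g x) U"
proof (induction k arbitrary: f g)
  case (Suc k)
  have "Ck_on k f U" "Ck_on k g U" using Suc.prems Ck_on_Suc_imp by blast+
  then have "Ck_on k (\<lambda>x. f x * dird v g x + dird v f x * g x) U" for v
    using Suc.prems by (intro Ck_on_add Suc.IH) auto
  then have "Ck_on k (dird v (\<lambda>x. f x * g x)) U" for v
    by (rule Ck_on_cong[OF Suc.prems(1), rotated]) (use Suc.prems in \<open>auto simp: dird_mult\<close>)
  then show ?case using Suc.prems by auto
qed (auto intro: continuous_intros)

lemma Ck_on_sum: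
  assumes "open U" "\<And>i. i \<in> I \<Longrightarrow> Ck_on k (f i) U"
  shows "Ck_on k (\<lambda>x. \<Sum>i\<in>I. f i x) U"
  using assms by (induction I rule: infinite_finite_induct) (auto intro: Ck_on_add Ck_on_const)

text \<open>The outer function sits in a family closed under differentiation, in the sense that
  \<open>\<Phi>' n\<close> is assembled from members; so the induction on \<open>k\<close> treats
  all members at once.\<close>

lemma Ck_on_compose:
  assumes "open U" "f ` U \<subseteq> T"
    and \<Phi>: "\<And>n t. t \<in> T \<Longrightarrow> (\<Phi> n has_real_derivative \<Phi>' n t) (at t)"
    and \<Phi>': "\<And>n k. (\<And>m. Ck_on k (\<lambda>x. \<Phi> m (f x)) U) \<Longrightarrow> Ck_on k (\<lambda>x. \<Phi>' n (f x)) U"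
    and "Ck_on k f U"
  shows "Ck_on k (\<lambda>x. \<Phi> n (f x)) U"
  using assms(5)
proof (induction k arbitrary: n)
  case 0
  have "continuous_on T (\<Phi> n)"
    using \<Phi> DERIV_isCont by (blast intro: continuous_at_imp_continuous_on)
  then show ?case using 0 assms(2) by (auto intro: continuous_on_compose2)
next
  case (Suc k)
  have 1: "Ck_on k (\<lambda>x. \<Phi>' n (f x)) U"
    using Suc.IH Suc.prems Ck_on_Suc_imp by (intro \<Phi>') blast
  have "Ck_on k (dird v (\<lambda>x. \<Phi> n (f x))) U" for v
  proof (rule Ck_on_cong[OF assms(1)])
    show "Ck_on k (\<lambda>x. \<Phi>' n (f x) * dird v f x) U"
      using Suc.prems 1 assms(1) by (intro Ck_on_mult) auto
    show "\<Phi>' n (f x) * dird v f x = dird v (\<lambda>x. \<Phi> n (f x)) x" if "x \<in> U" for x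
      using that assms(2) Suc.prems by (subst dird_compose(1)[OF _ \<Phi>]) auto
  qed
  moreover have "(\<lambda>x. \<Phi> n (f x)) differentiable (at x)" if "x \<in> U" for x
    using that assms(2) Suc.prems by (intro dird_compose(2)[OF _ \<Phi>]) auto
  ultimately show ?case by simp
qed

lemma Ck_on_inverse:
  assumes "open U" "Ck_on k f U" "\<And>x. x \<in> U \<Longrightarrow> f x \<noteq> 0"
  shows "Ck_on k (\<lambda>x. inverse (f x)) U"
proof -
  \<comment> \<open>Each negative power differentiates to a multiple of the next, so they form a
    closed family; the claim is its member 0.\<close>
  define \<Phi> where "\<Phi> = (\<lambda>n t::real. inverse t ^ Suc n)"
  have "Ck_on k (\<lambda>x. \<Phi> 0 (f x)) U"
  proof (rule Ck_on_compose[where T = "{t. t \<noteq> 0}" and \<Phi> = \<Phi> and \<Phi>' = "\<lambda>n t. - real (Suc n) * \<Phi> (Suc n) t"])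
    show "(\<Phi> n has_real_derivative - real (Suc n) * \<Phi> (Suc n) t) (at t)" if "t \<in> {t. t \<noteq> 0}" for n t
      using DERIV_power_Suc[OF DERIV_inverse, of t n] that
      by (simp add: \<Phi>_def algebra_simps)
  next
    fix n k assume "\<And>m. Ck_on k (\<lambda>x. \<Phi> m (f x)) U"
    then show "Ck_on k (\<lambda>x. - real (Suc n) * \<Phi> (Suc n) (f x)) U"
      using assms(1) by (intro Ck_on_mult Ck_on_const)
  qed (use assms in auto)
  then show ?thesis by (simp add: \<Phi>_def)
qed

text \<open>The case \<open>m = 0\<close> is the classical flat function; the other ones occur in its derivatives.\<close>

definition flat :: "nat \<Rightarrow> real \<Rightarrow> real" where
  "flat m t = (if 0 < t then exp (- inverse t) * inverse t ^ m else 0)"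

text \<open>With s = 1/t the limit from the right is the decay of s^m / exp s at infinity; on the
  left the function is 0.\<close>

lemma tendsto_flat: "(flat m \<longlongrightarrow> 0) (at 0)"
proof -
  have "((\<lambda>t. inverse t ^ m / exp (inverse t)) \<longlongrightarrow> (0::real)) (at_right 0)"
    by (rule filterlim_compose[OF tendsto_power_div_exp_0 filterlim_inverse_at_top_right])
  then have "(flat m \<longlongrightarrow> 0) (at_right 0)"
    by (rule Lim_transform_eventually)
      (auto simp: eventually_at_filter flat_def exp_minus field_simps)
  moreover have "(flat m \<longlongrightarrow> 0) (at_left 0)"
    by (rule Lim_transform_eventually[OF tendsto_const[of 0]])
      (auto simp: eventually_at_filter flat_def)
  ultimately show ?thesis by (simp add: filterlim_split_at)
qed

lemma DERIV_flat:
  "(flat m has_real_derivative (flat (m + 2) t + - real m * flat (Suc m) t)) (at t)"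
proof -
  consider "t < 0" | "t = 0" | "t > 0" by linarith
  then show ?thesis
  proof cases
    case 1
    have "((\<lambda>_. 0) has_real_derivative 0) (at t)" by simp
    then have "(flat m has_real_derivative 0) (at t)"
      by (rule has_field_derivative_transform_within_open[where S = "{..<0}"])
        (use 1 in \<open>auto simp: flat_def\<close>)
    then show ?thesis using 1 by (simp add: flat_def)
  next
    case 2
    \<comment> \<open>The difference quotient of \<open>flat m\<close> at 0 is
      \<open>flat (Suc m)\<close>, whose limit is known.\<close>
    have "((\<lambda>h. flat m h / h) \<longlongrightarrow> 0) (at 0)"
      by (rule Lim_transform_eventually[OF tendsto_flat[of "Suc m"]])
        (auto simp: eventually_at_filter flat_def field_simps)
    then show ?thesis using 2 by (simp add: DERIV_def flat_def)
  next
    case 3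
    have "((\<lambda>t. exp (- inverse t) * inverse t ^ m) has_real_derivative
        (flat (m + 2) t + - real m * flat (Suc m) t)) (at t)"
    proof (cases m)
      case 0
      then show ?thesis using 3
        by (auto intro!: derivative_eq_intros simp: flat_def field_simps power2_eq_square)
    next
      case (Suc j)
      have "((\<lambda>t. exp (- inverse t)) has_real_derivative exp (- inverse t) * inverse t ^ 2) (at t)"
        using 3 by (auto intro!: derivative_eq_intros simp: field_simps power2_eq_square)
      from DERIV_mult[OF this DERIV_power_Suc[OF DERIV_inverse, of t j]] show ?thesis
        using 3 by (simp add: Suc flat_def algebra_simps power2_eq_square)
    qed
    then show ?thesis
      by (rule has_field_derivative_transform_within_open[where S = "{0<..}"])
        (use 3 in \<open>auto simp: flat_def\<close>)
  qed
qed

lemma Ck_on_flat: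
  assumes "open U" "Ck_on k f U"
  shows "Ck_on k (\<lambda>x. flat m (f x)) U"
proof (rule Ck_on_compose[where T = UNIV, OF _ _ DERIV_flat])
  fix n k assume "\<And>m. Ck_on k (\<lambda>x. flat m (f x)) U"
  then show "Ck_on k (\<lambda>x. flat (n + 2) (f x) + - real n * flat (Suc n) (f x)) U"
    using assms(1) by (intro Ck_on_add Ck_on_mult Ck_on_const)
qed (use assms in auto)

lemma smooth_on_iff:
  "smooth_on f U \<longleftrightarrow> (\<forall>x\<in>U. f differentiable (at x)) \<and> (\<forall>v. smooth_on (dird v f) U)"
  unfolding smooth_on_def using Ck_on_Suc_imp by (metis Ck_on.simps(2) not0_implies_Suc)

lemma smooth_on_differentiable: "smooth_on f U \<Longrightarrow> x \<in> U \<Longrightarrow> f differentiable (at x)"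
  and smooth_on_dird: "smooth_on f U \<Longrightarrow> smooth_on (dird v f) U"
  using smooth_on_iff by blast+

lemma smooth_on_continuous: "smooth_on f U \<Longrightarrow> continuous_on U f"
  unfolding smooth_on_def by (metis Ck_on.simps(1))

lemma smooth_on_cong:
  "open U \<Longrightarrow> (\<And>x. x \<in> U \<Longrightarrow> f x = g x) \<Longrightarrow> smooth_on f U \<Longrightarrow> smooth_on g U"
  unfolding smooth_on_def using Ck_on_cong by metis

lemma smooth_on_subset: "smooth_on f U \<Longrightarrow> V \<subseteq> U \<Longrightarrow> smooth_on f V"
  and smooth_on_Un:
    "open U \<Longrightarrow> open V \<Longrightarrow> smooth_on f U \<Longrightarrow> smooth_on f V \<Longrightarrow> smooth_on f (U \<union> V)"
  and smooth_on_const: "smooth_on (\<lambda>x. c) U"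
  and smooth_on_linear: "linear f \<Longrightarrow> smooth_on f U"
  and smooth_on_add:
    "open U \<Longrightarrow> smooth_on f U \<Longrightarrow> smooth_on g U \<Longrightarrow> smooth_on (\<lambda>x. f x + g x) U"
  and smooth_on_mult:
    "open U \<Longrightarrow> smooth_on f U \<Longrightarrow> smooth_on g U \<Longrightarrow> smooth_on (\<lambda>x. f x * g x) U"
  and smooth_on_sum:
    "open U \<Longrightarrow> (\<And>i. i \<in> I \<Longrightarrow> smooth_on (F i) U) \<Longrightarrow> smooth_on (\<lambda>x. \<Sum>i\<in>I. F i x) U"
  and smooth_on_inverse:
    "open U \<Longrightarrow> smooth_on f U \<Longrightarrow> (\<And>x. x \<in> U \<Longrightarrow> f x \<noteq> 0) \<Longrightarrow> smooth_on (\<lambda>x. inverse (f x)) U"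
  and smooth_on_flat: "open U \<Longrightarrow> smooth_on f U \<Longrightarrow> smooth_on (\<lambda>x. flat m (f x)) U"
  by (auto simp: smooth_on_def intro: Ck_on_subset Ck_on_Un Ck_on_const Ck_on_linear Ck_on_add
      Ck_on_mult Ck_on_sum Ck_on_inverse Ck_on_flat)

lemma smooth_on_diff:
  assumes "open U" "smooth_on f U" "smooth_on g U"
  shows "smooth_on (\<lambda>x. f x - g x) U"
  using smooth_on_add[OF assms(1,2) smooth_on_mult[OF assms(1) smooth_on_const[of "-1"] assms(3)]]
  by simp

section \<open>Symmetry of second derivatives\<close>

lemma DERIV_line:
  assumes "f differentiable (at (a + t *\<^sub>R v))"
  shows "((\<lambda>s. f (a + s *\<^sub>R v)) has_real_derivative dird v f (a + t *\<^sub>R v)) (at t)"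
proof -
  have "((\<lambda>s. a + s *\<^sub>R v) has_derivative (\<lambda>s. s *\<^sub>R v)) (at t)"
    by (auto intro!: derivative_eq_intros)
  from has_derivative_compose[OF this has_dird[OF assms]] show ?thesis
    using linear_dird[OF assms]
    by (simp add: has_field_derivative_def linear_scale mult.commute[of _ "dird v f _"])
qed

text \<open>The mean value theorem twice: along \<open>u\<close> for the difference of
  \<open>f\<close> on two parallel lines that are \<open>h\<close> times \<open>v\<close> apart,
  then along \<open>v\<close> for the derivative found there. The left side of the equation is
  symmetric in \<open>u\<close> and \<open>v\<close>.\<close>

lemma second_difference:
  assumes sm: "smooth_on f U" and h: "0 < h"
    and U: "\<And>s t. s \<in> {0..h} \<Longrightarrow> t \<in> {0..h} \<Longrightarrow> x + s *\<^sub>R u + t *\<^sub>R v \<in> U"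
  obtains s t where "s \<in> {0..h}" "t \<in> {0..h}"
    "f (x + h *\<^sub>R u + h *\<^sub>R v) - f (x + h *\<^sub>R u) - f (x + h *\<^sub>R v) + f x
      = h * h * dird v (dird u f) (x + s *\<^sub>R u + t *\<^sub>R v)"
proof -
  have U': "x + h *\<^sub>R v + s *\<^sub>R u \<in> U" "x + s *\<^sub>R u \<in> U" if "s \<in> {0..h}" for s
    using U[of s h] U[of s 0] that h by (auto simp: algebra_simps)
  have "((\<lambda>s. f (x + h *\<^sub>R v + s *\<^sub>R u) - f (x + s *\<^sub>R u)) has_real_derivative
      dird u f (x + h *\<^sub>R v + s *\<^sub>R u) - dird u f (x + s *\<^sub>R u)) (at s)"
    if "0 \<le> s" "s \<le> h" for s
    using U'[of s] that by (intro DERIV_diff DERIV_line smooth_on_differentiable[OF sm]) auto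
  from MVT2[OF h this] obtain s where s: "0 < s" "s < h"
    and 1: "f (x + h *\<^sub>R v + h *\<^sub>R u) - f (x + h *\<^sub>R u) - (f (x + h *\<^sub>R v) - f x)
      = h * (dird u f (x + h *\<^sub>R v + s *\<^sub>R u) - dird u f (x + s *\<^sub>R u))"
    by auto
  have "((\<lambda>t. dird u f (x + s *\<^sub>R u + t *\<^sub>R v)) has_real_derivative
      dird v (dird u f) (x + s *\<^sub>R u + t *\<^sub>R v)) (at t)"
    if "0 \<le> t" "t \<le> h" for t
    using U[of s t] that s
    by (intro DERIV_line smooth_on_differentiable[OF smooth_on_dird[OF sm]]) auto
  from MVT2[OF h this] obtain t where t: "0 < t" "t < h"
    and 2: "dird u f (x + s *\<^sub>R u + h *\<^sub>R v) - dird u f (x + s *\<^sub>R u)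
      = h * dird v (dird u f) (x + s *\<^sub>R u + t *\<^sub>R v)"
    by auto
  show thesis
    by (rule that[of s t]) (use s t 1 2 in \<open>auto simp: algebra_simps\<close>)
qed

text \<open>Schwarz's theorem. The second difference over a small parallelogram is h^2 times either
  mixed derivative, taken at two nearby points; continuity of both at \<open>x\<close> then excludes
  a gap.\<close>

lemma dird_commute:
  assumes U: "open U" "x \<in> U" and sm: "smooth_on f U"
  shows "dird u (dird v f) x = dird v (dird u f) x"
proof (rule ccontr)
  assume ne: "dird u (dird v f) x \<noteq> dird v (dird u f) x"
  define e where "e = \<bar>dird u (dird v f) x - dird v (dird u f) x\<bar> / 2"
  have e: "e > 0" using ne by (simp add: e_def)
  have "isCont (dird a (dird b f)) x" for a b
    using smooth_on_continuous[OF smooth_on_dird[OF smooth_on_dird[OF sm]]] U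
    by (simp add: continuous_on_eq_continuous_at)
  then have "\<forall>\<^sub>F y in at x. dist (dird a (dird b f) y) (dird a (dird b f) x) < e" for a b
    using e unfolding isCont_def tendsto_iff by blast
  then have "\<forall>\<^sub>F y in nhds x. dist (dird a (dird b f) y) (dird a (dird b f) x) < e" for a b
    using e by (auto simp: eventually_nhds_conv_at)
  then have "\<forall>\<^sub>F y in nhds x. dist (dird u (dird v f) y) (dird u (dird v f) x) < e \<and>
      dist (dird v (dird u f) y) (dird v (dird u f) x) < e \<and> y \<in> U"
    using eventually_nhds_in_open[OF U] by (intro eventually_conj) auto
  then obtain d where d: "d > 0"
    and D: "\<And>y. dist y x < d \<Longrightarrow> dist (dird u (dird v f) y) (dird u (dird v f) x) < e"
      "\<And>y. dist y x < d \<Longrightarrow> dist (dird v (dird u f) y) (dird v (dird u f) x) < e"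
      "\<And>y. dist y x < d \<Longrightarrow> y \<in> U"
    unfolding eventually_nhds_metric by blast
  \<comment> \<open>Every point of the parallelogram then lies within \<open>d\<close> of
    \<open>x\<close>; the summand 1 guards against \<open>u = v = 0\<close>.\<close>
  define h where "h = d / (norm u + norm v + 1)"
  have pos: "norm u + norm v + 1 > 0" by (simp add: add_nonneg_pos)
  then have h: "h > 0" using d by (simp add: h_def)
  have near: "dist (x + s *\<^sub>R a + t *\<^sub>R b) x < d"
    if "s \<in> {0..h}" "t \<in> {0..h}" "norm a + norm b = norm u + norm v" for s t a b
  proof -
    have "dist (x + s *\<^sub>R a + t *\<^sub>R b) x \<le> norm (s *\<^sub>R a) + norm (t *\<^sub>R b)"
      using norm_triangle_ineq[of "s *\<^sub>R a" "t *\<^sub>R b"] by (simp add: dist_norm add.assoc)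
    also have "\<dots> \<le> h * norm a + h * norm b"
      using that by (auto intro!: add_mono mult_right_mono)
    also have "\<dots> = h * (norm u + norm v)" using that by (simp add: distrib_left[symmetric])
    also have "\<dots> < h * (norm u + norm v + 1)" using h by simp
    also have "\<dots> = d" using pos by (simp add: h_def)
    finally show ?thesis .
  qed
  obtain s t where st: "s \<in> {0..h}" "t \<in> {0..h}"
    and 1: "f (x + h *\<^sub>R u + h *\<^sub>R v) - f (x + h *\<^sub>R u) - f (x + h *\<^sub>R v) + f x
      = h * h * dird v (dird u f) (x + s *\<^sub>R u + t *\<^sub>R v)"
    by (rule second_difference[OF sm h D(3)[OF near], of u v]) auto
  obtain s' t' where st': "s' \<in> {0..h}" "t' \<in> {0..h}"
    and 2: "f (x + h *\<^sub>R v + h *\<^sub>R u) - f (x + h *\<^sub>R v) - f (x + h *\<^sub>R u) + f x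
      = h * h * dird u (dird v f) (x + s' *\<^sub>R v + t' *\<^sub>R u)"
    by (rule second_difference[OF sm h D(3)[OF near], of v u]) auto
  have "h * h * dird v (dird u f) (x + s *\<^sub>R u + t *\<^sub>R v)
      = h * h * dird u (dird v f) (x + s' *\<^sub>R v + t' *\<^sub>R u)"
    unfolding 1[symmetric] 2[symmetric] by (simp add: algebra_simps)
  then have "dird v (dird u f) (x + s *\<^sub>R u + t *\<^sub>R v)
      = dird u (dird v f) (x + s' *\<^sub>R v + t' *\<^sub>R u)" using h by simp
  moreover have "\<bar>dird v (dird u f) (x + s *\<^sub>R u + t *\<^sub>R v) - dird v (dird u f) x\<bar> < e"
    using D(2)[OF near[OF st]] by (simp add: dist_real_def)
  moreover have "\<bar>dird u (dird v f) (x + s' *\<^sub>R v + t' *\<^sub>R u) - dird u (dird v f) x\<bar> < e"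
    using D(1)[OF near[OF st']] by (simp add: dist_real_def)
  ultimately show False unfolding e_def by argo
qed

lemma Ck_on_imp_continuous: "Ck_on k f U \<Longrightarrow> continuous_on U f"
  by (induction k) (auto dest!: Ck_on_Suc_imp simp del: Ck_on.simps(2))

section \<open>Weighted integrals along rays from a centre\<close>

definition star_at :: "'a::real_vector \<Rightarrow> 'a set \<Rightarrow> bool" where
  "star_at z W \<longleftrightarrow> (\<forall>x\<in>W. \<forall>t\<in>{0..1}. z + t *\<^sub>R (x - z) \<in> W)"

lemma star_atD: "star_at z W \<Longrightarrow> x \<in> W \<Longrightarrow> 0 \<le> t \<Longrightarrow> t \<le> 1 \<Longrightarrow> z + t *\<^sub>R (x - z) \<in> W"
  by (simp add: star_at_def)

lemma continuous_on_star:
  fixes f :: "'a::real_normed_vector \<Rightarrow> 'b::real_normed_vector"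
  assumes "star_at z W" "continuous_on W f" "V \<subseteq> W"
  shows "continuous_on (V \<times> {0..1}) (\<lambda>(x, t). f (z + t *\<^sub>R (x - z)))"
  unfolding split_beta
  by (rule continuous_on_compose2[OF assms(2)])
    (use assms(1,3) in \<open>auto intro!: continuous_intros star_atD\<close>)

lemma continuous_on_ray:
  fixes f :: "'a::real_normed_vector \<Rightarrow> 'b::real_normed_vector"
  assumes "star_at z W" "continuous_on W f" "x \<in> W"
  shows "continuous_on {0..1} (\<lambda>t. f (z + t *\<^sub>R (x - z)))"
  by (rule continuous_on_compose2[OF assms(2)])
    (use assms(1,3) in \<open>auto intro!: continuous_intros star_atD\<close>)

text \<open>The weight is a parameter since each derivative under the integral sign brings out
  another factor \<open>t\<close>.\<close>

definition ray_integral :: "'a \<Rightarrow> (real \<Rightarrow> real) \<Rightarrow> ('a::euclidean_space \<Rightarrow> real) \<Rightarrow> 'a \<Rightarrow> real" where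
  "ray_integral z c f x = integral {0..1} (\<lambda>t. c t * f (z + t *\<^sub>R (x - z)))"

lemma ray_integrable:
  fixes f :: "'a::real_normed_vector \<Rightarrow> real"
  assumes "star_at z W" "continuous_on W f" "x \<in> W" "continuous_on {0..1} c"
  shows "(\<lambda>t. c t * f (z + t *\<^sub>R (x - z)) :: real) integrable_on {0..1}"
  using continuous_on_ray[OF assms(1-3)] assms(4)
  by (intro integrable_continuous_real continuous_on_mult)

lemma has_derivative_ray_integral:
  assumes W: "open W" "star_at z W" and f: "Ck_on 1 f W" and c: "continuous_on {0..1} c"
    and x: "x \<in> W"
  shows "(ray_integral z c f has_derivative (\<lambda>v. ray_integral z (\<lambda>t. c t * t) (dird v f) x)) (at x)"
proof -
  obtain r where r: "r > 0" "ball x r \<subseteq> W" using W(1) x open_contains_ball by blast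
  \<comment> \<open>\<open>leibniz_rule\<close> takes the derivative as a continuous map into
    bounded linear maps, so the directional derivatives are bundled into one.\<close>
  define F where "F y = Blinfun (\<lambda>v. dird v f y)" for y
  have diff: "f differentiable (at y)" if "y \<in> W" for y using f that by simp
  have cd: "continuous_on W (dird v f)" for v using f by simp
  have cf: "continuous_on W f"
    using diff by (auto intro!: continuous_at_imp_continuous_on differentiable_imp_continuous_within)
  have F: "blinfun_apply (F y) = (\<lambda>v. dird v f y)" if "y \<in> W" for y
    unfolding F_def using bounded_linear_Blinfun_apply has_derivative_bounded_linear[OF has_dird[OF diff[OF that]]] by blast
  have "continuous_on W F"
    by (rule continuous_on_blinfun_componentwise) (use cd F in \<open>simp cong: continuous_on_cong\<close>)
  then have cF: "continuous_on (V \<times> {0..1}) (\<lambda>(x, t). (c t * t) *\<^sub>R F (z + t *\<^sub>R (x - z)))"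
    if "V \<subseteq> W" for V
    using continuous_on_star[OF W(2) _ that, of F] c
    by (auto simp: split_beta intro!: continuous_intros continuous_on_compose2[OF c])
  have "((\<lambda>x. integral (cbox 0 1) (\<lambda>t. c t * f (z + t *\<^sub>R (x - z)))) has_derivative
      integral (cbox 0 1) (\<lambda>t. (c t * t) *\<^sub>R F (z + t *\<^sub>R (x - z)))) (at x within ball x r)"
  proof (rule leibniz_rule)
    fix y t assume "y \<in> ball x r" "t \<in> cbox (0::real) 1"
    then have y: "z + t *\<^sub>R (y - z) \<in> W" using r star_atD[OF W(2), of y t] by auto
    have line: "((\<lambda>y. z + t *\<^sub>R (y - z)) has_derivative (\<lambda>v. t *\<^sub>R v)) (at y)"
      by (auto intro!: derivative_eq_intros)
    have F2: "blinfun_apply ((c t * t) *\<^sub>R F (z + t *\<^sub>R (y - z)))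
        = (\<lambda>v. c t * (t * dird v f (z + t *\<^sub>R (y - z))))"
      by (simp add: fun_eq_iff blinfun.scaleR_left F[OF y] mult.assoc)
    from has_derivative_mult_right[OF has_derivative_compose[OF line has_dird[OF diff[OF y]]], of "c t"]
    have "((\<lambda>y. c t * f (z + t *\<^sub>R (y - z))) has_derivative
      blinfun_apply ((c t * t) *\<^sub>R F (z + t *\<^sub>R (y - z)))) (at y)"
      using linear_dird[OF diff[OF y]]
      by (simp add: linear_scale mult.assoc F2)
    then show "((\<lambda>y. c t * f (z + t *\<^sub>R (y - z))) has_derivative
      blinfun_apply ((c t * t) *\<^sub>R F (z + t *\<^sub>R (y - z)))) (at y within ball x r)"
      by (rule has_derivative_at_withinI)
  next
    fix y assume "y \<in> ball x r"
    then show "(\<lambda>t. c t * f (z + t *\<^sub>R (y - z))) integrable_on cbox 0 1"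
      using r ray_integrable[OF W(2) cf _ c] by auto
  next
    show "continuous_on (ball x r \<times> cbox 0 1) (\<lambda>(x, t). (c t * t) *\<^sub>R F (z + t *\<^sub>R (x - z)))"
      using cF[OF r(2)] by simp
  qed (use r in auto)
  then have 1: "(ray_integral z c f has_derivative
      integral {0..1} (\<lambda>t. (c t * t) *\<^sub>R F (z + t *\<^sub>R (x - z)))) (at x)"
    using r by (simp add: ray_integral_def[abs_def] at_within_open[of x "ball x r"])
  have "blinfun_apply (integral {0..1} (\<lambda>t. (c t * t) *\<^sub>R F (z + t *\<^sub>R (x - z)))) v
      = ray_integral z (\<lambda>t. c t * t) (dird v f) x" for v
  proof -
    have int: "(\<lambda>t. (c t * t) *\<^sub>R F (z + t *\<^sub>R (x - z))) integrable_on {0..1}"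
      using c continuous_on_ray[OF W(2) \<open>continuous_on W F\<close> x]
      by (intro integrable_continuous_real continuous_intros)
    show ?thesis
      unfolding ray_integral_def blinfun_apply_integral[OF int]
      by (rule integral_cong) (use star_atD[OF W(2) x] in \<open>auto simp: F blinfun.scaleR_left\<close>)
  qed
  then show ?thesis using 1 by (metis (no_types, lifting) ext)
qed

lemma Ck_on_ray_integral:
  assumes "open W" "star_at z W" "Ck_on k f W" "continuous_on {0..1} c"
  shows "Ck_on k (ray_integral z c f) W"
  using assms(3,4)
proof (induction k arbitrary: f c)
  case 0
  have "continuous_on (W \<times> cbox 0 1) (\<lambda>(x, t). c t * f (z + t *\<^sub>R (x - z)))"
    using continuous_on_star[OF assms(2), of f W] 0
    by (auto simp: split_beta intro!: continuous_intros continuous_on_compose2[OF 0(2)])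
  then show ?case
    using integral_continuous_on_param[of W 0 1 "\<lambda>x t. c t * f (z + t *\<^sub>R (x - z))"]
    by (simp add: ray_integral_def[abs_def])
next
  case (Suc k)
  have "Ck_on 1 f W"
    using Suc.prems(1) by (auto intro: Ck_on_imp_continuous)
  note * = has_derivative_ray_integral[OF assms(1,2) this Suc.prems(2)]
  have "Ck_on k (ray_integral z (\<lambda>t. c t * t) (dird v f)) W" for v
    using Suc.prems by (intro Suc.IH continuous_intros) auto
  then have "Ck_on k (dird v (ray_integral z c f)) W" for v
    by (rule Ck_on_cong[OF assms(1), rotated]) (simp add: dird_eqI[OF *])
  then show ?case using * by (auto intro: differentiableI)
qed

lemma smooth_on_ray_integral:
  "open W \<Longrightarrow> star_at z W \<Longrightarrow> smooth_on f W \<Longrightarrow> continuous_on {0..1} c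
    \<Longrightarrow> smooth_on (ray_integral z c f) W"
  by (simp add: smooth_on_def Ck_on_ray_integral)

lemma dird_ray_integral:
  assumes "open W" "star_at z W" "smooth_on f W" "continuous_on {0..1} c" "x \<in> W"
  shows "dird v (ray_integral z c f) x = ray_integral z (\<lambda>t. c t * t) (dird v f) x"
proof -
  have "Ck_on 1 f W" using assms(3) unfolding smooth_on_def by blast
  from dird_eqI[OF has_derivative_ray_integral[OF assms(1,2) this assms(4,5)]] show ?thesis .
qed

section \<open>Alternating forms and the exterior derivative\<close>

definition ins :: "nat \<Rightarrow> 'a \<Rightarrow> (nat \<Rightarrow> 'a) \<Rightarrow> nat \<Rightarrow> 'a" where
  "ins k u v = (\<lambda>i. if i < k then v i else if i = k then u else v (i - 1))"

lemma ins_skip: "ins k (v k) (skip k v) = v"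
  by (auto simp: ins_def skip_def fun_eq_iff)

lemma skip_0_ins [simp]: "skip 0 (ins 0 u v) = v"
  by (auto simp: ins_def skip_def)

lemma skip_Suc_ins: "skip (Suc k) (ins 0 u v) = ins 0 u (skip k v)"
  by (auto simp: ins_def skip_def fun_eq_iff)

lemma ins_0_apply [simp]: "ins 0 u v 0 = u" "ins 0 u v (Suc k) = v k"
  by (auto simp: ins_def)

lemma ins_0_upd: "ins 0 u (v(i := y)) = (ins 0 u v)(Suc i := y)"
  by (auto simp: ins_def fun_eq_iff)

lemma ins_0_conv_upd: "ins 0 u v = (ins 0 w v)(0 := u)"
  by (auto simp: ins_def fun_eq_iff)

text \<open>The simplicial identity for omitting two entries in either order; it pairs the terms of
  the iterated exterior derivative.\<close>

lemma skip_skip: "k \<le> l \<Longrightarrow> skip k (skip (Suc l) v) = skip l (skip k v)"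
  by (auto simp: skip_def fun_eq_iff)

lemma skip_upd:
  "skip i (v(i := y)) = skip i v"
  "i \<noteq> k \<Longrightarrow> skip k (v(i := y)) = (skip k v)((if i < k then i else i - 1) := y)"
  by (auto simp: skip_def fun_eq_iff)

lemma alternating_cong:
  "f \<in> alternating_forms p \<Longrightarrow> (\<And>i. i < p \<Longrightarrow> v i = w i) \<Longrightarrow> f v = f w"
  and alternating_linear: "f \<in> alternating_forms p \<Longrightarrow> i < p \<Longrightarrow> linear (\<lambda>y. f (v(i := y)))"
  and alternating_eq_0:
    "f \<in> alternating_forms p \<Longrightarrow> i < j \<Longrightarrow> j < p \<Longrightarrow> v i = v j \<Longrightarrow> f v = 0"
  unfolding alternating_forms_def by blast+

lemma linear_cmult:
  fixes f :: "'a::real_vector \<Rightarrow> real"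
  shows "linear f \<Longrightarrow> linear (\<lambda>x. c * f x)"
  using linear_compose_scale_right[of f c] by simp

lemma subspace_alternating_forms: "subspace (alternating_forms p)"
  unfolding subspace_def alternating_forms_def
  by (auto simp: linear_compose_add linear_zero linear_cmult; metis)

text \<open>Polarization: the value on \<open>a + b\<close> in both slots is 0, and so are the two
  diagonal terms of its expansion.\<close>

lemma alternating_swap:
  assumes f: "f \<in> alternating_forms p" and ij: "i < j" "j < p"
  shows "f (v(i := a, j := b)) = - f (v(i := b, j := a))"
proof -
  define g where "g = (\<lambda>a b. f (v(i := a, j := b)))"
  have g1: "g (a + a') b = g a b + g a' b" for a a' b
    using linear_add[OF alternating_linear[OF f, of i "v(j := b)"]] ij
    unfolding g_def by (simp add: fun_upd_twist)
  have g2: "g a (b + b') = g a b + g a b'" for a b b'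
    using linear_add[OF alternating_linear[OF f, of j "v(i := a)"]] ij unfolding g_def by simp
  have g0: "g a a = 0" for a
    unfolding g_def by (rule alternating_eq_0[OF f ij]) (use ij in auto)
  have "g a b + g b a = g (a + b) (a + b)" by (simp only: g1 g2) (simp add: g0)
  also have "\<dots> = 0" by (rule g0)
  finally have "g a b + g b a = 0" .
  then show ?thesis by (simp add: g_def)
qed

text \<open>Carrying \<open>u\<close> to the front takes \<open>k\<close> swaps of
  neighbours.\<close>

lemma alternating_ins:
  assumes f: "f \<in> alternating_forms p" and "k < p"
  shows "f (ins k u v) = (-1) ^ k * f (ins 0 u v)"
  using assms(2)
proof (induction k)
  case (Suc k)
  have "ins (Suc k) u v = (ins k u v)(k := v k, Suc k := u)"
    "ins k u v = (ins k u v)(k := u, Suc k := v k)"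
    by (auto simp: ins_def fun_eq_iff)
  then have "f (ins (Suc k) u v) = - f (ins k u v)"
    using alternating_swap[OF f _ Suc.prems, of k "ins k u v" "v k" u] by simp
  then show ?case using Suc by simp
qed simp

lemma alternating_expand_0:
  assumes f: "f \<in> alternating_forms (Suc p)"
  shows "f (ins 0 u v) = (\<Sum>b\<in>Basis. (u \<bullet> b) * f (ins 0 b v))"
proof -
  have lin: "linear (\<lambda>y. f (ins 0 y v))"
    using alternating_linear[OF f, of 0 "ins 0 0 v"]
    by (simp add: ins_0_conv_upd[of _ v 0, symmetric])
  have "f (ins 0 u v) = f (ins 0 (\<Sum>b\<in>Basis. (u \<bullet> b) *\<^sub>R b) v)" by (simp add: euclidean_representation)
  also have "\<dots> = (\<Sum>b\<in>Basis. (u \<bullet> b) * f (ins 0 b v))"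
    using linear_sum[OF lin, of "\<lambda>b. (u \<bullet> b) *\<^sub>R b" Basis] linear_scale[OF lin] by simp
  finally show ?thesis .
qed

text \<open>This makes a form determined by finitely many values, which later bounds the dimension
  in degree 0.\<close>

lemma alternating_eqI_Basis:
  assumes f: "f \<in> alternating_forms p" and B: "\<And>v. (\<And>i. i < p \<Longrightarrow> v i \<in> Basis) \<Longrightarrow> f v = 0"
  shows "f v = 0"
proof -
  \<comment> \<open>The first \<open>k\<close> arguments are arbitrary and the others basis vectors.
    Each step frees one more argument by expanding it in the basis, and \<open>k = p\<close> is the
    claim.\<close>
  have "f v = 0" if "k \<le> p" "\<And>i. k \<le> i \<Longrightarrow> i < p \<Longrightarrow> v i \<in> Basis" for k v
    using that
  proof (induction k arbitrary: v)
    case 0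
    then show ?case by (intro B) simp
  next
    case (Suc k)
    have "f (v(k := b)) = 0" if "b \<in> Basis" for b
      using that Suc.prems by (intro Suc.IH) (auto simp: le_Suc_eq)
    moreover have "f v = (\<Sum>b\<in>Basis. (v k \<bullet> b) * f (v(k := b)))"
    proof -
      have lin: "linear (\<lambda>y. f (v(k := y)))" using alternating_linear[OF f] Suc.prems by simp
      have "f v = f (v(k := \<Sum>b\<in>Basis. (v k \<bullet> b) *\<^sub>R b))" by (simp add: euclidean_representation)
      also have "\<dots> = (\<Sum>b\<in>Basis. (v k \<bullet> b) * f (v(k := b)))"
        using linear_sum[OF lin, of "\<lambda>b. (v k \<bullet> b) *\<^sub>R b" Basis] linear_scale[OF lin] by simp
      finally show ?thesis .
    qed
    ultimately show ?case by simp
  qed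
  from this[of p v] show ?thesis by simp
qed

lemma smooth_form_alternating: "\<omega> \<in> smooth_forms p U \<Longrightarrow> \<omega> x \<in> alternating_forms p"
  using subspace_0[OF subspace_alternating_forms] unfolding smooth_forms_def by force

lemma smooth_form_smooth: "\<omega> \<in> smooth_forms p U \<Longrightarrow> smooth_on (\<lambda>x. \<omega> x v) U"
  and smooth_form_outside: "\<omega> \<in> smooth_forms p U \<Longrightarrow> x \<notin> U \<Longrightarrow> \<omega> x = 0"
  unfolding smooth_forms_def by auto

lemma smooth_form_differentiable:
  "\<omega> \<in> smooth_forms p U \<Longrightarrow> x \<in> U \<Longrightarrow> (\<lambda>x. \<omega> x v) differentiable (at x)"
  using smooth_form_smooth smooth_on_differentiable by blast

lemma smooth_formsI:
  assumes "\<And>x. x \<in> U \<Longrightarrow> \<omega> x \<in> alternating_forms p" "\<And>v. smooth_on (\<lambda>x. \<omega> x v) U"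
    "\<And>x. x \<notin> U \<Longrightarrow> \<omega> x = 0"
  shows "\<omega> \<in> smooth_forms p U"
  using assms unfolding smooth_forms_def by blast

lemma subspace_smooth_forms:
  assumes "open U"
  shows "subspace (smooth_forms p U)"
  unfolding subspace_def
proof (intro conjI ballI allI)
  show "0 \<in> smooth_forms p U"
    by (rule smooth_formsI)
      (auto simp: subspace_0[OF subspace_alternating_forms] smooth_on_const)
next
  fix \<omega> \<eta> assume "\<omega> \<in> smooth_forms p U" "\<eta> \<in> smooth_forms p U"
  then show "\<omega> + \<eta> \<in> smooth_forms p U"
    by (intro smooth_formsI)
      (auto simp: smooth_form_alternating smooth_form_smooth smooth_form_outside assms
        intro!: subspace_add[OF subspace_alternating_forms] smooth_on_add)
next
  fix c :: real and \<omega> assume "\<omega> \<in> smooth_forms p U"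
  then show "c *\<^sub>R \<omega> \<in> smooth_forms p U"
    by (intro smooth_formsI)
      (auto simp: smooth_form_alternating smooth_form_smooth smooth_form_outside assms
        intro!: subspace_scale[OF subspace_alternating_forms] smooth_on_mult smooth_on_const)
qed

lemma exterior_derivative_eq:
  "x \<in> U \<Longrightarrow> exterior_derivative p U \<omega> x v
    = (\<Sum>k\<le>p. (-1) ^ k * dird (v k) (\<lambda>y. \<omega> y (skip k v)) x)"
  by (simp add: exterior_derivative_def)

lemma exterior_derivative_alternating:
  assumes \<omega>: "\<omega> \<in> smooth_forms p U" and x: "x \<in> U"
  shows "exterior_derivative p U \<omega> x \<in> alternating_forms (Suc p)"
  unfolding alternating_forms_def mem_Collect_eq
proof (intro conjI allI impI)
  note alt = smooth_form_alternating[OF \<omega>]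
  fix v w :: "nat \<Rightarrow> 'a" assume "\<forall>i<Suc p. v i = w i"
  then have "\<omega> y (skip k v) = \<omega> y (skip k w)" "v k = w k" if "k \<le> p" for y k
    using that by (auto intro!: alternating_cong[OF alt] simp: skip_def)
  then show "exterior_derivative p U \<omega> x v = exterior_derivative p U \<omega> x w"
    using x by (simp add: exterior_derivative_eq)
next
  note alt = smooth_form_alternating[OF \<omega>] and diff = smooth_form_differentiable[OF \<omega> x]
  fix v :: "nat \<Rightarrow> 'a" and i assume i: "i < Suc p"
  have "linear (\<lambda>y. dird ((v(i := y)) k) (\<lambda>z. \<omega> z (skip k (v(i := y)))) x)" if k: "k \<le> p" for k
  \<comment> \<open>The varied vector is either the direction of differentiation or an argument of
    the form; in the second case it sits in slot \<open>i'\<close> once entry \<open>k\<close> is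
    omitted.\<close>
  proof (cases "k = i")
    case True
    then show ?thesis using linear_dird[OF diff] by (simp add: skip_upd)
  next
    case False
    define i' where "i' = (if i < k then i else i - 1)"
    have "i' < p" using i k False by (auto simp: i'_def)
    then have lin: "linear (\<lambda>y. \<omega> z ((skip k v)(i' := y)))" for z by (rule alternating_linear[OF alt])
    have "linear (\<lambda>y. dird (v k) (\<lambda>z. \<omega> z ((skip k v)(i' := y))) x)"
      by (rule linearI)
        (simp_all add: linear_add[OF lin] linear_scale[OF lin] dird_add diff dird_cmult)
    then show ?thesis using False by (simp add: skip_upd i'_def)
  qed
  then have "linear (\<lambda>y. \<Sum>k\<le>p. (-1) ^ k *\<^sub>R
      dird ((v(i := y)) k) (\<lambda>z. \<omega> z (skip k (v(i := y)))) x)"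
    by (intro linear_compose_sum ballI linear_compose_scale_right) auto
  then show "linear (\<lambda>y. exterior_derivative p U \<omega> x (v(i := y)))"
    using x by (simp add: exterior_derivative_eq)
next
  note alt = smooth_form_alternating[OF \<omega>]
  fix v :: "nat \<Rightarrow> 'a" and i j assume ij: "i < j \<and> j < Suc p \<and> v i = v j"
  \<comment> \<open>\<open>w\<close> omits both equal entries. Omitting only \<open>j\<close>, or
    only \<open>i\<close>, leaves \<open>w\<close> with the common vector at place \<open>i\<close>,
    or \<open>j - 1\<close>; the signs for moving it to the front make the terms \<open>i\<close>
    and \<open>j\<close> cancel.\<close>
  define w where "w = skip i (skip j v)"
  define G where "G = dird (v i) (\<lambda>y. \<omega> y (ins 0 (v i) w)) x"
  define T where "T k = (-1) ^ k * dird (v k) (\<lambda>y. \<omega> y (skip k v)) x" for k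
  obtain j' where j': "j = Suc j'" using ij by (cases j) auto
  have j1: "skip j v = ins i (v i) w"
    using ins_skip[of i "skip j v"] ij by (simp add: w_def skip_def)
  have i1: "skip i v = ins j' (v i) w"
    using ins_skip[of j' "skip i v"] skip_skip[of i j' v] ij by (simp add: w_def skip_def j')
  have "\<omega> y (skip j v) = (-1) ^ i * \<omega> y (ins 0 (v i) w)"
    "\<omega> y (skip i v) = (-1) ^ j' * \<omega> y (ins 0 (v i) w)" for y
    unfolding j1 i1 using ij j' by (auto intro!: alternating_ins[OF alt])
  then have "T i = (-1) ^ i * ((-1) ^ j' * G)" "T j = (-1) ^ j * ((-1) ^ i * G)"
    unfolding T_def G_def using ij
    by (simp_all add: dird_cmult smooth_form_differentiable[OF \<omega> x])
  then have Tij: "T i + T j = 0" by (simp add: j')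
  \<comment> \<open>Both equal entries survive in \<open>skip k v\<close>; an entry beyond
    \<open>k\<close> moves down by one place.\<close>
  have "T k = 0" if "k \<noteq> i" "k \<noteq> j" "k \<le> p" for k
  proof -
    have "\<omega> y (skip k v) = 0" for y
      by (rule alternating_eq_0[OF alt, of "if i < k then i else i - 1" "if j < k then j else j - 1"])
        (use that ij in \<open>auto simp: skip_def\<close>)
    then show ?thesis by (simp add: T_def frechet_derivative_const)
  qed
  then have "(\<Sum>k\<le>p. T k) = (\<Sum>k\<in>{i, j}. T k)"
    using ij by (intro sum.mono_neutral_right) auto
  also have "\<dots> = 0" using Tij ij by simp
  finally show "exterior_derivative p U \<omega> x v = 0"
    using x by (simp add: exterior_derivative_eq T_def)
qed

lemma exterior_derivative_smooth_forms:
  assumes U: "open U" and \<omega>: "\<omega> \<in> smooth_forms p U"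
  shows "exterior_derivative p U \<omega> \<in> smooth_forms (Suc p) U"
proof (rule smooth_formsI)
  fix v
  have "smooth_on (\<lambda>x. \<Sum>k\<le>p. (-1) ^ k * dird (v k) (\<lambda>y. \<omega> y (skip k v)) x) U"
    using smooth_form_smooth[OF \<omega>] U
    by (intro smooth_on_sum smooth_on_mult smooth_on_const smooth_on_dird) auto
  then show "smooth_on (\<lambda>x. exterior_derivative p U \<omega> x v) U"
    by (rule smooth_on_cong[OF U, rotated]) (simp add: exterior_derivative_eq)
qed (use exterior_derivative_alternating[OF \<omega>] in \<open>auto simp: exterior_derivative_def fun_eq_iff\<close>)

text \<open>Sending (k, l) with k \<le> l to (l + 1, k) is a bijection onto the index pairs whose
  first entry is the larger one, and it reverses the sign of \<open>S\<close>.\<close>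

lemma antisymmetric_double_sum:
  fixes S :: "nat \<Rightarrow> nat \<Rightarrow> real"
  assumes "\<And>k l. k \<le> l \<Longrightarrow> l \<le> p \<Longrightarrow> S k l = - S (Suc l) k"
  shows "(\<Sum>k\<le>Suc p. \<Sum>l\<le>p. S k l) = 0"
  using assms
proof (induction p)
  case 0
  then show ?case using 0[of 0 0] by simp
next
  case (Suc p)
  \<comment> \<open>The larger index range adds one row and one column, which cancel each
    other.\<close>
  have "(\<Sum>k\<le>Suc (Suc p). \<Sum>l\<le>Suc p. S k l)
      = (\<Sum>k\<le>Suc p. \<Sum>l\<le>p. S k l) + (\<Sum>k\<le>Suc p. S k (Suc p)) + (\<Sum>l\<le>Suc p. S (Suc (Suc p)) l)"
    by (simp add: sum.distrib algebra_simps)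
  also have "(\<Sum>k\<le>Suc p. S k (Suc p)) = - (\<Sum>l\<le>Suc p. S (Suc (Suc p)) l)"
    unfolding sum_negf[symmetric] by (rule sum.cong) (use Suc.prems in auto)
  also have "(\<Sum>k\<le>Suc p. \<Sum>l\<le>p. S k l) = 0" using Suc by simp
  finally show ?case by simp
qed

text \<open>Summands pair off under exchanging the two omitted entries: second derivatives commute,
  and the sign flips because one of the two positions shifts by one.\<close>

lemma exterior_derivative_exterior_derivative:
  assumes U: "open U" and \<omega>: "\<omega> \<in> smooth_forms p U"
  shows "exterior_derivative (Suc p) U (exterior_derivative p U \<omega>) = 0"
proof (intro ext)
  fix x v
  show "exterior_derivative (Suc p) U (exterior_derivative p U \<omega>) x v = 0 x v"
  proof (cases "x \<in> U")
    case False
    then show ?thesis by (simp add: exterior_derivative_def)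
  next
    case x: True
    define S where "S k l = (-1) ^ k * ((-1) ^ l *
      dird (v k) (dird (skip k v l) (\<lambda>z. \<omega> z (skip l (skip k v)))) x)" for k l
    have sm: "smooth_on (\<lambda>z. \<omega> z w) U" for w using smooth_form_smooth[OF \<omega>] .
    have "dird (v k) (\<lambda>y. exterior_derivative p U \<omega> y (skip k v)) x
        = dird (v k) (\<lambda>y. \<Sum>l\<le>p. (-1) ^ l * dird (skip k v l) (\<lambda>z. \<omega> z (skip l (skip k v))) y) x" for k
      by (rule dird_cong_open(1)[OF U x]) (simp add: exterior_derivative_eq)
    also have "\<dots> k = (\<Sum>l\<le>p. (-1) ^ l *
        dird (v k) (dird (skip k v l) (\<lambda>z. \<omega> z (skip l (skip k v)))) x)" for k
      using smooth_on_differentiable[OF smooth_on_dird[OF sm] x]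
      by (subst dird_sum) (auto simp: dird_cmult intro!: differentiable_mult)
    finally have "exterior_derivative (Suc p) U (exterior_derivative p U \<omega>) x v
        = (\<Sum>k\<le>Suc p. \<Sum>l\<le>p. S k l)"
      unfolding exterior_derivative_eq[OF x, of "Suc p"] S_def
      by (simp add: sum_distrib_left del: sum.atMost_Suc)
    also have "\<dots> = 0"
    proof (rule antisymmetric_double_sum)
      fix k l assume kl: "k \<le> l" "l \<le> p"
      then show "S k l = - S (Suc l) k"
        using dird_commute[OF U x sm[of "skip l (skip k v)"], of "v k" "v (Suc l)"]
        by (simp add: S_def skip_skip) (simp add: skip_def)
    qed
    finally show ?thesis by simp
  qed
qed

section \<open>The homotopy operator of the Poincare lemma\<close>

text \<open>Poincare's operator for the contraction to \<open>z\<close>. Pulling back along the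
  contraction scales each of the \<open>p\<close> remaining vectors by \<open>t\<close>, whence the
  weight t^p; \<open>p\<close> is the degree of the result, one less than that of
  \<open>\<omega>\<close>.\<close>

definition homotopy ::
    "'a::euclidean_space \<Rightarrow> nat \<Rightarrow> 'a set \<Rightarrow> ('a \<Rightarrow> (nat \<Rightarrow> 'a) \<Rightarrow> real) \<Rightarrow> 'a \<Rightarrow> (nat \<Rightarrow> 'a) \<Rightarrow> real"
  where
  "homotopy z p W \<omega> = (\<lambda>x v. if x \<in> W
     then ray_integral z (\<lambda>t. t ^ p) (\<lambda>y. \<omega> y (ins 0 (x - z) v)) x else 0)"

lemma ray_integral_cong:
  assumes "star_at z W" "x \<in> W" "\<And>y. y \<in> W \<Longrightarrow> f y = g y"
  shows "ray_integral z c f x = ray_integral z c g x"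
  unfolding ray_integral_def by (rule integral_cong) (use star_atD[OF assms(1,2)] assms(3) in auto)

lemma ray_integral_add:
  assumes "star_at z W" "x \<in> W" "continuous_on W f" "continuous_on W g" "continuous_on {0..1} c"
  shows "ray_integral z c (\<lambda>y. f y + g y) x = ray_integral z c f x + ray_integral z c g x"
  unfolding ray_integral_def distrib_left using assms
  by (intro integral_add ray_integrable)

lemma ray_integral_cmult:
  "ray_integral z c (\<lambda>y. a * f y) x = a * ray_integral z c f x"
  unfolding ray_integral_def by (simp add: mult.left_commute[of _ a])

lemma ray_integral_0 [simp]: "ray_integral z c (\<lambda>y. 0) x = 0"
  by (simp add: ray_integral_def)

lemma ray_integral_sum:
  assumes "star_at z W" "x \<in> W" "\<And>i. i \<in> I \<Longrightarrow> continuous_on W (f i)" "continuous_on {0..1} c"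
  shows "ray_integral z c (\<lambda>y. \<Sum>i\<in>I. f i y) x = (\<Sum>i\<in>I. ray_integral z c (f i) x)"
  using assms(3)
  by (induction I rule: infinite_finite_induct)
    (auto simp: ray_integral_add[OF assms(1,2) _ _ assms(4)] continuous_on_sum)

context
  fixes z :: "'a::euclidean_space" and W :: "'a set"
  assumes W: "open W" "star_at z W"
begin

lemma smooth_form_continuous: "\<omega> \<in> smooth_forms p W \<Longrightarrow> continuous_on W (\<lambda>y. \<omega> y v)"
  by (rule smooth_on_continuous[OF smooth_form_smooth])

text \<open>In \<open>homotopy\<close> the point \<open>x\<close> also enters through the inserted
  vector \<open>x - z\<close>. Expanding that vector in the basis leaves ray integrals of fixed
  functions with coefficients affine in \<open>x\<close>, to which the rules for derivatives
  apply.\<close>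

lemma homotopy_expand:
  assumes \<omega>: "\<omega> \<in> smooth_forms (Suc p) W" and x: "x \<in> W"
  shows "homotopy z p W \<omega> x v
    = (\<Sum>b\<in>Basis. ((x - z) \<bullet> b) * ray_integral z (\<lambda>t. t ^ p) (\<lambda>y. \<omega> y (ins 0 b v)) x)"
proof -
  have "homotopy z p W \<omega> x v
    = ray_integral z (\<lambda>t. t ^ p) (\<lambda>y. \<Sum>b\<in>Basis. ((x - z) \<bullet> b) * \<omega> y (ins 0 b v)) x"
    using x alternating_expand_0[OF smooth_form_alternating[OF \<omega>], of _ "x - z" v]
    by (simp add: homotopy_def)
  also have "\<dots> = (\<Sum>b\<in>Basis. ray_integral z (\<lambda>t. t ^ p) (\<lambda>y. ((x - z) \<bullet> b) * \<omega> y (ins 0 b v)) x)"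
    by (rule ray_integral_sum[OF W(2) x])
      (auto intro!: continuous_intros smooth_form_continuous[OF \<omega>])
  finally show ?thesis by (simp only: ray_integral_cmult)
qed

lemma homotopy_smooth_forms:
  assumes \<omega>: "\<omega> \<in> smooth_forms (Suc p) W"
  shows "homotopy z p W \<omega> \<in> smooth_forms p W"
proof (rule smooth_formsI)
  note alt = smooth_form_alternating[OF \<omega>] and cont = smooth_form_continuous[OF \<omega>]
  fix x assume x: "x \<in> W"
  show "homotopy z p W \<omega> x \<in> alternating_forms p"
    unfolding alternating_forms_def mem_Collect_eq
  proof (intro conjI allI impI)
    fix v w :: "nat \<Rightarrow> 'a" assume "\<forall>i<p. v i = w i"
    then have "\<omega> y (ins 0 u v) = \<omega> y (ins 0 u w)" for y u
      by (intro alternating_cong[OF alt]) (auto simp: ins_def)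
    then show "homotopy z p W \<omega> x v = homotopy z p W \<omega> x w" by (simp add: homotopy_def)
  next
    fix v :: "nat \<Rightarrow> 'a" and i assume "i < p"
    then have lin: "linear (\<lambda>y. \<omega> u (ins 0 a (v(i := y))))" for u a
      unfolding ins_0_upd by (intro alternating_linear[OF alt]) simp
    have "linear (\<lambda>y. ray_integral z (\<lambda>t. t ^ p) (\<lambda>u. \<omega> u (ins 0 (x - z) (v(i := y)))) x)"
      by (rule linearI)
        (simp_all add: linear_add[OF lin] linear_scale[OF lin] ray_integral_cmult
          ray_integral_add[OF W(2) x cont cont] continuous_intros)
    then show "linear (\<lambda>y. homotopy z p W \<omega> x (v(i := y)))" using x by (simp add: homotopy_def)
  next
    fix v :: "nat \<Rightarrow> 'a" and i j assume "i < j \<and> j < p \<and> v i = v j"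
    then have "\<omega> y (ins 0 u v) = 0" for y u
      by (intro alternating_eq_0[OF alt, of "Suc i" "Suc j"]) auto
    then show "homotopy z p W \<omega> x v = 0" by (simp add: homotopy_def)
  qed
next
  fix v
  have "smooth_on (\<lambda>x. x \<bullet> b - z \<bullet> b) W" for b
    by (intro smooth_on_diff W smooth_on_linear smooth_on_const bounded_linear.linear
        bounded_linear_inner_left)
  then have "smooth_on (\<lambda>x. \<Sum>b\<in>Basis. ((x - z) \<bullet> b) *
      ray_integral z (\<lambda>t. t ^ p) (\<lambda>y. \<omega> y (ins 0 b v)) x) W"
    unfolding inner_diff_left
    by (intro smooth_on_sum smooth_on_mult smooth_on_ray_integral W smooth_form_smooth[OF \<omega>]
        continuous_intros)
  then show "smooth_on (\<lambda>x. homotopy z p W \<omega> x v) W"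
    by (rule smooth_on_cong[OF W(1), rotated]) (simp add: homotopy_expand[OF \<omega>])
qed (auto simp: homotopy_def)

text \<open>Product rule for the expansion: the first summand differentiates the coefficients, the
  second the ray integrals, where the chain rule adds a factor \<open>t\<close>.\<close>

lemma dird_homotopy:
  assumes \<omega>: "\<omega> \<in> smooth_forms (Suc p) W" and x: "x \<in> W"
  shows "dird u (\<lambda>x. homotopy z p W \<omega> x v) x
    = ray_integral z (\<lambda>t. t ^ p) (\<lambda>y. \<omega> y (ins 0 u v)) x
      + ray_integral z (\<lambda>t. t ^ Suc p) (dird u (\<lambda>y. \<omega> y (ins 0 (x - z) v))) x"
proof -
  note sm = smooth_form_smooth[OF \<omega>] and diff = smooth_form_differentiable[OF \<omega>]
  have c: "continuous_on {0..1} (\<lambda>t::real. t ^ p)" "continuous_on {0..1} (\<lambda>t::real. t ^ Suc p)"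
    by (intro continuous_intros)+
  define r where "r b = ray_integral z (\<lambda>t. t ^ p) (\<lambda>y. \<omega> y (ins 0 b v))" for b
  define s where "s b = ray_integral z (\<lambda>t. t ^ Suc p) (dird u (\<lambda>y. \<omega> y (ins 0 b v))) x" for b
  have r: "r b differentiable (at x)" "dird u (r b) x = s b" for b
    unfolding r_def s_def using x
    by (auto intro!: smooth_on_differentiable[OF smooth_on_ray_integral] W sm c
        simp: dird_ray_integral[OF W sm c(1)] mult.commute)
  have "((\<lambda>x. (x - z) \<bullet> b) has_derivative (\<lambda>u. u \<bullet> b)) (at x)" for b
    by (auto intro!: derivative_eq_intros)
  then have i: "(\<lambda>x. (x - z) \<bullet> b) differentiable (at x)" "dird u (\<lambda>x. (x - z) \<bullet> b) x = u \<bullet> b" for b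
    using dird_eqI by (blast intro: differentiableI)+
  have "dird u (\<lambda>x. homotopy z p W \<omega> x v) x = dird u (\<lambda>x. \<Sum>b\<in>Basis. ((x - z) \<bullet> b) * r b x) x"
    by (rule dird_cong_open(1)[OF W(1) x]) (simp add: homotopy_expand[OF \<omega>] r_def)
  also have "\<dots> = (\<Sum>b\<in>Basis. (u \<bullet> b) * r b x) + (\<Sum>b\<in>Basis. ((x - z) \<bullet> b) * s b)"
    using i r by (subst dird_sum) (auto simp: dird_mult sum.distrib intro!: differentiable_mult)
  also have "(\<Sum>b\<in>Basis. (u \<bullet> b) * r b x) = ray_integral z (\<lambda>t. t ^ p) (\<lambda>y. \<omega> y (ins 0 u v)) x"
    unfolding r_def alternating_expand_0[OF smooth_form_alternating[OF \<omega>], of _ u v]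
      ray_integral_cmult[symmetric]
    by (rule ray_integral_sum[OF W(2) x, symmetric])
      (auto intro!: continuous_intros smooth_form_continuous[OF \<omega>])
  also have "(\<Sum>b\<in>Basis. ((x - z) \<bullet> b) * s b)
      = ray_integral z (\<lambda>t. t ^ Suc p) (\<lambda>y. \<Sum>b\<in>Basis. ((x - z) \<bullet> b) * dird u (\<lambda>y. \<omega> y (ins 0 b v)) y) x"
    unfolding s_def ray_integral_cmult[symmetric]
    by (rule ray_integral_sum[OF W(2) x, symmetric])
      (auto intro!: continuous_intros smooth_on_continuous[OF smooth_on_dird[OF sm]])
  also have "\<dots> = ray_integral z (\<lambda>t. t ^ Suc p) (dird u (\<lambda>y. \<omega> y (ins 0 (x - z) v))) x"
    unfolding alternating_expand_0[OF smooth_form_alternating[OF \<omega>], of _ "x - z" v]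
    by (rule ray_integral_cong[OF W(2) x])
      (auto simp: dird_sum dird_cmult diff intro!: differentiable_mult)
  finally show ?thesis .
qed

text \<open>The terms of both operators that differentiate along some \<open>v k\<close> cancel.
  What remains is the integral over [0, 1] of the \<open>t\<close>-derivative of t^(p + 1)
  \<omega>(z + t(x - z); v); the power of \<open>t\<close> removes the value at 0.\<close>

lemma homotopy_formula:
  assumes \<omega>: "\<omega> \<in> smooth_forms (Suc p) W" and x: "x \<in> W"
  shows "exterior_derivative p W (homotopy z p W \<omega>) x v
    + homotopy z (Suc p) W (exterior_derivative (Suc p) W \<omega>) x v = \<omega> x v"
proof -
  note sm = smooth_form_smooth[OF \<omega>] and diff = smooth_form_differentiable[OF \<omega>]
  note cont = smooth_form_continuous[OF \<omega>]
  have cont': "continuous_on W (dird a (\<lambda>y. \<omega> y w))" for a w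
    using smooth_on_continuous[OF smooth_on_dird[OF sm]] .
  have c: "continuous_on {0..1} (\<lambda>t::real. t ^ p)" "continuous_on {0..1} (\<lambda>t::real. t ^ Suc p)"
    by (intro continuous_intros)+
  define e where "e = x - z"
  define g where "g = (\<lambda>k. dird (v k) (\<lambda>y. \<omega> y (ins 0 e (skip k v))))"
  \<comment> \<open>Moving \<open>v k\<close> back to its place shows that the first summand of
    \<open>dird_homotopy\<close> contributes the same for all \<open>p + 1\<close> values of
    \<open>k\<close>, whence the factor \<open>real (Suc p)\<close>.\<close>
  have "(-1) ^ k * \<omega> y (ins 0 (v k) (skip k v)) = \<omega> y v" if "k \<le> p" for k y
    using alternating_ins[OF smooth_form_alternating[OF \<omega>], of k y "v k" "skip k v"] that
    by (simp add: ins_skip)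
  then have "(-1) ^ k * ray_integral z (\<lambda>t. t ^ p) (\<lambda>y. \<omega> y (ins 0 (v k) (skip k v))) x
      = ray_integral z (\<lambda>t. t ^ p) (\<lambda>y. \<omega> y v) x" if "k \<le> p" for k
    using that by (simp add: ray_integral_cmult[symmetric])
  then have 1: "exterior_derivative p W (homotopy z p W \<omega>) x v
      = real (Suc p) * ray_integral z (\<lambda>t. t ^ p) (\<lambda>y. \<omega> y v) x
        + (\<Sum>k\<le>p. (-1) ^ k * ray_integral z (\<lambda>t. t ^ Suc p) (g k) x)"
    using x by (simp add: exterior_derivative_eq dird_homotopy[OF \<omega>] distrib_left sum.distrib
        g_def e_def del: power_Suc)
  have "homotopy z (Suc p) W (exterior_derivative (Suc p) W \<omega>) x v
      = ray_integral z (\<lambda>t. t ^ Suc p) (\<lambda>y. exterior_derivative (Suc p) W \<omega> y (ins 0 e v)) x"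
    using x by (simp add: homotopy_def e_def)
  \<comment> \<open>Summand 0 of the exterior derivative differentiates along \<open>e\<close>.
    Summand \<open>k + 1\<close> omits \<open>v k\<close> and has the sign opposite to the one in
    \<open>1\<close>.\<close>
  also have "\<dots> = ray_integral z (\<lambda>t. t ^ Suc p) (\<lambda>y. dird e (\<lambda>y. \<omega> y v) y
        + (\<Sum>k\<le>p. (- ((-1) ^ k)) * g k y)) x"
    by (rule ray_integral_cong[OF W(2) x])
      (simp add: exterior_derivative_eq sum.atMost_Suc_shift skip_Suc_ins g_def del: sum.atMost_Suc)
  also have "\<dots> = ray_integral z (\<lambda>t. t ^ Suc p) (dird e (\<lambda>y. \<omega> y v)) x
        + (\<Sum>k\<le>p. (- ((-1) ^ k)) * ray_integral z (\<lambda>t. t ^ Suc p) (g k) x)"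
    using cont' unfolding ray_integral_cmult[symmetric]
    by (subst ray_integral_add[OF W(2) x], (auto simp: g_def intro!: continuous_intros)[3])
      (auto simp: g_def intro!: ray_integral_sum[OF W(2) x] continuous_intros)
  finally have 2: "exterior_derivative p W (homotopy z p W \<omega>) x v
      + homotopy z (Suc p) W (exterior_derivative (Suc p) W \<omega>) x v
      = real (Suc p) * ray_integral z (\<lambda>t. t ^ p) (\<lambda>y. \<omega> y v) x
        + ray_integral z (\<lambda>t. t ^ Suc p) (dird e (\<lambda>y. \<omega> y v)) x"
    unfolding 1 by (simp add: sum_negf)
  define G where "G t = real (Suc p) * (t ^ p * \<omega> (z + t *\<^sub>R e) v)
        + t ^ Suc p * dird e (\<lambda>y. \<omega> y v) (z + t *\<^sub>R e)" for t
  have "(G has_integral (1 ^ Suc p * \<omega> (z + 1 *\<^sub>R e) v - 0 ^ Suc p * \<omega> (z + 0 *\<^sub>R e) v)) {0..1}"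
  proof (rule fundamental_theorem_of_calculus)
    fix t :: real assume "t \<in> {0..1}"
    then have "z + t *\<^sub>R e \<in> W" using star_atD[OF W(2) x] by (auto simp: e_def)
    from DERIV_mult[OF DERIV_power_Suc[OF DERIV_ident, where n = p] DERIV_line[OF diff[OF this]]]
    have "((\<lambda>t. t ^ Suc p * \<omega> (z + t *\<^sub>R e) v) has_real_derivative G t) (at t)"
      by (simp add: G_def algebra_simps)
    then show "((\<lambda>t. t ^ Suc p * \<omega> (z + t *\<^sub>R e) v) has_vector_derivative G t) (at t within {0..1})"
      unfolding has_real_derivative_iff_has_vector_derivative
      by (rule has_vector_derivative_at_within)
  qed simp
  then have "integral {0..1} G = \<omega> x v" by (simp add: e_def integral_unique)
  moreover have "integral {0..1} G = real (Suc p) * ray_integral z (\<lambda>t. t ^ p) (\<lambda>y. \<omega> y v) x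
        + ray_integral z (\<lambda>t. t ^ Suc p) (dird e (\<lambda>y. \<omega> y v)) x"
    unfolding G_def ray_integral_def e_def integral_mult_right[symmetric]
    by (intro integral_add integrable_on_cmult_left ray_integrable[OF W(2) _ x] cont cont' c
        ray_integrable[OF W(2) cont x c(1), THEN integrable_on_mult_right])
  ultimately show ?thesis using 2 by simp
qed

end

section \<open>Superforms\<close>

definition slice :: "(nat \<Rightarrow> 'a) \<Rightarrow> 'a superform \<Rightarrow> 'a \<Rightarrow> (nat \<Rightarrow> 'a) \<Rightarrow> real" where
  "slice w \<alpha> = (\<lambda>x v. \<alpha> x v w)"

text \<open>For linear \<open>T\<close> this is \<open>T \<otimes> id\<close>, with \<open>w\<close>
  as a parameter.\<close>

definition lift ::
    "(('a \<Rightarrow> (nat \<Rightarrow> 'a) \<Rightarrow> real) \<Rightarrow> 'a \<Rightarrow> (nat \<Rightarrow> 'a) \<Rightarrow> real) \<Rightarrow> 'a superform \<Rightarrow> 'a superform" where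
  "lift T \<alpha> = (\<lambda>x v w. T (slice w \<alpha>) x v)"

lemma slice_apply [simp]: "slice w \<alpha> x v = \<alpha> x v w"
  by (simp add: slice_def)

lemma slice_linear [simp]:
  "slice w 0 = 0" "slice w (\<alpha> + \<beta>) = slice w \<alpha> + slice w \<beta>" "slice w (c *\<^sub>R \<alpha>) = c *\<^sub>R slice w \<alpha>"
  "slice w (tensor \<omega> \<eta>) = \<eta> w *\<^sub>R \<omega>"
  by (auto simp: fun_eq_iff tensor_def)

lemma dprime_eq_lift: "dprime p U = lift (exterior_derivative p U)"
  by (simp add: dprime_def lift_def slice_def fun_eq_iff)

lemma subspace_superforms: "subspace (superforms p q U)"
  by (simp add: superforms_def)

lemma tensor_superforms:
  "\<omega> \<in> smooth_forms p U \<Longrightarrow> \<eta> \<in> alternating_forms q \<Longrightarrow> tensor \<omega> \<eta> \<in> superforms p q U"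
  unfolding superforms_def by (rule span_base) blast

lemma superforms_induct [consumes 1, case_names zero step]:
  assumes "\<alpha> \<in> superforms p q U" "P 0"
    "\<And>c \<omega> \<eta> \<beta>. \<omega> \<in> smooth_forms p U \<Longrightarrow> \<eta> \<in> alternating_forms q \<Longrightarrow> \<beta> \<in> superforms p q U
      \<Longrightarrow> P \<beta> \<Longrightarrow> P (c *\<^sub>R tensor \<omega> \<eta> + \<beta>)"
  shows "P \<alpha>"
proof -
  have "\<alpha> \<in> superforms p q U \<and> P \<alpha>"
    using assms(1) unfolding superforms_def
  proof (induction rule: span_induct_alt)
    case base
    show ?case using assms(2) span_zero by blast
  next
    case (step c a b)
    then obtain \<omega> \<eta> where a: "a = tensor \<omega> \<eta>" "\<omega> \<in> smooth_forms p U" "\<eta> \<in> alternating_forms q"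
      by blast
    have b: "b \<in> superforms p q U" "P b" using step by (auto simp: superforms_def)
    have "c *\<^sub>R tensor \<omega> \<eta> + b \<in> superforms p q U"
      using a b by (intro subspace_add[OF subspace_superforms] subspace_scale[OF subspace_superforms]
          tensor_superforms)
    then show ?case using assms(3)[OF a(2,3) b] unfolding a(1) superforms_def by blast
  qed
  then show ?thesis ..
qed

lemma slice_smooth_forms:
  assumes "open U" "\<alpha> \<in> superforms p q U"
  shows "slice w \<alpha> \<in> smooth_forms p U"
  using assms(2)
proof (induction rule: superforms_induct)
  case zero
  show ?case unfolding slice_linear(1) by (rule subspace_0[OF subspace_smooth_forms[OF assms(1)]])
next
  case (step c \<omega> \<eta> \<beta>)
  then show ?case
    unfolding slice_linear
    by (intro subspace_add[OF subspace_smooth_forms[OF assms(1)]]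
        subspace_scale[OF subspace_smooth_forms[OF assms(1)]])
qed

lemma superform_alternating:
  assumes "\<alpha> \<in> superforms p q U"
  shows "\<alpha> x v \<in> alternating_forms q"
  using assms
proof (induction rule: superforms_induct)
  case zero
  show ?case using subspace_0[OF subspace_alternating_forms] by (simp add: zero_fun_def)
next
  case (step c \<omega> \<eta> \<beta>)
  have "(c *\<^sub>R tensor \<omega> \<eta> + \<beta>) x v = c *\<^sub>R \<omega> x v *\<^sub>R \<eta> + \<beta> x v"
    by (simp add: tensor_def fun_eq_iff)
  then show ?case using step
    by (simp only:) (intro subspace_add[OF subspace_alternating_forms]
        subspace_scale[OF subspace_alternating_forms])
qed

text \<open>On a product, \<open>lift T\<close> acts on the first factor only, and products span.
  Linearity is asked on smooth forms alone, because derivatives and integrals are additive only for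
  sufficiently regular forms.\<close>

lemma lift_superforms:
  assumes U: "open U"
    and T: "\<And>\<omega>. \<omega> \<in> smooth_forms p U \<Longrightarrow> T \<omega> \<in> smooth_forms p' U'"
    and add: "\<And>\<omega> \<omega>'. \<omega> \<in> smooth_forms p U \<Longrightarrow> \<omega>' \<in> smooth_forms p U \<Longrightarrow> T (\<omega> + \<omega>') = T \<omega> + T \<omega>'"
    and scale: "\<And>c \<omega>. \<omega> \<in> smooth_forms p U \<Longrightarrow> T (c *\<^sub>R \<omega>) = c *\<^sub>R T \<omega>"
    and \<alpha>: "\<alpha> \<in> superforms p q U"
  shows "lift T \<alpha> \<in> superforms p' q U'"
  using \<alpha>
proof (induction rule: superforms_induct)
  case zero
  have "T 0 = 0" using scale[OF subspace_0[OF subspace_smooth_forms[OF U]], of 0] by simp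
  then have "lift T 0 = 0" by (simp add: lift_def fun_eq_iff)
  then show ?case using subspace_0[OF subspace_superforms] by metis
next
  case (step c \<omega> \<eta> \<beta>)
  note sub = subspace_smooth_forms[OF U]
  have "lift T (c *\<^sub>R tensor \<omega> \<eta> + \<beta>) = c *\<^sub>R tensor (T \<omega>) \<eta> + lift T \<beta>"
  proof (intro ext)
    fix x v w
    have "T (slice w (c *\<^sub>R tensor \<omega> \<eta> + \<beta>)) = c *\<^sub>R \<eta> w *\<^sub>R T \<omega> + T (slice w \<beta>)"
      using step slice_smooth_forms[OF U step(3)]
      by (simp only: slice_linear add scale subspace_scale[OF sub])
    then show "lift T (c *\<^sub>R tensor \<omega> \<eta> + \<beta>) x v w = (c *\<^sub>R tensor (T \<omega>) \<eta> + lift T \<beta>) x v w"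
      by (simp add: lift_def tensor_def)
  qed
  then show ?case using step T
    by (simp only:) (intro subspace_add[OF subspace_superforms] subspace_scale[OF subspace_superforms]
        tensor_superforms)
qed

lemma exterior_derivative_add:
  assumes "\<omega> \<in> smooth_forms p U" "\<omega>' \<in> smooth_forms p U"
  shows "exterior_derivative p U (\<omega> + \<omega>') = exterior_derivative p U \<omega> + exterior_derivative p U \<omega>'"
  by (auto simp: fun_eq_iff exterior_derivative_def dird_add sum.distrib distrib_left
      smooth_form_differentiable[OF assms(1)] smooth_form_differentiable[OF assms(2)])

lemma exterior_derivative_scale:
  assumes "\<omega> \<in> smooth_forms p U"
  shows "exterior_derivative p U (c *\<^sub>R \<omega>) = c *\<^sub>R exterior_derivative p U \<omega>"
  by (auto simp: fun_eq_iff exterior_derivative_def dird_cmult sum_distrib_left mult.left_commute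
      smooth_form_differentiable[OF assms(1)])

lemma dprime_superforms:
  "open U \<Longrightarrow> \<alpha> \<in> superforms p q U \<Longrightarrow> dprime p U \<alpha> \<in> superforms (Suc p) q U"
  unfolding dprime_eq_lift
  by (rule lift_superforms)
    (auto simp: exterior_derivative_smooth_forms exterior_derivative_add exterior_derivative_scale)

lemma dprime_dprime:
  assumes "open U" "\<alpha> \<in> superforms p q U"
  shows "dprime (Suc p) U (dprime p U \<alpha>) = 0"
proof -
  have *: "slice w (dprime p U \<alpha>) = exterior_derivative p U (slice w \<alpha>)" for w
    by (simp add: dprime_eq_lift lift_def fun_eq_iff)
  show ?thesis
    by (intro ext) (simp add: dprime_eq_lift[of "Suc p"] lift_def[of "exterior_derivative (Suc p) U"] *
        exterior_derivative_exterior_derivative[OF assms(1) slice_smooth_forms[OF assms]])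
qed

lemma dprime_cong_open:
  assumes "open Y" "x \<in> Y" "Y \<subseteq> U" "Y \<subseteq> V" "\<And>y. y \<in> Y \<Longrightarrow> \<alpha> y = \<beta> y"
  shows "dprime p U \<alpha> x = dprime p V \<beta> x"
proof (intro ext)
  fix v w
  have "dird (v k) (\<lambda>y. \<alpha> y (skip k v) w) x = dird (v k) (\<lambda>y. \<beta> y (skip k v) w) x" for k
    by (rule dird_cong_open(1)[OF assms(1,2)]) (simp add: assms(5))
  then show "dprime p U \<alpha> x v w = dprime p V \<beta> x v w"
    using assms(2-4) by (auto simp: dprime_def exterior_derivative_def)
qed

text \<open>Extension by zero: the product is smooth on \<open>V \<inter> Y\<close> and identically
  0 on \<open>N \<inter> Y\<close>, and these two open sets cover the domain.\<close>

lemma cutoff_superforms: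
  assumes op: "open V" "open N" "open Y" and \<phi>: "smooth_on \<phi> Y"
    and N: "\<And>x. x \<in> N \<Longrightarrow> x \<in> Y \<Longrightarrow> \<phi> x = 0" and \<alpha>: "\<alpha> \<in> superforms p q V"
  shows "(\<lambda>x v w. if x \<in> (V \<union> N) \<inter> Y then \<phi> x * \<alpha> x v w else 0) \<in> superforms p q ((V \<union> N) \<inter> Y)"
proof -
  define T where "T = (\<lambda>\<omega> x (v :: nat \<Rightarrow> 'a). if x \<in> (V \<union> N) \<inter> Y then \<phi> x * \<omega> x v :: real else 0)"
  have "lift T \<alpha> \<in> superforms p q ((V \<union> N) \<inter> Y)"
  proof (rule lift_superforms[OF op(1) _ _ _ \<alpha>])
    fix \<omega> assume \<omega>: "\<omega> \<in> smooth_forms p V"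
    show "T \<omega> \<in> smooth_forms p ((V \<union> N) \<inter> Y)"
    proof (rule smooth_formsI)
      fix x assume x: "x \<in> (V \<union> N) \<inter> Y"
      then have "T \<omega> x = \<phi> x *\<^sub>R \<omega> x" by (simp add: T_def fun_eq_iff)
      then show "T \<omega> x \<in> alternating_forms p"
        by (simp add: smooth_form_alternating[OF \<omega>] subspace_scale[OF subspace_alternating_forms])
    next
      fix v
      have "smooth_on (\<lambda>x. \<phi> x * \<omega> x v) (V \<inter> Y)"
        using op smooth_form_smooth[OF \<omega>] \<phi>
        by (intro smooth_on_mult) (auto intro: smooth_on_subset)
      then have "smooth_on (\<lambda>x. T \<omega> x v) (V \<inter> Y)"
        using op by (rule_tac smooth_on_cong) (auto simp: T_def)
      moreover have "smooth_on (\<lambda>x. T \<omega> x v) (N \<inter> Y)"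
        by (rule smooth_on_cong[OF _ _ smooth_on_const[of 0]]) (use op N in \<open>auto simp: T_def\<close>)
      ultimately have "smooth_on (\<lambda>x. T \<omega> x v) (V \<inter> Y \<union> N \<inter> Y)"
        using op by (intro smooth_on_Un) auto
      then show "smooth_on (\<lambda>x. T \<omega> x v) ((V \<union> N) \<inter> Y)" by (simp add: Int_Un_distrib2)
    qed (auto simp: T_def fun_eq_iff)
  qed (auto simp: T_def fun_eq_iff algebra_simps)
  then show ?thesis by (simp add: lift_def T_def cong: if_cong)
qed

text \<open>Forms are encoded as 0 outside their domain, so passing to a smaller domain has to reset
  values.\<close>

definition shrink :: "'a set \<Rightarrow> 'a superform \<Rightarrow> 'a superform" where
  "shrink W \<alpha> = (\<lambda>x v w. if x \<in> W then \<alpha> x v w else 0)"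

lemma shrink_apply [simp]: "x \<in> W \<Longrightarrow> shrink W \<alpha> x = \<alpha> x"
  by (simp add: shrink_def)

lemma shrink_superforms:
  assumes "open V" "open W" "W \<subseteq> V" "\<alpha> \<in> superforms p q V"
  shows "shrink W \<alpha> \<in> superforms p q W"
proof -
  have "(V \<union> {}) \<inter> W = W" using assms(3) by auto
  then show ?thesis
    using cutoff_superforms[OF assms(1) open_empty assms(2) smooth_on_const[of 1] _ assms(4)]
    by (simp add: shrink_def cong: if_cong)
qed

section \<open>Superforms on the support of a complex\<close>

definition restrict_to :: "'a set \<Rightarrow> ('a set \<Rightarrow> 'a superform) \<Rightarrow> 'a set \<Rightarrow> 'a superform" where
  "restrict_to \<Omega> \<theta> = (\<lambda>\<sigma> x v w. if x \<in> \<Omega> then \<theta> \<sigma> x v w else 0)"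

definition fun_times :: "('a \<Rightarrow> real) \<Rightarrow> ('a set \<Rightarrow> 'a superform) \<Rightarrow> 'a set \<Rightarrow> 'a superform" where
  "fun_times \<phi> \<theta> = (\<lambda>\<sigma> x v w. \<phi> x * \<theta> \<sigma> x v w)"

lemma restrict_to_linear:
  "restrict_to \<Omega> (\<theta> + \<zeta>) = restrict_to \<Omega> \<theta> + restrict_to \<Omega> \<zeta>"
  "restrict_to \<Omega> (c *\<^sub>R \<theta>) = c *\<^sub>R restrict_to \<Omega> \<theta>"
  "restrict_to \<Omega> (\<theta> - \<zeta>) = restrict_to \<Omega> \<theta> - restrict_to \<Omega> \<zeta>"
  "restrict_to \<Omega> 0 = 0"
  by (auto simp: restrict_to_def fun_eq_iff)

lemma restr_linear:
  "restr C \<Omega> p q (\<alpha> + \<beta>) = restr C \<Omega> p q \<alpha> + restr C \<Omega> p q \<beta>"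
  "restr C \<Omega> p q (c *\<^sub>R \<alpha>) = c *\<^sub>R restr C \<Omega> p q \<alpha>"
  "restr C \<Omega> p q 0 = 0"
  by (auto simp: restr_def fun_eq_iff)

lemma restr_cong: "(\<And>x. x \<in> \<Omega> \<Longrightarrow> \<alpha> x = \<beta> x) \<Longrightarrow> restr C \<Omega> p q \<alpha> = restr C \<Omega> p q \<beta>"
  by (auto simp: restr_def fun_eq_iff)

lemma restrict_to_restr:
  "\<Omega>' \<subseteq> \<Omega> \<Longrightarrow> restrict_to \<Omega>' (restr C \<Omega> p q \<alpha>) = restr C \<Omega>' p q \<alpha>"
  by (auto simp: restr_def restrict_to_def fun_eq_iff)

lemma restrict_to_restrict_to:
  "restrict_to \<Omega>' (restrict_to \<Omega> \<theta>) = restrict_to (\<Omega>' \<inter> \<Omega>) \<theta>"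
  by (auto simp: restrict_to_def fun_eq_iff)

lemma superforms_on_outside:
  "\<theta> \<in> superforms_on C \<Omega> p q \<Longrightarrow> x \<notin> \<Omega> \<Longrightarrow> \<theta> \<sigma> x v w = 0"
  by (auto simp: superforms_on_def represents_def restr_def)

lemma superforms_onI:
  "open V \<Longrightarrow> V \<inter> supp C = \<Omega> \<Longrightarrow> \<alpha> \<in> superforms p q V \<Longrightarrow> restr C \<Omega> p q \<alpha> \<in> superforms_on C \<Omega> p q"
  unfolding superforms_on_def represents_def by blast

lemma superforms_onE:
  assumes "\<theta> \<in> superforms_on C \<Omega> p q"
  obtains V \<alpha> where "open V" "V \<inter> supp C = \<Omega>" "\<alpha> \<in> superforms p q V" "\<theta> = restr C \<Omega> p q \<alpha>"
  using assms unfolding superforms_on_def represents_def by blast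

abbreviation rel_open :: "'a::topological_space set set \<Rightarrow> 'a set \<Rightarrow> bool" where
  "rel_open C \<Omega> \<equiv> openin (top_of_set (supp C)) \<Omega>"

lemma rel_openE:
  assumes "rel_open C \<Omega>"
  obtains T where "open T" "T \<inter> supp C = \<Omega>"
  using assms by (auto simp: openin_open)

text \<open>Each representative comes with a neighbourhood of its own; trimming it is how two of
  them obtain a common domain.\<close>

lemma superforms_onE_subset:
  assumes "\<theta> \<in> superforms_on C \<Omega> p q" "open Y" "\<Omega> \<subseteq> Y"
  obtains V \<alpha> where "open V" "V \<inter> supp C = \<Omega>" "V \<subseteq> Y" "\<alpha> \<in> superforms p q V"
    "\<theta> = restr C \<Omega> p q \<alpha>"
proof -
  obtain V \<alpha> where V: "open V" "V \<inter> supp C = \<Omega>" "\<alpha> \<in> superforms p q V" "\<theta> = restr C \<Omega> p q \<alpha>"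
    using assms(1) by (rule superforms_onE)
  show thesis
  proof (rule that)
    show "shrink (V \<inter> Y) \<alpha> \<in> superforms p q (V \<inter> Y)"
      using V assms by (intro shrink_superforms[of V]) auto
    show "\<theta> = restr C \<Omega> p q (shrink (V \<inter> Y) \<alpha>)"
      unfolding V(4) by (rule restr_cong) (use V(2) assms(3) in auto)
  qed (use V assms in auto)
qed

text \<open>
  Elements of \<^const>\<open>superforms_on\<close> vanish outside their domain, so \<open>fun_times \<phi> \<gamma>\<close> is
  the extension of \<open>\<phi> \<gamma>\<close> by zero.
\<close>

lemma fun_times_superforms_on:
  assumes \<gamma>: "\<gamma> \<in> superforms_on C \<Omega>' p q"
    and \<Omega>: "rel_open C \<Omega>" "\<Omega>' \<subseteq> \<Omega>" "\<Omega> \<subseteq> Y" "\<Omega> - \<Omega>' \<subseteq> N" and op: "open Y" "open N"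
    and \<phi>: "smooth_on \<phi> Y" "\<And>x. x \<in> N \<Longrightarrow> x \<in> Y \<Longrightarrow> \<phi> x = 0"
  shows "fun_times \<phi> \<gamma> \<in> superforms_on C \<Omega> p q"
proof -
  obtain V \<alpha> where V: "open V" "V \<inter> supp C = \<Omega>'" "\<alpha> \<in> superforms p q V" "\<gamma> = restr C \<Omega>' p q \<alpha>"
    using \<gamma> by (rule superforms_onE)
  obtain T where T: "open T" "T \<inter> supp C = \<Omega>" using \<Omega>(1) by (rule rel_openE)
  \<comment> \<open>On the support, \<open>V\<close> and \<open>N\<close> together cover
    \<open>\<Omega>\<close>, and \<open>T\<close> removes whatever lies outside it.\<close>
  define W where "W = (V \<union> N) \<inter> (Y \<inter> T)"
  have W: "open W" "W \<inter> supp C = \<Omega>"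
    using V T \<Omega> op by (auto simp: W_def)
  have "(\<lambda>x v w. if x \<in> W then \<phi> x * \<alpha> x v w else 0) \<in> superforms p q W"
    unfolding W_def using V T op \<phi> by (intro cutoff_superforms) (auto intro: smooth_on_subset)
  moreover have "fun_times \<phi> \<gamma> = restr C \<Omega> p q (\<lambda>x v w. if x \<in> W then \<phi> x * \<alpha> x v w else 0)"
    using \<Omega> W(2) \<phi>(2) by (auto simp: fun_times_def V(4) restr_def fun_eq_iff)
  ultimately show ?thesis using superforms_onI[OF W] by simp
qed

lemma restrict_to_superforms_on:
  assumes "\<theta> \<in> superforms_on C \<Omega> p q" "\<Omega>' \<subseteq> \<Omega>" "rel_open C \<Omega>'"
  shows "restrict_to \<Omega>' \<theta> \<in> superforms_on C \<Omega>' p q"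
proof -
  obtain V \<alpha> where V: "open V" "V \<inter> supp C = \<Omega>" "\<alpha> \<in> superforms p q V" "\<theta> = restr C \<Omega> p q \<alpha>"
    using assms(1) by (rule superforms_onE)
  obtain T where T: "open T" "T \<inter> supp C = \<Omega>'" using assms(3) by (rule rel_openE)
  have "shrink (V \<inter> T) \<alpha> \<in> superforms p q (V \<inter> T)"
    using V T by (intro shrink_superforms[of V]) auto
  then have "restr C \<Omega>' p q (shrink (V \<inter> T) \<alpha>) \<in> superforms_on C \<Omega>' p q"
    by (rule superforms_onI[rotated 2]) (use V T assms(2) in auto)
  also have "restr C \<Omega>' p q (shrink (V \<inter> T) \<alpha>) = restrict_to \<Omega>' \<theta>"
    unfolding V(4) restrict_to_restr[OF assms(2)]
    by (rule restr_cong) (use V T assms(2) in auto)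
  finally show ?thesis .
qed

lemma superforms_onE2:
  assumes "\<theta> \<in> superforms_on C \<Omega> p q" "\<zeta> \<in> superforms_on C \<Omega> p q"
  obtains V \<alpha> \<beta> where "open V" "V \<inter> supp C = \<Omega>" "\<alpha> \<in> superforms p q V" "\<theta> = restr C \<Omega> p q \<alpha>"
    "\<beta> \<in> superforms p q V" "\<zeta> = restr C \<Omega> p q \<beta>"
proof -
  obtain V \<alpha> where V: "open V" "V \<inter> supp C = \<Omega>" "\<alpha> \<in> superforms p q V" "\<theta> = restr C \<Omega> p q \<alpha>"
    using assms(1) by (rule superforms_onE)
  obtain W \<beta> where W: "open W" "W \<inter> supp C = \<Omega>" "W \<subseteq> V" "\<beta> \<in> superforms p q W" "\<zeta> = restr C \<Omega> p q \<beta>"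
    using assms(2) V by (elim superforms_onE_subset[where Y = V]) auto
  have "\<theta> = restr C \<Omega> p q (shrink W \<alpha>)"
    unfolding V(4) by (rule restr_cong) (use W in auto)
  with shrink_superforms[OF V(1) W(1,3) V(3)] show thesis
    by (intro that[OF W(1,2) _ _ W(4,5)])
qed

lemma subspace_superforms_on:
  assumes "rel_open C \<Omega>"
  shows "subspace (superforms_on C \<Omega> p q)"
  unfolding subspace_def
proof (intro conjI ballI allI)
  obtain T where T: "open T" "T \<inter> supp C = \<Omega>" using assms by (rule rel_openE)
  show "0 \<in> superforms_on C \<Omega> p q"
    using superforms_onI[OF T subspace_0[OF subspace_superforms]] by (simp add: restr_linear)
next
  fix \<theta> \<zeta> assume "\<theta> \<in> superforms_on C \<Omega> p q" "\<zeta> \<in> superforms_on C \<Omega> p q"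
  then obtain V \<alpha> \<beta> where V: "open V" "V \<inter> supp C = \<Omega>" "\<alpha> \<in> superforms p q V"
    "\<theta> = restr C \<Omega> p q \<alpha>" "\<beta> \<in> superforms p q V" "\<zeta> = restr C \<Omega> p q \<beta>"
    by (rule superforms_onE2)
  then show "\<theta> + \<zeta> \<in> superforms_on C \<Omega> p q"
    using superforms_onI[OF V(1,2) subspace_add[OF subspace_superforms V(3,5)]]
    by (simp add: restr_linear)
next
  fix c :: real and \<theta> assume "\<theta> \<in> superforms_on C \<Omega> p q"
  then obtain V \<alpha> where V: "open V" "V \<inter> supp C = \<Omega>" "\<alpha> \<in> superforms p q V" "\<theta> = restr C \<Omega> p q \<alpha>"
    by (rule superforms_onE)
  then show "c *\<^sub>R \<theta> \<in> superforms_on C \<Omega> p q"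
    using superforms_onI[OF V(1,2) subspace_scale[OF subspace_superforms V(3)]]
    by (simp add: restr_linear)
qed

context
  fixes C :: "'a::euclidean_space set set"
  assumes C: "polyhedral_complex C"
begin

lemma dprime_on_superforms_on:
  assumes "\<theta> \<in> superforms_on C \<Omega> p q"
  shows "dprime_on C \<Omega> p q \<theta> \<in> superforms_on C \<Omega> (Suc p) q"
  using assms
  by (rule superforms_onE) (auto simp: dprime_on_restr[OF C] intro!: superforms_onI dprime_superforms)

lemma dprime_on_add:
  assumes "\<theta> \<in> superforms_on C \<Omega> p q" "\<zeta> \<in> superforms_on C \<Omega> p q"
  shows "dprime_on C \<Omega> p q (\<theta> + \<zeta>) = dprime_on C \<Omega> p q \<theta> + dprime_on C \<Omega> p q \<zeta>"
proof -
  obtain V \<alpha> \<beta> where V: "open V" "V \<inter> supp C = \<Omega>" "\<alpha> \<in> superforms p q V"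
    "\<theta> = restr C \<Omega> p q \<alpha>" "\<beta> \<in> superforms p q V" "\<zeta> = restr C \<Omega> p q \<beta>"
    using assms by (rule superforms_onE2)
  then have "\<alpha> + \<beta> \<in> superforms p q V" by (intro subspace_add[OF subspace_superforms])
  then show ?thesis
    using V by (simp add: restr_linear(1)[symmetric] dprime_on_restr[OF C V(1,2)] dprime_add)
qed

lemma dprime_on_scale:
  assumes "\<theta> \<in> superforms_on C \<Omega> p q"
  shows "dprime_on C \<Omega> p q (c *\<^sub>R \<theta>) = c *\<^sub>R dprime_on C \<Omega> p q \<theta>"
proof -
  obtain V \<alpha> where V: "open V" "V \<inter> supp C = \<Omega>" "\<alpha> \<in> superforms p q V" "\<theta> = restr C \<Omega> p q \<alpha>"
    using assms by (rule superforms_onE)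
  then have "c *\<^sub>R \<alpha> \<in> superforms p q V" by (intro subspace_scale[OF subspace_superforms])
  then show ?thesis
    using V by (simp add: restr_linear(2)[symmetric] dprime_on_restr[OF C V(1,2)] dprime_scaleR)
qed

lemma dprime_on_diff:
  assumes "\<theta> \<in> superforms_on C \<Omega> p q" "\<zeta> \<in> superforms_on C \<Omega> p q" "rel_open C \<Omega>"
  shows "dprime_on C \<Omega> p q (\<theta> - \<zeta>) = dprime_on C \<Omega> p q \<theta> - dprime_on C \<Omega> p q \<zeta>"
  using dprime_on_add[OF assms(1) subspace_scale[OF subspace_superforms_on[OF assms(3)] assms(2)], of "-1"]
    dprime_on_scale[OF assms(2), of "-1"] by simp

lemma dprime_on_dprime_on:
  assumes "\<theta> \<in> superforms_on C \<Omega> p q"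
  shows "dprime_on C \<Omega> (Suc p) q (dprime_on C \<Omega> p q \<theta>) = 0"
  using assms
  by (rule superforms_onE)
    (auto simp: dprime_on_restr[OF C] dprime_superforms dprime_dprime restr_linear)

lemma dprime_on_restrict_to:
  assumes \<theta>: "\<theta> \<in> superforms_on C \<Omega> p q" and \<Omega>': "\<Omega>' \<subseteq> \<Omega>" "rel_open C \<Omega>'"
  shows "dprime_on C \<Omega>' p q (restrict_to \<Omega>' \<theta>) = restrict_to \<Omega>' (dprime_on C \<Omega> p q \<theta>)"
proof -
  obtain V \<alpha> where V: "open V" "V \<inter> supp C = \<Omega>" "\<alpha> \<in> superforms p q V" "\<theta> = restr C \<Omega> p q \<alpha>"
    using \<theta> by (rule superforms_onE)
  obtain T where T: "open T" "T \<inter> supp C = \<Omega>'" using \<Omega>'(2) by (rule rel_openE)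
  define \<alpha>' where "\<alpha>' = shrink (V \<inter> T) \<alpha>"
  have W: "open (V \<inter> T)" "(V \<inter> T) \<inter> supp C = \<Omega>'" using V T \<Omega>' by auto
  have \<alpha>': "\<alpha>' \<in> superforms p q (V \<inter> T)"
    unfolding \<alpha>'_def using V T by (intro shrink_superforms[of V]) auto
  have "restrict_to \<Omega>' \<theta> = restr C \<Omega>' p q \<alpha>'"
    unfolding V(4) restrict_to_restr[OF \<Omega>'(1)]
    by (rule restr_cong) (use V T \<Omega>' in \<open>auto simp: \<alpha>'_def\<close>)
  then have "dprime_on C \<Omega>' p q (restrict_to \<Omega>' \<theta>) = restr C \<Omega>' (Suc p) q (dprime p (V \<inter> T) \<alpha>')"
    using dprime_on_restr[OF C W] \<alpha>' by simp
  also have "\<dots> = restr C \<Omega>' (Suc p) q (dprime p V \<alpha>)"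
  proof (rule restr_cong)
    fix x assume "x \<in> \<Omega>'"
    then show "dprime p (V \<inter> T) \<alpha>' x = dprime p V \<alpha> x"
      using W by (intro dprime_cong_open[of "V \<inter> T"]) (auto simp: \<alpha>'_def)
  qed
  also have "\<dots> = restrict_to \<Omega>' (dprime_on C \<Omega> p q \<theta>)"
    unfolding V(4) dprime_on_restr[OF C V(1-3)] restrict_to_restr[OF \<Omega>'(1)] ..
  finally show ?thesis .
qed

end

section \<open>Finite dimension modulo a subspace\<close>

text \<open>Finite dimension of \<open>Z\<close> modulo \<open>B\<close>. The spanning vectors may
  lie outside \<open>Z\<close>, which makes the notion monotone in \<open>Z\<close>;
  \<open>fin_mod_preimage\<close> finds spanning vectors inside.\<close>

definition fin_mod :: "'b::real_vector set \<Rightarrow> 'b set \<Rightarrow> bool" where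
  "fin_mod Z B \<longleftrightarrow> (\<exists>S. finite S \<and> Z \<subseteq> span (S \<union> B))"

text \<open>\<open>f\<close> embeds \<open>Z\<close> modulo the preimage of \<open>B\<close> into a
  quotient of finite dimension. The proof eliminates the spanning vectors of \<open>Z'\<close> one
  at a time.\<close>

lemma fin_mod_preimage:
  fixes f :: "'b::real_vector \<Rightarrow> 'c::real_vector"
  assumes Z: "subspace Z" and B: "subspace B" and "fin_mod Z' B" and f: "f ` Z \<subseteq> Z'"
    and add: "\<And>x y. x \<in> Z \<Longrightarrow> y \<in> Z \<Longrightarrow> f (x + y) = f x + f y"
    and scale: "\<And>c x. x \<in> Z \<Longrightarrow> f (c *\<^sub>R x) = c *\<^sub>R f x"
  obtains S where "finite S" "S \<subseteq> Z" "Z \<subseteq> span (S \<union> {z \<in> Z. f z \<in> B})"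
proof -
  obtain T where T: "finite T" "Z' \<subseteq> span (T \<union> B)"
    using assms(3) by (auto simp: fin_mod_def)
  have "\<exists>S. finite S \<and> S \<subseteq> Z \<and> Z \<subseteq> span (S \<union> {z \<in> Z. f z \<in> B})"
    if "f ` Z \<subseteq> span (T \<union> B)"
    using T(1) Z that add scale
  proof (induction T arbitrary: Z)
    case empty
    moreover have "span B = B" using B by (simp add: span_eq_iff)
    ultimately have "{z \<in> Z. f z \<in> B} = Z" by auto
    then show ?case using span_superset[of Z] by (intro exI[of _ "{}"]) simp
  next
    case (insert t T)
    \<comment> \<open>\<open>Y\<close> collects the vectors whose image does without
      \<open>t\<close>; its codimension in \<open>Z\<close> is at most 1.\<close>
    define Y where "Y = {z \<in> Z. f z \<in> span (T \<union> B)}"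
    have f0: "f 0 = 0" using insert.prems(4)[OF subspace_0[OF insert.prems(1)], of 0] by simp
    have "subspace Y"
      using insert.prems(1,3,4) f0 unfolding Y_def subspace_def
      by (auto intro: span_zero span_add span_scale)
    then have "\<exists>S. finite S \<and> S \<subseteq> Y \<and> Y \<subseteq> span (S \<union> {z \<in> Y. f z \<in> B})"
      using insert.prems(3,4) by (intro insert.IH) (auto simp: Y_def)
    then obtain S where S: "finite S" "S \<subseteq> Y" "Y \<subseteq> span (S \<union> {z \<in> Y. f z \<in> B})" by blast
    have Y: "Y \<subseteq> span (S \<union> {z \<in> Z. f z \<in> B})"
      using S(3) by (rule order_trans) (intro span_mono, auto simp: Y_def)
    show ?case
    proof (cases "Y = Z")
      case True
      then show ?thesis using S Y by (intro exI[of _ S]) auto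
    next
      case False
      then obtain z0 where z0: "z0 \<in> Z" "z0 \<notin> Y" by (auto simp: Y_def)
      have br: "\<exists>k. f z - k *\<^sub>R t \<in> span (T \<union> B)" if "z \<in> Z" for z
        using insert.prems(2) that span_breakdown_eq[of "f z" t "T \<union> B"] by auto
      obtain k where k: "f z0 - k *\<^sub>R t \<in> span (T \<union> B)" using br z0(1) by blast
      \<comment> \<open>\<open>z0\<close> serves as pivot: subtracting \<open>m / k\<close> times
        \<open>z0\<close> removes the coefficient \<open>m\<close> of \<open>t\<close> from
        \<open>f z\<close>.\<close>
      have "k \<noteq> 0" using k z0 by (auto simp: Y_def)
      have "z \<in> span (insert z0 S \<union> {z \<in> Z. f z \<in> B})" if z: "z \<in> Z" for z
      proof -
        obtain m where m: "f z - m *\<^sub>R t \<in> span (T \<union> B)" using br z by blast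
        have in_Z: "(- (m / k)) *\<^sub>R z0 \<in> Z" using z0(1) insert.prems(1) by (intro subspace_scale)
        have "f (z + (- (m / k)) *\<^sub>R z0) = f z + (- (m / k)) *\<^sub>R f z0"
          using z z0(1) in_Z insert.prems(3,4) by metis
        also have "\<dots> = (f z - m *\<^sub>R t) - (m / k) *\<^sub>R (f z0 - k *\<^sub>R t)"
          using \<open>k \<noteq> 0\<close> by (simp add: algebra_simps)
        also have "\<dots> \<in> span (T \<union> B)" by (rule span_diff[OF m span_scale[OF k]])
        finally have "z + (- (m / k)) *\<^sub>R z0 \<in> Y"
          using subspace_add[OF insert.prems(1) z in_Z] by (simp add: Y_def)
        then have "z - (m / k) *\<^sub>R z0 \<in> span (S \<union> {z \<in> Z. f z \<in> B})" using Y by auto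
        then show ?thesis using span_breakdown_eq[of z z0 "S \<union> {z \<in> Z. f z \<in> B}"] by auto
      qed
      then show ?thesis using S z0 by (intro exI[of _ "insert z0 S"]) (auto simp: Y_def)
    qed
  qed
  then show thesis using f T(2) that by (meson order_trans)
qed

lemma fin_mod_span:
  assumes "finite S" "Z \<subseteq> span (S \<union> Y)" "fin_mod Y B"
  shows "fin_mod Z B"
proof -
  obtain T where T: "finite T" "Y \<subseteq> span (T \<union> B)" using assms(3) by (auto simp: fin_mod_def)
  have "S \<union> Y \<subseteq> span (S \<union> T \<union> B)"
    using T(2) span_mono[of "T \<union> B" "S \<union> T \<union> B"] span_superset[of "S \<union> T \<union> B"] by auto
  then have "span (S \<union> Y) \<subseteq> span (S \<union> T \<union> B)" by (rule span_minimal) simp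
  then show ?thesis using assms(1,2) T(1) unfolding fin_mod_def
    by (intro exI[of _ "S \<union> T"]) auto
qed

section \<open>Cosets and the quotient space\<close>

definition coset :: "'b::real_vector set \<Rightarrow> 'b \<Rightarrow> 'b set" where
  "coset B z = {z + b | b. b \<in> B}"

lemma coset_eq_iff:
  assumes "subspace B"
  shows "coset B x = coset B y \<longleftrightarrow> x - y \<in> B"
proof
  assume "coset B x = coset B y"
  moreover have "x \<in> coset B x" using subspace_0[OF assms] by (force simp: coset_def)
  ultimately show "x - y \<in> B" by (auto simp: coset_def)
next
  assume xy: "x - y \<in> B"
  have sub: "coset B a \<subseteq> coset B b" if "a - b \<in> B" for a b
  proof
    fix z assume "z \<in> coset B a"
    then obtain c where "c \<in> B" "z = a + c" by (auto simp: coset_def)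
    then have "z = b + (a - b + c)" "a - b + c \<in> B" using that subspace_add[OF assms] by auto
    then show "z \<in> coset B b" unfolding coset_def by blast
  qed
  have "y - x \<in> B" using subspace_neg[OF assms xy] by simp
  then show "coset B x = coset B y" using sub xy by blast
qed

lemma quotient_space_add:
  assumes "subspace B"
  shows "add (quotient_space Z B) (coset B x) (coset B y) = coset B (x + y)"
proof -
  have "{a + b | a b. a \<in> coset B x \<and> b \<in> coset B y} = coset B (x + y)"
  proof (intro equalityI subsetI)
    fix z assume "z \<in> {a + b | a b. a \<in> coset B x \<and> b \<in> coset B y}"
    then obtain a b where "a \<in> B" "b \<in> B" "z = x + y + (a + b)"
      by (auto simp: coset_def algebra_simps)
    then show "z \<in> coset B (x + y)" using subspace_add[OF assms] unfolding coset_def by blast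
  next
    fix z assume "z \<in> coset B (x + y)"
    then obtain b where "b \<in> B" "z = (x + b) + (y + 0)" by (auto simp: coset_def algebra_simps)
    then show "z \<in> {a + b | a b. a \<in> coset B x \<and> b \<in> coset B y}"
      using subspace_0[OF assms] unfolding coset_def by blast
  qed
  then show ?thesis by (simp add: quotient_space_def)
qed

lemma quotient_space_smult:
  assumes "subspace B"
  shows "smult (quotient_space Z B) c (coset B x) = coset B (c *\<^sub>R x)"
proof -
  have "{c *\<^sub>R a + b | a b. a \<in> coset B x \<and> b \<in> B} = coset B (c *\<^sub>R x)"
  proof (intro equalityI subsetI)
    fix z assume "z \<in> {c *\<^sub>R a + b | a b. a \<in> coset B x \<and> b \<in> B}"
    then obtain a b where "a \<in> B" "b \<in> B" "z = c *\<^sub>R x + (c *\<^sub>R a + b)"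
      by (auto simp: coset_def algebra_simps)
    then show "z \<in> coset B (c *\<^sub>R x)"
      using subspace_add[OF assms] subspace_scale[OF assms] unfolding coset_def by blast
  next
    fix z assume "z \<in> coset B (c *\<^sub>R x)"
    then obtain b where "b \<in> B" "z = c *\<^sub>R (x + 0) + b" by (auto simp: coset_def)
    then show "z \<in> {c *\<^sub>R a + b | a b. a \<in> coset B x \<and> b \<in> B}"
      using subspace_0[OF assms] unfolding coset_def by blast
  qed
  then show ?thesis by (simp add: quotient_space_def)
qed

lemma finite_dimensional_quotient_space:
  assumes Z: "subspace Z" and B: "subspace B" and BZ: "B \<subseteq> Z" and "fin_mod Z B"
  shows "finite_dimensional (quotient_space Z B)"
proof -
  define M where "M = quotient_space Z B"
  have car: "carrier M = coset B ` Z" by (auto simp: M_def quotient_space_def coset_def)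
  have zero: "\<zero>\<^bsub>M\<^esub> = coset B 0" by (auto simp: M_def quotient_space_def coset_def)
  interpret module "\<lparr>carrier = UNIV, mult = (*), one = 1, zero = 0, add = (+)\<rparr>" M
    unfolding M_def by (rule module_quotient_space[OF Z B BZ])
  \<comment> \<open>For the identity map, \<open>fin_mod_preimage\<close> moves the spanning vectors
    into \<open>Z\<close>.\<close>
  obtain S0 where S0: "finite S0" "S0 \<subseteq> Z" "Z \<subseteq> span (S0 \<union> {z \<in> Z. z \<in> B})"
    by (rule fin_mod_preimage[OF Z B assms(4), of "\<lambda>x. x"]) auto
  \<comment> \<open>\<open>finite_dimensional\<close> sums over a set of cosets, so one vector per
    coset is kept; otherwise reindexing the sum would merge terms.\<close>
  obtain S where S: "S \<subseteq> S0" "inj_on (coset B) S" "coset B ` S0 = coset B ` S"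
    using subset_image_inj[of "coset B ` S0" "coset B" S0] by auto
  have fin: "finite S" using S(1) S0(1) finite_subset by blast
  have SZ: "S \<subseteq> Z" using S S0 by auto
  have "s \<in> span (S \<union> B)" if "s \<in> S0" for s
  proof -
    have "coset B s \<in> coset B ` S" unfolding S(3)[symmetric] using that by (rule imageI)
    then obtain s' where s': "s' \<in> S" "s - s' \<in> B"
      by (auto simp: coset_eq_iff[OF B])
    then have "s' + (s - s') \<in> span (S \<union> B)" by (intro span_add span_base) auto
    then show ?thesis by simp
  qed
  then have "span (S0 \<union> {z \<in> Z. z \<in> B}) \<subseteq> span (S \<union> B)"
    by (intro span_minimal) (auto intro: span_base)
  then have Zsp: "Z \<subseteq> span (S \<union> B)" using S0(3) by blast
  have in_car: "coset B z \<in> carrier M" if "z \<in> Z" for z using that car by blast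
  have sum: "(\<Oplus>\<^bsub>M\<^esub>s\<in>F. c s \<odot>\<^bsub>M\<^esub> coset B s) = coset B (\<Sum>s\<in>F. c s *\<^sub>R s)" if "F \<subseteq> S" for F c
    using finite_subset[OF that fin] that
  proof (induction F rule: finite_induct)
    case empty
    then show ?case by (simp add: zero)
  next
    case (insert s F)
    have mem: "c s \<odot>\<^bsub>M\<^esub> coset B s \<in> carrier M" if "s \<in> S" for s
      using that SZ in_car by (intro smult_closed) auto
    have "(\<Oplus>\<^bsub>M\<^esub>s\<in>insert s F. c s \<odot>\<^bsub>M\<^esub> coset B s)
        = c s \<odot>\<^bsub>M\<^esub> coset B s \<oplus>\<^bsub>M\<^esub> (\<Oplus>\<^bsub>M\<^esub>s\<in>F. c s \<odot>\<^bsub>M\<^esub> coset B s)"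
      using insert mem by (intro M.finsum_insert) auto
    then show ?case
      using insert by (simp add: M_def quotient_space_smult[OF B] quotient_space_add[OF B])
  qed
  have "\<exists>c. h = (\<Oplus>\<^bsub>M\<^esub>t\<in>coset B ` S. c t \<odot>\<^bsub>M\<^esub> t)" if h: "h \<in> carrier M" for h
  proof -
    obtain z where z: "z \<in> Z" "h = coset B z" using h car by blast
    have "z \<in> span (S \<union> B)" using z Zsp by blast
    then obtain x b where xb: "x \<in> span S" "b \<in> B" "z = x + b"
      unfolding span_Un using B by (auto simp: span_eq_iff[THEN iffD2])
    obtain c where c: "x = (\<Sum>s\<in>S. c s *\<^sub>R s)" using xb(1) by (auto simp: span_finite[OF fin])
    define c' where "c' = (\<lambda>t. c (the_inv_into S (coset B) t))"
    have "(\<Oplus>\<^bsub>M\<^esub>t\<in>coset B ` S. c' t \<odot>\<^bsub>M\<^esub> t) = (\<Oplus>\<^bsub>M\<^esub>s\<in>S. c' (coset B s) \<odot>\<^bsub>M\<^esub> coset B s)"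
      using S(2) SZ in_car by (intro M.finsum_reindex) (auto intro!: smult_closed)
    also have "\<dots> = coset B (\<Sum>s\<in>S. c' (coset B s) *\<^sub>R s)" by (rule sum) simp
    also have "(\<Sum>s\<in>S. c' (coset B s) *\<^sub>R s) = x"
      unfolding c by (rule sum.cong) (auto simp: c'_def the_inv_into_f_f[OF S(2)])
    also have "coset B x = h" unfolding z(2) coset_eq_iff[OF B] using xb subspace_neg[OF B] by simp
    finally show ?thesis by blast
  qed
  then have "\<exists>S. finite S \<and> S \<subseteq> carrier M \<and> (\<forall>h\<in>carrier M. \<exists>c. h = (\<Oplus>\<^bsub>M\<^esub>s\<in>S. c s \<odot>\<^bsub>M\<^esub> s))"
    using fin SZ in_car by (intro exI[of _ "coset B ` S"]) auto
  then show ?thesis unfolding finite_dimensional_def M_def .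
qed

section \<open>Mayer--Vietoris\<close>

text \<open>A partition of unity \<open>\<phi>\<close>, \<open>1 - \<phi>\<close> for the pair, in
  the form that extension by zero asks for: each function vanishes on an open set around the points
  where its form is undefined.\<close>

definition splitting :: "'a::euclidean_space set \<Rightarrow> 'a set \<Rightarrow> bool" where
  "splitting \<Omega>\<^sub>1 \<Omega>\<^sub>2 \<longleftrightarrow> (\<exists>Y N\<^sub>1 N\<^sub>2 \<phi>. open Y \<and> open N\<^sub>1 \<and> open N\<^sub>2 \<and> smooth_on \<phi> Y \<and>
     \<Omega>\<^sub>1 \<union> \<Omega>\<^sub>2 \<subseteq> Y \<and> \<Omega>\<^sub>2 - \<Omega>\<^sub>1 \<subseteq> N\<^sub>1 \<and> \<Omega>\<^sub>1 - \<Omega>\<^sub>2 \<subseteq> N\<^sub>2 \<and>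
     (\<forall>x\<in>N\<^sub>1 \<inter> Y. \<phi> x = 0) \<and> (\<forall>x\<in>N\<^sub>2 \<inter> Y. \<phi> x = 1))"

context
  fixes C :: "'a::euclidean_space set set" and q :: nat
  assumes C: "polyhedral_complex C"
begin

lemma subspace_cocycles:
  assumes "rel_open C \<Omega>"
  shows "subspace (cocycles C \<Omega> p q)"
proof -
  note sub = subspace_superforms_on[OF assms, of p q]
  have "dprime_on C \<Omega> p q 0 = 0" using dprime_on_scale[OF C subspace_0[OF sub], of 0] by simp
  then show ?thesis
    using sub unfolding cocycles_def subspace_def
    by (auto simp: dprime_on_add[OF C] dprime_on_scale[OF C])
qed

lemma subspace_coboundaries:
  assumes "rel_open C \<Omega>"
  shows "subspace (coboundaries C \<Omega> p q)"
proof (cases p)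
  case 0
  then show ?thesis by (simp add: coboundaries_def subspace_single_0)
next
  case (Suc p')
  note sub = subspace_superforms_on[OF assms, of p' q]
  have "dprime_on C \<Omega> p' q 0 = 0" using dprime_on_scale[OF C subspace_0[OF sub], of 0] by simp
  then have "0 \<in> dprime_on C \<Omega> p' q ` superforms_on C \<Omega> p' q"
    using subspace_0[OF sub] by (metis imageI)
  moreover have "x + y \<in> dprime_on C \<Omega> p' q ` superforms_on C \<Omega> p' q"
    if "x \<in> dprime_on C \<Omega> p' q ` superforms_on C \<Omega> p' q"
      "y \<in> dprime_on C \<Omega> p' q ` superforms_on C \<Omega> p' q" for x y
    using that dprime_on_add[OF C] subspace_add[OF sub] by (smt (verit, best) imageE imageI)
  moreover have "c *\<^sub>R x \<in> dprime_on C \<Omega> p' q ` superforms_on C \<Omega> p' q"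
    if "x \<in> dprime_on C \<Omega> p' q ` superforms_on C \<Omega> p' q" for c x
    using that dprime_on_scale[OF C] subspace_scale[OF sub] by (smt (verit, best) imageE imageI)
  ultimately show ?thesis unfolding subspace_def by (simp add: coboundaries_def Suc)
qed

lemma coboundaries_subset_cocycles:
  assumes "rel_open C \<Omega>"
  shows "coboundaries C \<Omega> p q \<subseteq> cocycles C \<Omega> p q"
proof (cases p)
  case 0
  then show ?thesis using subspace_0[OF subspace_cocycles[OF assms]] by (simp add: coboundaries_def)
next
  case (Suc p')
  then show ?thesis
    by (auto simp: coboundaries_def cocycles_def dprime_on_superforms_on[OF C] dprime_on_dprime_on[OF C])
qed

lemma restrict_to_cocycles:
  assumes "\<theta> \<in> cocycles C \<Omega> p q" "\<Omega>' \<subseteq> \<Omega>" "rel_open C \<Omega>'"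
  shows "restrict_to \<Omega>' \<theta> \<in> cocycles C \<Omega>' p q"
  using assms
  by (auto simp: cocycles_def restrict_to_superforms_on dprime_on_restrict_to[OF C] restrict_to_linear)

context
  fixes \<Omega>\<^sub>1 \<Omega>\<^sub>2 :: "'a set"
  assumes op: "rel_open C \<Omega>\<^sub>1" "rel_open C \<Omega>\<^sub>2" and split: "splitting \<Omega>\<^sub>1 \<Omega>\<^sub>2"
begin

lemma rel_open_Un_Int: "rel_open C (\<Omega>\<^sub>1 \<union> \<Omega>\<^sub>2)" "rel_open C (\<Omega>\<^sub>1 \<inter> \<Omega>\<^sub>2)"
  using op by auto

text \<open>Surjectivity in the Mayer--Vietoris sequence: the parts are \<open>1 - \<phi>\<close>
  and \<open>- \<phi>\<close> times \<open>\<gamma>\<close>, each extended by zero across the set on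
  which its factor vanishes.\<close>

lemma superforms_on_decompose:
  assumes \<gamma>: "\<gamma> \<in> superforms_on C (\<Omega>\<^sub>1 \<inter> \<Omega>\<^sub>2) p q"
  obtains \<delta>\<^sub>1 \<delta>\<^sub>2 where "\<delta>\<^sub>1 \<in> superforms_on C \<Omega>\<^sub>1 p q" "\<delta>\<^sub>2 \<in> superforms_on C \<Omega>\<^sub>2 p q"
    "restrict_to (\<Omega>\<^sub>1 \<inter> \<Omega>\<^sub>2) \<delta>\<^sub>1 - restrict_to (\<Omega>\<^sub>1 \<inter> \<Omega>\<^sub>2) \<delta>\<^sub>2 = \<gamma>"
proof -
  obtain Y N\<^sub>1 N\<^sub>2 \<phi> where Y: "open Y" "open N\<^sub>1" "open N\<^sub>2" "smooth_on \<phi> Y"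
    "\<Omega>\<^sub>1 \<union> \<Omega>\<^sub>2 \<subseteq> Y" "\<Omega>\<^sub>2 - \<Omega>\<^sub>1 \<subseteq> N\<^sub>1" "\<Omega>\<^sub>1 - \<Omega>\<^sub>2 \<subseteq> N\<^sub>2" "\<forall>x\<in>N\<^sub>1 \<inter> Y. \<phi> x = 0" "\<forall>x\<in>N\<^sub>2 \<inter> Y. \<phi> x = 1"
    using split unfolding splitting_def by blast
  show thesis
  proof (rule that)
    show "fun_times (\<lambda>x. 1 - \<phi> x) \<gamma> \<in> superforms_on C \<Omega>\<^sub>1 p q"
      by (rule fun_times_superforms_on[OF \<gamma> op(1), where Y = Y and N = N\<^sub>2])
        (use Y in \<open>auto intro!: smooth_on_diff smooth_on_const\<close>)
    show "fun_times (\<lambda>x. 0 - \<phi> x) \<gamma> \<in> superforms_on C \<Omega>\<^sub>2 p q"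
      by (rule fun_times_superforms_on[OF \<gamma> op(2), where Y = Y and N = N\<^sub>1])
        (use Y in \<open>auto intro!: smooth_on_diff[OF _ smooth_on_const, of _ \<phi> 0, simplified]\<close>)
    show "restrict_to (\<Omega>\<^sub>1 \<inter> \<Omega>\<^sub>2) (fun_times (\<lambda>x. 1 - \<phi> x) \<gamma>)
        - restrict_to (\<Omega>\<^sub>1 \<inter> \<Omega>\<^sub>2) (fun_times (\<lambda>x. 0 - \<phi> x) \<gamma>) = \<gamma>"
      using superforms_on_outside[OF \<gamma>]
      by (auto simp: fun_eq_iff restrict_to_def fun_times_def algebra_simps)
  qed
qed

text \<open>Gluing calls for one representative near all of the union; \<open>\<phi>\<close> times
  the first form plus \<open>1 - \<phi>\<close> times the second provides it.\<close>

lemma superforms_on_glue: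
  assumes \<beta>: "\<beta>\<^sub>1 \<in> superforms_on C \<Omega>\<^sub>1 p q" "\<beta>\<^sub>2 \<in> superforms_on C \<Omega>\<^sub>2 p q"
    and eq: "restrict_to (\<Omega>\<^sub>1 \<inter> \<Omega>\<^sub>2) \<beta>\<^sub>1 = restrict_to (\<Omega>\<^sub>1 \<inter> \<Omega>\<^sub>2) \<beta>\<^sub>2"
  obtains \<beta> where "\<beta> \<in> superforms_on C (\<Omega>\<^sub>1 \<union> \<Omega>\<^sub>2) p q"
    "restrict_to \<Omega>\<^sub>1 \<beta> = \<beta>\<^sub>1" "restrict_to \<Omega>\<^sub>2 \<beta> = \<beta>\<^sub>2"
proof -
  obtain Y N\<^sub>1 N\<^sub>2 \<phi> where Y: "open Y" "open N\<^sub>1" "open N\<^sub>2" "smooth_on \<phi> Y"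
    "\<Omega>\<^sub>1 \<union> \<Omega>\<^sub>2 \<subseteq> Y" "\<Omega>\<^sub>2 - \<Omega>\<^sub>1 \<subseteq> N\<^sub>1" "\<Omega>\<^sub>1 - \<Omega>\<^sub>2 \<subseteq> N\<^sub>2" "\<forall>x\<in>N\<^sub>1 \<inter> Y. \<phi> x = 0" "\<forall>x\<in>N\<^sub>2 \<inter> Y. \<phi> x = 1"
    using split unfolding splitting_def by blast
  define \<beta> where "\<beta> = fun_times \<phi> \<beta>\<^sub>1 + fun_times (\<lambda>x. 1 - \<phi> x) \<beta>\<^sub>2"
  have "fun_times \<phi> \<beta>\<^sub>1 \<in> superforms_on C (\<Omega>\<^sub>1 \<union> \<Omega>\<^sub>2) p q"
    by (rule fun_times_superforms_on[OF \<beta>(1) rel_open_Un_Int(1), where Y = Y and N = N\<^sub>1]) (use Y in auto)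
  moreover have "fun_times (\<lambda>x. 1 - \<phi> x) \<beta>\<^sub>2 \<in> superforms_on C (\<Omega>\<^sub>1 \<union> \<Omega>\<^sub>2) p q"
    by (rule fun_times_superforms_on[OF \<beta>(2) rel_open_Un_Int(1), where Y = Y and N = N\<^sub>2])
      (use Y in \<open>auto intro!: smooth_on_diff smooth_on_const\<close>)
  ultimately have 1: "\<beta> \<in> superforms_on C (\<Omega>\<^sub>1 \<union> \<Omega>\<^sub>2) p q"
    unfolding \<beta>_def by (rule subspace_add[OF subspace_superforms_on[OF rel_open_Un_Int(1)]])
  have eq': "\<beta>\<^sub>1 \<sigma> x v w = \<beta>\<^sub>2 \<sigma> x v w" if "x \<in> \<Omega>\<^sub>1" "x \<in> \<Omega>\<^sub>2" for \<sigma> x v w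
    using that fun_cong[OF fun_cong[OF fun_cong[OF fun_cong[OF eq]]], of \<sigma> x v w]
    by (simp add: restrict_to_def)
  have \<phi>: "\<phi> x = 1" if "x \<in> \<Omega>\<^sub>1" "x \<notin> \<Omega>\<^sub>2" for x using that Y by auto
  have \<phi>': "\<phi> x = 0" if "x \<in> \<Omega>\<^sub>2" "x \<notin> \<Omega>\<^sub>1" for x using that Y by auto
  note out = superforms_on_outside[OF \<beta>(1)] superforms_on_outside[OF \<beta>(2)]
  have 2: "restrict_to \<Omega>\<^sub>1 \<beta> = \<beta>\<^sub>1"
  proof (intro ext)
    fix \<sigma> x v w
    show "restrict_to \<Omega>\<^sub>1 \<beta> \<sigma> x v w = \<beta>\<^sub>1 \<sigma> x v w"
      by (cases "x \<in> \<Omega>\<^sub>2"; cases "x \<in> \<Omega>\<^sub>1")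
        (simp_all add: restrict_to_def \<beta>_def fun_times_def eq' \<phi> out algebra_simps)
  qed
  have 3: "restrict_to \<Omega>\<^sub>2 \<beta> = \<beta>\<^sub>2"
  proof (intro ext)
    fix \<sigma> x v w
    show "restrict_to \<Omega>\<^sub>2 \<beta> \<sigma> x v w = \<beta>\<^sub>2 \<sigma> x v w"
      by (cases "x \<in> \<Omega>\<^sub>2"; cases "x \<in> \<Omega>\<^sub>1")
        (simp_all add: restrict_to_def \<beta>_def fun_times_def eq' \<phi>' out algebra_simps)
  qed
  show thesis using that 1 2 3 .
qed

lemma superforms_on_eqI:
  assumes "\<theta> \<in> superforms_on C (\<Omega>\<^sub>1 \<union> \<Omega>\<^sub>2) p q" "\<zeta> \<in> superforms_on C (\<Omega>\<^sub>1 \<union> \<Omega>\<^sub>2) p q"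
    and "restrict_to \<Omega>\<^sub>1 \<theta> = restrict_to \<Omega>\<^sub>1 \<zeta>" "restrict_to \<Omega>\<^sub>2 \<theta> = restrict_to \<Omega>\<^sub>2 \<zeta>"
  shows "\<theta> = \<zeta>"
proof (intro ext)
  fix \<sigma> x v w
  have "restrict_to \<Omega>\<^sub>1 \<theta> \<sigma> x v w = restrict_to \<Omega>\<^sub>1 \<zeta> \<sigma> x v w"
    "restrict_to \<Omega>\<^sub>2 \<theta> \<sigma> x v w = restrict_to \<Omega>\<^sub>2 \<zeta> \<sigma> x v w"
    using assms(3,4) by simp_all
  then show "\<theta> \<sigma> x v w = \<zeta> \<sigma> x v w"
    using superforms_on_outside[OF assms(1)] superforms_on_outside[OF assms(2)]
    by (cases "x \<in> \<Omega>\<^sub>1 \<union> \<Omega>\<^sub>2") (auto simp: restrict_to_def split: if_splits)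
qed

text \<open>A primitive \<open>\<delta>\<close> of the discrepancy splits as a difference.
  Subtracting the derivatives of its two parts from the given primitives makes these agree without
  changing their derivatives, and then they glue. For \<open>p = 0\<close> they agree from the
  start.\<close>

lemma coboundary_glue:
  assumes \<theta>: "\<theta> \<in> superforms_on C (\<Omega>\<^sub>1 \<union> \<Omega>\<^sub>2) (Suc p) q"
    and \<beta>: "\<beta>\<^sub>1 \<in> superforms_on C \<Omega>\<^sub>1 p q" "\<beta>\<^sub>2 \<in> superforms_on C \<Omega>\<^sub>2 p q"
      "restrict_to \<Omega>\<^sub>1 \<theta> = dprime_on C \<Omega>\<^sub>1 p q \<beta>\<^sub>1" "restrict_to \<Omega>\<^sub>2 \<theta> = dprime_on C \<Omega>\<^sub>2 p q \<beta>\<^sub>2"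
    and \<gamma>: "restrict_to (\<Omega>\<^sub>1 \<inter> \<Omega>\<^sub>2) \<beta>\<^sub>1 - restrict_to (\<Omega>\<^sub>1 \<inter> \<Omega>\<^sub>2) \<beta>\<^sub>2 \<in> coboundaries C (\<Omega>\<^sub>1 \<inter> \<Omega>\<^sub>2) p q"
  shows "\<theta> \<in> coboundaries C (\<Omega>\<^sub>1 \<union> \<Omega>\<^sub>2) (Suc p) q"
proof -
  note subs = subspace_superforms_on[OF op(1)] subspace_superforms_on[OF op(2)]
  have "\<exists>\<beta>\<^sub>1' \<beta>\<^sub>2'. \<beta>\<^sub>1' \<in> superforms_on C \<Omega>\<^sub>1 p q \<and> \<beta>\<^sub>2' \<in> superforms_on C \<Omega>\<^sub>2 p q \<and>
      restrict_to \<Omega>\<^sub>1 \<theta> = dprime_on C \<Omega>\<^sub>1 p q \<beta>\<^sub>1' \<and> restrict_to \<Omega>\<^sub>2 \<theta> = dprime_on C \<Omega>\<^sub>2 p q \<beta>\<^sub>2' \<and>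
      restrict_to (\<Omega>\<^sub>1 \<inter> \<Omega>\<^sub>2) \<beta>\<^sub>1' = restrict_to (\<Omega>\<^sub>1 \<inter> \<Omega>\<^sub>2) \<beta>\<^sub>2'"
  proof (cases p)
    case 0
    then show ?thesis using \<beta> \<gamma> by (intro exI[of _ \<beta>\<^sub>1] exI[of _ \<beta>\<^sub>2]) (simp add: coboundaries_def)
  next
    case (Suc r)
    obtain \<delta> where \<delta>: "\<delta> \<in> superforms_on C (\<Omega>\<^sub>1 \<inter> \<Omega>\<^sub>2) r q"
      "restrict_to (\<Omega>\<^sub>1 \<inter> \<Omega>\<^sub>2) \<beta>\<^sub>1 - restrict_to (\<Omega>\<^sub>1 \<inter> \<Omega>\<^sub>2) \<beta>\<^sub>2 = dprime_on C (\<Omega>\<^sub>1 \<inter> \<Omega>\<^sub>2) r q \<delta>"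
      using \<gamma> by (auto simp: coboundaries_def Suc)
    obtain \<delta>\<^sub>1 \<delta>\<^sub>2 where d: "\<delta>\<^sub>1 \<in> superforms_on C \<Omega>\<^sub>1 r q" "\<delta>\<^sub>2 \<in> superforms_on C \<Omega>\<^sub>2 r q"
      "restrict_to (\<Omega>\<^sub>1 \<inter> \<Omega>\<^sub>2) \<delta>\<^sub>1 - restrict_to (\<Omega>\<^sub>1 \<inter> \<Omega>\<^sub>2) \<delta>\<^sub>2 = \<delta>"
      using \<delta>(1) by (rule superforms_on_decompose)
    have dd: "dprime_on C \<Omega>\<^sub>1 r q \<delta>\<^sub>1 \<in> superforms_on C \<Omega>\<^sub>1 p q"
      "dprime_on C \<Omega>\<^sub>2 r q \<delta>\<^sub>2 \<in> superforms_on C \<Omega>\<^sub>2 p q"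
      using d by (simp_all add: Suc dprime_on_superforms_on[OF C])
    have "dprime_on C (\<Omega>\<^sub>1 \<inter> \<Omega>\<^sub>2) r q \<delta>
        = restrict_to (\<Omega>\<^sub>1 \<inter> \<Omega>\<^sub>2) (dprime_on C \<Omega>\<^sub>1 r q \<delta>\<^sub>1)
          - restrict_to (\<Omega>\<^sub>1 \<inter> \<Omega>\<^sub>2) (dprime_on C \<Omega>\<^sub>2 r q \<delta>\<^sub>2)"
      unfolding d(3)[symmetric] using d(1,2) rel_open_Un_Int
      by (simp add: dprime_on_diff[OF C] dprime_on_restrict_to[OF C, symmetric]
          restrict_to_superforms_on)
    then have "restrict_to (\<Omega>\<^sub>1 \<inter> \<Omega>\<^sub>2) (\<beta>\<^sub>1 - dprime_on C \<Omega>\<^sub>1 r q \<delta>\<^sub>1)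
        = restrict_to (\<Omega>\<^sub>1 \<inter> \<Omega>\<^sub>2) (\<beta>\<^sub>2 - dprime_on C \<Omega>\<^sub>2 r q \<delta>\<^sub>2)"
      using \<delta>(2) by (simp add: restrict_to_linear algebra_simps)
    moreover have "dprime_on C \<Omega>\<^sub>1 p q (\<beta>\<^sub>1 - dprime_on C \<Omega>\<^sub>1 r q \<delta>\<^sub>1) = dprime_on C \<Omega>\<^sub>1 p q \<beta>\<^sub>1"
      "dprime_on C \<Omega>\<^sub>2 p q (\<beta>\<^sub>2 - dprime_on C \<Omega>\<^sub>2 r q \<delta>\<^sub>2) = dprime_on C \<Omega>\<^sub>2 p q \<beta>\<^sub>2"
      using \<beta>(1,2) d(1,2) dd op
      by (simp_all add: dprime_on_diff[OF C]) (simp_all add: Suc dprime_on_dprime_on[OF C])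
    ultimately show ?thesis
      using \<beta> dd subs
      by (intro exI[of _ "\<beta>\<^sub>1 - dprime_on C \<Omega>\<^sub>1 r q \<delta>\<^sub>1"] exI[of _ "\<beta>\<^sub>2 - dprime_on C \<Omega>\<^sub>2 r q \<delta>\<^sub>2"])
        (auto intro: subspace_diff)
  qed
  then obtain \<beta>\<^sub>1' \<beta>\<^sub>2' where \<beta>': "\<beta>\<^sub>1' \<in> superforms_on C \<Omega>\<^sub>1 p q" "\<beta>\<^sub>2' \<in> superforms_on C \<Omega>\<^sub>2 p q"
      "restrict_to \<Omega>\<^sub>1 \<theta> = dprime_on C \<Omega>\<^sub>1 p q \<beta>\<^sub>1'" "restrict_to \<Omega>\<^sub>2 \<theta> = dprime_on C \<Omega>\<^sub>2 p q \<beta>\<^sub>2'"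
      "restrict_to (\<Omega>\<^sub>1 \<inter> \<Omega>\<^sub>2) \<beta>\<^sub>1' = restrict_to (\<Omega>\<^sub>1 \<inter> \<Omega>\<^sub>2) \<beta>\<^sub>2'"
    by blast
  obtain \<beta> where b: "\<beta> \<in> superforms_on C (\<Omega>\<^sub>1 \<union> \<Omega>\<^sub>2) p q"
    "restrict_to \<Omega>\<^sub>1 \<beta> = \<beta>\<^sub>1'" "restrict_to \<Omega>\<^sub>2 \<beta> = \<beta>\<^sub>2'"
    using \<beta>'(1,2,5) by (rule superforms_on_glue)
  have "\<theta> = dprime_on C (\<Omega>\<^sub>1 \<union> \<Omega>\<^sub>2) p q \<beta>"
  proof (rule superforms_on_eqI[OF \<theta> dprime_on_superforms_on[OF C b(1)]])
    show "restrict_to \<Omega>\<^sub>1 \<theta> = restrict_to \<Omega>\<^sub>1 (dprime_on C (\<Omega>\<^sub>1 \<union> \<Omega>\<^sub>2) p q \<beta>)"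
      unfolding \<beta>'(3) b(2)[symmetric] by (rule dprime_on_restrict_to[OF C b(1) Un_upper1 op(1)])
    show "restrict_to \<Omega>\<^sub>2 \<theta> = restrict_to \<Omega>\<^sub>2 (dprime_on C (\<Omega>\<^sub>1 \<union> \<Omega>\<^sub>2) p q \<beta>)"
      unfolding \<beta>'(4) b(3)[symmetric] by (rule dprime_on_restrict_to[OF C b(1) Un_upper2 op(2)])
  qed
  then show ?thesis using b(1) by (auto simp: coboundaries_def)
qed

text \<open>Cocycles are cut down to \<open>Z1\<close> and \<open>Z2\<close>, exact on the first and
  on both sets, each time with finite codimension. \<open>Z2\<close> is controlled by the overlap in
  degree \<open>p - 1\<close>; as primitives are not unique, the connecting map enters through a
  relation and its two projections.\<close>

lemma fin_mod_union:
  assumes fin: "\<And>p. fin_mod (cocycles C \<Omega>\<^sub>1 p q) (coboundaries C \<Omega>\<^sub>1 p q)"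
    "\<And>p. fin_mod (cocycles C \<Omega>\<^sub>2 p q) (coboundaries C \<Omega>\<^sub>2 p q)"
    "\<And>p. fin_mod (cocycles C (\<Omega>\<^sub>1 \<inter> \<Omega>\<^sub>2) p q) (coboundaries C (\<Omega>\<^sub>1 \<inter> \<Omega>\<^sub>2) p q)"
  shows "fin_mod (cocycles C (\<Omega>\<^sub>1 \<union> \<Omega>\<^sub>2) p q) (coboundaries C (\<Omega>\<^sub>1 \<union> \<Omega>\<^sub>2) p q)"
proof -
  define Z where "Z = cocycles C (\<Omega>\<^sub>1 \<union> \<Omega>\<^sub>2) p q"
  define Z1 where "Z1 = {\<theta> \<in> Z. restrict_to \<Omega>\<^sub>1 \<theta> \<in> coboundaries C \<Omega>\<^sub>1 p q}"
  define Z2 where "Z2 = {\<theta> \<in> Z1. restrict_to \<Omega>\<^sub>2 \<theta> \<in> coboundaries C \<Omega>\<^sub>2 p q}"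
  have Z: "subspace Z" unfolding Z_def by (rule subspace_cocycles[OF rel_open_Un_Int(1)])
  then have Z1: "subspace Z1"
    using subspace_coboundaries[OF op(1)]
    by (auto simp: Z1_def subspace_def restrict_to_linear)
  have r: "restrict_to \<Omega>\<^sub>1 ` Z \<subseteq> cocycles C \<Omega>\<^sub>1 p q" "restrict_to \<Omega>\<^sub>2 ` Z1 \<subseteq> cocycles C \<Omega>\<^sub>2 p q"
    using restrict_to_cocycles[of _ "\<Omega>\<^sub>1 \<union> \<Omega>\<^sub>2"] op by (auto simp: Z_def Z1_def)
  obtain S1 where S1: "finite S1" "Z \<subseteq> span (S1 \<union> Z1)"
    unfolding Z1_def
    by (rule fin_mod_preimage[OF Z subspace_coboundaries[OF op(1)] fin(1) r(1)])
      (auto simp: restrict_to_linear)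
  obtain S2 where S2: "finite S2" "Z1 \<subseteq> span (S2 \<union> Z2)"
    unfolding Z2_def
    by (rule fin_mod_preimage[OF Z1 subspace_coboundaries[OF op(2)] fin(2) r(2)])
      (auto simp: restrict_to_linear)
  have "fin_mod Z2 (coboundaries C (\<Omega>\<^sub>1 \<union> \<Omega>\<^sub>2) p q)"
  proof (cases p)
    case 0
    \<comment> \<open>Coboundaries in degree 0 vanish, so \<open>\<theta>\<close> is 0 on both
      sets.\<close>
    have "\<theta> = 0" if "\<theta> \<in> Z2" for \<theta>
    proof (rule superforms_on_eqI[of \<theta> p 0])
      show "\<theta> \<in> superforms_on C (\<Omega>\<^sub>1 \<union> \<Omega>\<^sub>2) p q"
        using that by (simp add: Z2_def Z1_def Z_def cocycles_def)
      show "0 \<in> superforms_on C (\<Omega>\<^sub>1 \<union> \<Omega>\<^sub>2) p q"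
        by (rule subspace_0[OF subspace_superforms_on[OF rel_open_Un_Int(1)]])
      show "restrict_to \<Omega>\<^sub>1 \<theta> = restrict_to \<Omega>\<^sub>1 0" "restrict_to \<Omega>\<^sub>2 \<theta> = restrict_to \<Omega>\<^sub>2 0"
        using that 0 unfolding restrict_to_linear(4)
        by (simp_all only: Z2_def Z1_def coboundaries_def) auto
    qed
    then have "Z2 \<subseteq> {0}" by blast
    then show ?thesis unfolding fin_mod_def by (intro exI[of _ "{}"]) (auto intro: span_zero)
  next
    case (Suc r)
    \<comment> \<open>The connecting map of the Mayer--Vietoris sequence, as a linear relation.\<close>
    define R where "R = {(\<theta>, \<gamma>). \<theta> \<in> superforms_on C (\<Omega>\<^sub>1 \<union> \<Omega>\<^sub>2) p q \<and>
      (\<exists>\<beta>\<^sub>1\<in>superforms_on C \<Omega>\<^sub>1 r q. \<exists>\<beta>\<^sub>2\<in>superforms_on C \<Omega>\<^sub>2 r q.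
        restrict_to \<Omega>\<^sub>1 \<theta> = dprime_on C \<Omega>\<^sub>1 r q \<beta>\<^sub>1 \<and> restrict_to \<Omega>\<^sub>2 \<theta> = dprime_on C \<Omega>\<^sub>2 r q \<beta>\<^sub>2 \<and>
        \<gamma> = restrict_to (\<Omega>\<^sub>1 \<inter> \<Omega>\<^sub>2) \<beta>\<^sub>1 - restrict_to (\<Omega>\<^sub>1 \<inter> \<Omega>\<^sub>2) \<beta>\<^sub>2)}"
    note subs = subspace_superforms_on[OF op(1), of r q] subspace_superforms_on[OF op(2), of r q]
      subspace_superforms_on[OF rel_open_Un_Int(1), of p q]
    have RI: "(\<theta>, \<gamma>) \<in> R"
      if "\<theta> \<in> superforms_on C (\<Omega>\<^sub>1 \<union> \<Omega>\<^sub>2) p q"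
        "\<beta>\<^sub>1 \<in> superforms_on C \<Omega>\<^sub>1 r q" "\<beta>\<^sub>2 \<in> superforms_on C \<Omega>\<^sub>2 r q"
        "restrict_to \<Omega>\<^sub>1 \<theta> = dprime_on C \<Omega>\<^sub>1 r q \<beta>\<^sub>1" "restrict_to \<Omega>\<^sub>2 \<theta> = dprime_on C \<Omega>\<^sub>2 r q \<beta>\<^sub>2"
        "\<gamma> = restrict_to (\<Omega>\<^sub>1 \<inter> \<Omega>\<^sub>2) \<beta>\<^sub>1 - restrict_to (\<Omega>\<^sub>1 \<inter> \<Omega>\<^sub>2) \<beta>\<^sub>2"
      for \<theta> \<gamma> \<beta>\<^sub>1 \<beta>\<^sub>2
      using that unfolding R_def by blast
    have R: "subspace R"
      unfolding subspace_def
    proof (intro conjI ballI allI)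
      have "dprime_on C \<Omega>\<^sub>1 r q 0 = 0" "dprime_on C \<Omega>\<^sub>2 r q 0 = 0"
        using dprime_on_scale[OF C subspace_0[OF subs(1)], of 0]
          dprime_on_scale[OF C subspace_0[OF subs(2)], of 0] by simp_all
      then show "0 \<in> R"
        using subs[THEN subspace_0] unfolding zero_prod_def
        by (intro RI[of _ 0 0]) (auto simp: restrict_to_linear)
    next
      fix x y assume "x \<in> R" "y \<in> R"
      then obtain \<theta> \<gamma> \<beta>\<^sub>1 \<beta>\<^sub>2 \<theta>' \<gamma>' \<beta>\<^sub>1' \<beta>\<^sub>2' where
        "x = (\<theta>, \<gamma>)" "\<theta> \<in> superforms_on C (\<Omega>\<^sub>1 \<union> \<Omega>\<^sub>2) p q"
        "\<beta>\<^sub>1 \<in> superforms_on C \<Omega>\<^sub>1 r q" "\<beta>\<^sub>2 \<in> superforms_on C \<Omega>\<^sub>2 r q"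
        "restrict_to \<Omega>\<^sub>1 \<theta> = dprime_on C \<Omega>\<^sub>1 r q \<beta>\<^sub>1" "restrict_to \<Omega>\<^sub>2 \<theta> = dprime_on C \<Omega>\<^sub>2 r q \<beta>\<^sub>2"
        "\<gamma> = restrict_to (\<Omega>\<^sub>1 \<inter> \<Omega>\<^sub>2) \<beta>\<^sub>1 - restrict_to (\<Omega>\<^sub>1 \<inter> \<Omega>\<^sub>2) \<beta>\<^sub>2"
        "y = (\<theta>', \<gamma>')" "\<theta>' \<in> superforms_on C (\<Omega>\<^sub>1 \<union> \<Omega>\<^sub>2) p q"
        "\<beta>\<^sub>1' \<in> superforms_on C \<Omega>\<^sub>1 r q" "\<beta>\<^sub>2' \<in> superforms_on C \<Omega>\<^sub>2 r q"
        "restrict_to \<Omega>\<^sub>1 \<theta>' = dprime_on C \<Omega>\<^sub>1 r q \<beta>\<^sub>1'" "restrict_to \<Omega>\<^sub>2 \<theta>' = dprime_on C \<Omega>\<^sub>2 r q \<beta>\<^sub>2'"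
        "\<gamma>' = restrict_to (\<Omega>\<^sub>1 \<inter> \<Omega>\<^sub>2) \<beta>\<^sub>1' - restrict_to (\<Omega>\<^sub>1 \<inter> \<Omega>\<^sub>2) \<beta>\<^sub>2'"
        unfolding R_def by auto
      moreover from this have "(\<theta> + \<theta>', \<gamma> + \<gamma>') \<in> R"
        by (intro RI[of _ "\<beta>\<^sub>1 + \<beta>\<^sub>1'" "\<beta>\<^sub>2 + \<beta>\<^sub>2'"])
          (simp_all add: restrict_to_linear dprime_on_add[OF C] subs[THEN subspace_add])
      ultimately show "x + y \<in> R" by simp
    next
      fix c :: real and x assume "x \<in> R"
      then obtain \<theta> \<gamma> \<beta>\<^sub>1 \<beta>\<^sub>2 where
        "x = (\<theta>, \<gamma>)" "\<theta> \<in> superforms_on C (\<Omega>\<^sub>1 \<union> \<Omega>\<^sub>2) p q"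
        "\<beta>\<^sub>1 \<in> superforms_on C \<Omega>\<^sub>1 r q" "\<beta>\<^sub>2 \<in> superforms_on C \<Omega>\<^sub>2 r q"
        "restrict_to \<Omega>\<^sub>1 \<theta> = dprime_on C \<Omega>\<^sub>1 r q \<beta>\<^sub>1" "restrict_to \<Omega>\<^sub>2 \<theta> = dprime_on C \<Omega>\<^sub>2 r q \<beta>\<^sub>2"
        "\<gamma> = restrict_to (\<Omega>\<^sub>1 \<inter> \<Omega>\<^sub>2) \<beta>\<^sub>1 - restrict_to (\<Omega>\<^sub>1 \<inter> \<Omega>\<^sub>2) \<beta>\<^sub>2"
        unfolding R_def by auto
      moreover from this have "(c *\<^sub>R \<theta>, c *\<^sub>R \<gamma>) \<in> R"
        by (intro RI[of _ "c *\<^sub>R \<beta>\<^sub>1" "c *\<^sub>R \<beta>\<^sub>2"])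
          (simp_all add: restrict_to_linear dprime_on_scale[OF C] scaleR_diff_right
            subs[THEN subspace_scale])
      ultimately show "c *\<^sub>R x \<in> R" by simp
    qed
    have sndR: "snd ` R \<subseteq> cocycles C (\<Omega>\<^sub>1 \<inter> \<Omega>\<^sub>2) r q"
    proof (rule image_subsetI)
      fix x assume "x \<in> R"
      then obtain \<theta> \<gamma> \<beta>\<^sub>1 \<beta>\<^sub>2 where
        x: "x = (\<theta>, \<gamma>)" "\<beta>\<^sub>1 \<in> superforms_on C \<Omega>\<^sub>1 r q" "\<beta>\<^sub>2 \<in> superforms_on C \<Omega>\<^sub>2 r q"
        "restrict_to \<Omega>\<^sub>1 \<theta> = dprime_on C \<Omega>\<^sub>1 r q \<beta>\<^sub>1" "restrict_to \<Omega>\<^sub>2 \<theta> = dprime_on C \<Omega>\<^sub>2 r q \<beta>\<^sub>2"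
        "\<gamma> = restrict_to (\<Omega>\<^sub>1 \<inter> \<Omega>\<^sub>2) \<beta>\<^sub>1 - restrict_to (\<Omega>\<^sub>1 \<inter> \<Omega>\<^sub>2) \<beta>\<^sub>2"
        unfolding R_def by auto
      have \<beta>r: "restrict_to (\<Omega>\<^sub>1 \<inter> \<Omega>\<^sub>2) \<beta>\<^sub>1 \<in> superforms_on C (\<Omega>\<^sub>1 \<inter> \<Omega>\<^sub>2) r q"
        "restrict_to (\<Omega>\<^sub>1 \<inter> \<Omega>\<^sub>2) \<beta>\<^sub>2 \<in> superforms_on C (\<Omega>\<^sub>1 \<inter> \<Omega>\<^sub>2) r q"
        using x rel_open_Un_Int by (auto intro: restrict_to_superforms_on)
      have "dprime_on C (\<Omega>\<^sub>1 \<inter> \<Omega>\<^sub>2) r q \<gamma> = restrict_to (\<Omega>\<^sub>1 \<inter> \<Omega>\<^sub>2) (restrict_to \<Omega>\<^sub>1 \<theta>)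
          - restrict_to (\<Omega>\<^sub>1 \<inter> \<Omega>\<^sub>2) (restrict_to \<Omega>\<^sub>2 \<theta>)"
        unfolding x(6) dprime_on_diff[OF C \<beta>r rel_open_Un_Int(2)] using x rel_open_Un_Int
        by (simp add: dprime_on_restrict_to[OF C])
      also have "\<dots> = 0" by (simp add: restrict_to_restrict_to Int_commute Int_left_commute)
      finally show "snd x \<in> cocycles C (\<Omega>\<^sub>1 \<inter> \<Omega>\<^sub>2) r q"
        using \<beta>r subspace_diff[OF subspace_superforms_on[OF rel_open_Un_Int(2)]] by (simp add: cocycles_def x)
    qed
    \<comment> \<open>\<open>snd\<close> is a genuine linear map on \<open>R\<close>. Pairs that it
      sends to coboundaries have an exact first component by \<open>coboundary_glue\<close>, so
      \<open>fst\<close> carries the finiteness over to \<open>Z2\<close>.\<close>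
    obtain S where S: "finite S" "R \<subseteq> span (S \<union> {x \<in> R. snd x \<in> coboundaries C (\<Omega>\<^sub>1 \<inter> \<Omega>\<^sub>2) r q})"
      by (rule fin_mod_preimage[OF R subspace_coboundaries[OF rel_open_Un_Int(2)] fin(3) sndR]) auto
    have "fst ` {x \<in> R. snd x \<in> coboundaries C (\<Omega>\<^sub>1 \<inter> \<Omega>\<^sub>2) r q} \<subseteq> coboundaries C (\<Omega>\<^sub>1 \<union> \<Omega>\<^sub>2) p q"
      unfolding R_def Suc by (auto intro: coboundary_glue)
    then have "span (fst ` (S \<union> {x \<in> R. snd x \<in> coboundaries C (\<Omega>\<^sub>1 \<inter> \<Omega>\<^sub>2) r q}))
        \<subseteq> span (fst ` S \<union> coboundaries C (\<Omega>\<^sub>1 \<union> \<Omega>\<^sub>2) p q)"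
      by (intro span_mono) auto
    moreover have "Z2 \<subseteq> fst ` R"
    proof
      fix \<theta> assume "\<theta> \<in> Z2"
      then obtain \<beta>\<^sub>1 \<beta>\<^sub>2 where "\<theta> \<in> superforms_on C (\<Omega>\<^sub>1 \<union> \<Omega>\<^sub>2) p q"
        "\<beta>\<^sub>1 \<in> superforms_on C \<Omega>\<^sub>1 r q" "restrict_to \<Omega>\<^sub>1 \<theta> = dprime_on C \<Omega>\<^sub>1 r q \<beta>\<^sub>1"
        "\<beta>\<^sub>2 \<in> superforms_on C \<Omega>\<^sub>2 r q" "restrict_to \<Omega>\<^sub>2 \<theta> = dprime_on C \<Omega>\<^sub>2 r q \<beta>\<^sub>2"
        by (auto simp: Z2_def Z1_def Z_def cocycles_def coboundaries_def Suc)
      then have "(\<theta>, restrict_to (\<Omega>\<^sub>1 \<inter> \<Omega>\<^sub>2) \<beta>\<^sub>1 - restrict_to (\<Omega>\<^sub>1 \<inter> \<Omega>\<^sub>2) \<beta>\<^sub>2) \<in> R"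
        by (intro RI) auto
      then show "\<theta> \<in> fst ` R" by force
    qed
    moreover have "fst ` R \<subseteq> span (fst ` (S \<union> {x \<in> R. snd x \<in> coboundaries C (\<Omega>\<^sub>1 \<inter> \<Omega>\<^sub>2) r q}))"
      using S(2) span_linear_image[OF linear_fst] by blast
    ultimately show ?thesis unfolding fin_mod_def using S(1) by (intro exI[of _ "fst ` S"]) auto
  qed
  then have "fin_mod Z1 (coboundaries C (\<Omega>\<^sub>1 \<union> \<Omega>\<^sub>2) p q)" by (rule fin_mod_span[OF S2])
  then show ?thesis using fin_mod_span[OF S1] by (simp add: Z_def)
qed

end

end

section \<open>Zero sets of smooth functions\<close>

lemma flat_nonneg: "0 \<le> flat m t"
  by (simp add: flat_def)

lemma flat_0_eq_0_iff: "flat 0 t = 0 \<longleftrightarrow> t \<le> 0"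
  by (simp add: flat_def)

text \<open>Nonnegativity lets a sum of functions describe an intersection; products describe
  unions.\<close>

definition smooth_zero_set :: "'a::euclidean_space set \<Rightarrow> bool" where
  "smooth_zero_set K \<longleftrightarrow> (\<exists>h. smooth_on h UNIV \<and> (\<forall>x. 0 \<le> h x) \<and> K = {x. h x = 0})"

lemma smooth_zero_set_halfspace: "smooth_zero_set {x. a \<bullet> x \<le> b}"
proof -
  have "smooth_on (\<lambda>x. flat 0 (a \<bullet> x - b)) UNIV"
    by (intro smooth_on_flat smooth_on_diff smooth_on_linear smooth_on_const open_UNIV
        bounded_linear.linear bounded_linear_inner_right)
  then show ?thesis unfolding smooth_zero_set_def
    by (intro exI[of _ "\<lambda>x. flat 0 (a \<bullet> x - b)"]) (simp add: flat_nonneg flat_0_eq_0_iff)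
qed

lemma smooth_zero_set_Int:
  assumes "smooth_zero_set K" "smooth_zero_set L"
  shows "smooth_zero_set (K \<inter> L)"
proof -
  obtain h g where "smooth_on h UNIV" "\<forall>x. 0 \<le> h x" "K = {x. h x = 0}"
    "smooth_on g UNIV" "\<forall>x. 0 \<le> g x" "L = {x. g x = 0}"
    using assms unfolding smooth_zero_set_def by blast
  then show ?thesis unfolding smooth_zero_set_def
    by (intro exI[of _ "\<lambda>x. h x + g x"]) (auto simp: add_nonneg_eq_0_iff smooth_on_add)
qed

lemma smooth_zero_set_Un:
  assumes "smooth_zero_set K" "smooth_zero_set L"
  shows "smooth_zero_set (K \<union> L)"
proof -
  obtain h g where "smooth_on h UNIV" "\<forall>x. 0 \<le> h x" "K = {x. h x = 0}"
    "smooth_on g UNIV" "\<forall>x. 0 \<le> g x" "L = {x. g x = 0}"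
    using assms unfolding smooth_zero_set_def by blast
  then show ?thesis unfolding smooth_zero_set_def
    by (intro exI[of _ "\<lambda>x. h x * g x"]) (auto simp: smooth_on_mult)
qed

lemma smooth_zero_set_Inter:
  assumes "finite F" "\<And>K. K \<in> F \<Longrightarrow> smooth_zero_set K"
  shows "smooth_zero_set (\<Inter>F)"
  using assms
proof (induction F)
  case empty
  show ?case unfolding smooth_zero_set_def
    by (intro exI[of _ "\<lambda>x. 0"]) (simp add: smooth_on_const)
qed (simp add: smooth_zero_set_Int)

lemma smooth_zero_set_Union:
  assumes "finite F" "\<And>K. K \<in> F \<Longrightarrow> smooth_zero_set K"
  shows "smooth_zero_set (\<Union>F)"
  using assms
proof (induction F)
  case empty
  show ?case unfolding smooth_zero_set_def
    by (intro exI[of _ "\<lambda>x. 1"]) (simp add: smooth_on_const)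
qed (simp add: smooth_zero_set_Un)

lemma smooth_zero_set_polyhedron:
  assumes "polyhedron P"
  shows "smooth_zero_set P"
proof -
  obtain F where F: "finite F" "P = \<Inter>F" "\<forall>h\<in>F. \<exists>a b. a \<noteq> 0 \<and> h = {x. a \<bullet> x \<le> b}"
    using assms unfolding polyhedron_def by blast
  have "smooth_zero_set h" if "h \<in> F" for h
  proof -
    from bspec[OF F(3) that] obtain a b where "h = {x. a \<bullet> x \<le> b}" by (elim exE conjE)
    then show ?thesis by (simp only: smooth_zero_set_halfspace)
  qed
  then show ?thesis unfolding F(2) by (rule smooth_zero_set_Inter[OF F(1)])
qed

text \<open>The quotient of \<open>h\<^sub>1\<close> by \<open>h\<^sub>1 + h\<^sub>2\<close> would
  vanish on \<open>K\<^sub>1\<close> but not near it, so flat cutoffs of weighted differences take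
  the place of the two functions.\<close>

lemma splitting_complements:
  assumes "smooth_zero_set K\<^sub>1" "smooth_zero_set K\<^sub>2"
  shows "splitting (X - K\<^sub>1) (X - K\<^sub>2)"
proof -
  obtain h\<^sub>1 h\<^sub>2 where h: "smooth_on h\<^sub>1 UNIV" "\<And>x. 0 \<le> h\<^sub>1 x" "K\<^sub>1 = {x. h\<^sub>1 x = 0}"
    "smooth_on h\<^sub>2 UNIV" "\<And>x. 0 \<le> h\<^sub>2 x" "K\<^sub>2 = {x. h\<^sub>2 x = 0}"
    using assms unfolding smooth_zero_set_def by blast
  note cont = smooth_on_continuous[OF h(1)] smooth_on_continuous[OF h(4)]
  define Y where "Y = {x. 0 < h\<^sub>1 x + h\<^sub>2 x}"
  \<comment> \<open>The factor 2 makes the regions \<open>a > 0\<close> and \<open>b > 0\<close>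
    overlap: they cover \<open>Y\<close>, yet each avoids an open set around the points where its
    function must vanish. With factor 1 both would be 0 where
    \<open>h\<^sub>1 = h\<^sub>2\<close>.\<close>
  define a where "a = (\<lambda>x. flat 0 (2 * h\<^sub>1 x - h\<^sub>2 x))"
  define b where "b = (\<lambda>x. flat 0 (2 * h\<^sub>2 x - h\<^sub>1 x))"
  define \<phi> where "\<phi> = (\<lambda>x. a x * inverse (a x + b x))"
  have pos: "h\<^sub>1 x > 0 \<longleftrightarrow> x \<notin> K\<^sub>1" "h\<^sub>2 x > 0 \<longleftrightarrow> x \<notin> K\<^sub>2" for x
    using h(2)[of x] h(5)[of x] by (auto simp: h(3,6))
  have Y: "open Y" unfolding Y_def by (intro open_Collect_less continuous_intros cont)
  have sm: "smooth_on h\<^sub>1 Y" "smooth_on h\<^sub>2 Y" using h(1,4) smooth_on_subset by blast+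
  have ab: "smooth_on a Y" "smooth_on b Y"
    unfolding a_def b_def using Y sm
    by (auto intro!: smooth_on_flat smooth_on_diff smooth_on_mult smooth_on_const)
  have ne: "a x + b x \<noteq> 0" if "x \<in> Y" for x
  proof
    assume "a x + b x = 0"
    then have "a x = 0" "b x = 0"
      using add_nonneg_eq_0_iff[of "a x" "b x"] by (simp_all add: a_def b_def flat_nonneg)
    then have "2 * h\<^sub>1 x \<le> h\<^sub>2 x" "2 * h\<^sub>2 x \<le> h\<^sub>1 x" by (simp_all add: a_def b_def flat_0_eq_0_iff)
    then show False using that by (simp add: Y_def)
  qed
  have "smooth_on \<phi> Y"
    unfolding \<phi>_def using Y ab ne by (intro smooth_on_mult smooth_on_inverse smooth_on_add)
  moreover have "open {x. 2 * h\<^sub>1 x < h\<^sub>2 x}" "open {x. 2 * h\<^sub>2 x < h\<^sub>1 x}"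
    by (intro open_Collect_less continuous_intros cont)+
  moreover have "X - K\<^sub>1 \<union> (X - K\<^sub>2) \<subseteq> Y"
    using pos h(2,5) by (auto simp: Y_def intro: add_pos_nonneg add_nonneg_pos)
  moreover have "(X - K\<^sub>2) - (X - K\<^sub>1) \<subseteq> {x. 2 * h\<^sub>1 x < h\<^sub>2 x}"
    "(X - K\<^sub>1) - (X - K\<^sub>2) \<subseteq> {x. 2 * h\<^sub>2 x < h\<^sub>1 x}"
    using pos h(3,6) by auto
  moreover have "\<phi> x = 0" if "2 * h\<^sub>1 x < h\<^sub>2 x" for x
    using that by (simp add: \<phi>_def a_def flat_0_eq_0_iff)
  moreover have "\<phi> x = 1" if "2 * h\<^sub>2 x < h\<^sub>1 x" "x \<in> Y" for x
  proof -
    have "b x = 0" using that by (simp add: b_def flat_0_eq_0_iff)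
    then show ?thesis using ne[OF that(2)] by (simp add: \<phi>_def)
  qed
  ultimately show ?thesis
    unfolding splitting_def using Y
    by (intro exI[of _ Y] exI[of _ "{x. 2 * h\<^sub>1 x < h\<^sub>2 x}"] exI[of _ "{x. 2 * h\<^sub>2 x < h\<^sub>1 x}"]
        exI[of _ \<phi>]) auto
qed

section \<open>Open stars\<close>

text \<open>For a point \<open>x\<close> in the relative interior of \<open>\<sigma> \<in> C\<close>, \<open>open_star C {x}\<close> is the usual open
  star of \<open>\<sigma>\<close>. Allowing arbitrary sets \<open>A\<close> makes the family closed under intersection.\<close>

definition open_star :: "'a set set \<Rightarrow> 'a set \<Rightarrow> 'a set" where
  "open_star C A = supp C - \<Union>{\<tau> \<in> C. \<not> A \<subseteq> \<tau>}"

lemma open_star_Int: "open_star C A \<inter> open_star C B = open_star C (A \<union> B)"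
  by (auto simp: open_star_def)

text \<open>Each evaluation is one linear functional and costs at most one dimension.\<close>

lemma fin_mod_eval:
  fixes Z :: "('b \<Rightarrow> real) set"
  assumes "finite P" "subspace Z"
  shows "fin_mod Z {f \<in> Z. \<forall>v\<in>P. f v = 0}"
  using assms
proof (induction P arbitrary: Z)
  case empty
  then show ?case using span_superset[of Z] unfolding fin_mod_def by (intro exI[of _ "{}"]) simp
next
  case (insert v P)
  have "x = x *\<^sub>R 1" for x :: real by simp
  then have "(UNIV :: real set) \<subseteq> span ({1} \<union> {0})"
    by (metis UnI1 insertI1 span_base span_scale subsetI)
  then have "fin_mod (UNIV :: real set) {0}"
    unfolding fin_mod_def by (intro exI[of _ "{1}"]) simp
  then obtain S where S: "finite S" "Z \<subseteq> span (S \<union> {f \<in> Z. f v \<in> {0}})"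
    by (rule fin_mod_preimage[OF insert.prems subspace_single_0, where f = "\<lambda>f. f v"]) auto
  have "subspace {f \<in> Z. f v \<in> {0}}" using insert.prems by (auto simp: subspace_def)
  from insert.IH[OF this]
  have "fin_mod {f \<in> Z. f v \<in> {0}} {f \<in> Z. \<forall>u\<in>insert v P. f u = 0}"
    by (simp add: conj_ac)
  then show ?case by (rule fin_mod_span[OF S])
qed

lemma fin_mod_alternating_forms: "fin_mod (alternating_forms q) {0 :: (nat \<Rightarrow> 'a::euclidean_space) \<Rightarrow> real}"
proof -
  \<comment> \<open>\<open>\<Pi>\<^sub>E\<close> fixes the entries from \<open>q\<close> on, so
    \<open>P\<close> is finite; an alternating \<open>q\<close>-form does not see these
    entries.\<close>
  define P :: "(nat \<Rightarrow> 'a) set" where "P = (\<Pi>\<^sub>E i\<in>{..<q}. Basis)"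
  have "f = 0" if f: "f \<in> alternating_forms q" "\<forall>v\<in>P. f v = 0" for f
  proof
    fix v
    show "f v = 0 v"
      unfolding zero_fun_apply
    proof (rule alternating_eqI_Basis[OF f(1)])
      fix v :: "nat \<Rightarrow> 'a" assume "\<And>i. i < q \<Longrightarrow> v i \<in> Basis"
      then have "restrict v {..<q} \<in> P" by (auto simp: P_def)
      moreover have "f v = f (restrict v {..<q})" by (rule alternating_cong[OF f(1)]) simp
      ultimately show "f v = 0" using f(2) by simp
    qed
  qed
  moreover have "(0 :: (nat \<Rightarrow> 'a) \<Rightarrow> real) \<in> alternating_forms q"
    by (rule subspace_0[OF subspace_alternating_forms])
  ultimately have "{f \<in> alternating_forms q. \<forall>v\<in>P. f v = 0} = {0}" by auto
  moreover have "finite P" by (simp add: P_def finite_PiE)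
  ultimately show ?thesis using fin_mod_eval[OF _ subspace_alternating_forms, of P q] by simp
qed

text \<open>By compactness a segment in \<open>V\<close> has a uniform margin \<open>e\<close>, and
  moving its end \<open>x\<close> by less than \<open>e\<close> moves each of its points by less
  than \<open>e\<close>.\<close>

lemma open_rays_subset:
  fixes z :: "'a::real_normed_vector"
  assumes "open V"
  shows "open {x. \<forall>t\<in>{0..1}. z + t *\<^sub>R (x - z) \<in> V}"
  unfolding open_dist
proof (intro ballI)
  fix x assume x: "x \<in> {x. \<forall>t\<in>{0..1}. z + t *\<^sub>R (x - z) \<in> V}"
  have "compact ((\<lambda>t. z + t *\<^sub>R (x - z)) ` {0..1})"
    by (intro compact_continuous_image continuous_intros) simp
  then obtain e where e: "e > 0" "(\<Union>y\<in>(\<lambda>t. z + t *\<^sub>R (x - z)) ` {0..1}. ball y e) \<subseteq> V"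
    using x assms by (elim compact_subset_open_imp_ball_epsilon_subset[where B = V]) auto
  have "z + t *\<^sub>R (y - z) \<in> V" if "dist y x < e" "t \<in> {0..1}" for y t
  proof -
    have "dist (z + t *\<^sub>R (x - z)) (z + t *\<^sub>R (y - z)) = norm (t *\<^sub>R (x - y))"
      by (simp add: dist_norm algebra_simps)
    also have "\<dots> = t * dist y x"
      using that by (simp add: dist_norm norm_minus_commute)
    also have "\<dots> \<le> 1 * dist y x" using that by (intro mult_right_mono) auto
    also have "\<dots> < e" using that by simp
    finally have "z + t *\<^sub>R (y - z) \<in> ball (z + t *\<^sub>R (x - z)) e" by simp
    then show ?thesis using e(2) that(2) by blast
  qed
  then show "\<exists>e>0. \<forall>y. dist y x < e \<longrightarrow> y \<in> {x. \<forall>t\<in>{0..1}. z + t *\<^sub>R (x - z) \<in> V}"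
    using e(1) by blast
qed

lemma direction_space_diff: "x \<in> \<sigma> \<Longrightarrow> y \<in> \<sigma> \<Longrightarrow> x - y \<in> direction_space \<sigma>"
  unfolding direction_space_def using hull_subset[of \<sigma> affine] by blast

context
  fixes C :: "'a::euclidean_space set set" and q :: nat
  assumes C: "polyhedral_complex C"
begin

lemma finite_complex: "finite C" and polyhedron_cell: "\<sigma> \<in> C \<Longrightarrow> polyhedron \<sigma>"
  and face_of_cell: "\<sigma> \<in> C \<Longrightarrow> F face_of \<sigma> \<Longrightarrow> F \<in> C"
  and Int_cells_face_of: "\<sigma> \<in> C \<Longrightarrow> \<tau> \<in> C \<Longrightarrow> (\<sigma> \<inter> \<tau>) face_of \<sigma>"
  using C unfolding polyhedral_complex_def by blast+

lemma open_star_eq_Diff: "\<exists>K. smooth_zero_set K \<and> open_star C A = supp C - K"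
proof -
  have "smooth_zero_set (\<Union>{\<tau> \<in> C. \<not> A \<subseteq> \<tau>})"
    by (rule smooth_zero_set_Union) (simp_all add: finite_complex polyhedron_cell smooth_zero_set_polyhedron)
  then show ?thesis
    by (intro exI[of _ "\<Union>{\<tau> \<in> C. \<not> A \<subseteq> \<tau>}"]) (simp add: open_star_def)
qed

lemma rel_open_Diff_zero_set: "smooth_zero_set K \<Longrightarrow> rel_open C (supp C - K)"
proof -
  assume "smooth_zero_set K"
  then obtain h where h: "smooth_on h UNIV" "K = {x. h x = 0}" unfolding smooth_zero_set_def by blast
  have "closed K" unfolding h(2)
    by (intro closed_Collect_eq smooth_on_continuous[OF h(1)] continuous_intros)
  then show ?thesis unfolding openin_open by (intro exI[of _ "- K"]) auto
qed

section \<open>Cohomology of a piece that is star-shaped within every cell\<close>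

context
  fixes \<Omega> z
  assumes \<Omega>: "rel_open C \<Omega>" and z: "z \<in> \<Omega>"
    and ray: "\<And>\<sigma> x t. \<sigma> \<in> C \<Longrightarrow> x \<in> \<sigma> \<Longrightarrow> x \<in> \<Omega> \<Longrightarrow> t \<in> {0..1} \<Longrightarrow> z + t *\<^sub>R (x - z) \<in> \<sigma> \<inter> \<Omega>"
begin

text \<open>The given neighbourhood \<open>V\<close> may fail to be star-shaped although its trace
  is. \<open>W\<close> is the largest subset of \<open>V\<close> that is star-shaped about
  \<open>z\<close>, and by \<open>ray\<close> it still contains \<open>\<Omega>\<close>.\<close>

lemma star_representative:
  assumes "\<theta> \<in> superforms_on C \<Omega> p q"
  obtains W \<alpha> where "open W" "star_at z W" "W \<inter> supp C = \<Omega>" "\<alpha> \<in> superforms p q W"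
    "\<theta> = restr C \<Omega> p q \<alpha>"
proof -
  obtain V \<alpha> where V: "open V" "V \<inter> supp C = \<Omega>" "\<alpha> \<in> superforms p q V" "\<theta> = restr C \<Omega> p q \<alpha>"
    using assms by (rule superforms_onE)
  define W where "W = {x. \<forall>t\<in>{0..1}. z + t *\<^sub>R (x - z) \<in> V}"
  have W: "open W" unfolding W_def by (rule open_rays_subset[OF V(1)])
  have WV: "W \<subseteq> V"
  proof
    fix x assume "x \<in> W"
    then have "z + 1 *\<^sub>R (x - z) \<in> V" unfolding W_def by (auto simp del: scaleR_one)
    then show "x \<in> V" by simp
  qed
  have "\<Omega> \<subseteq> W"
  proof
    fix x assume x: "x \<in> \<Omega>"
    then obtain \<sigma> where "\<sigma> \<in> C" "x \<in> \<sigma>" using V(2) by (auto simp: supp_def)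
    then show "x \<in> W" using ray[OF _ _ x] V(2) unfolding W_def by blast
  qed
  then have W\<Omega>: "W \<inter> supp C = \<Omega>" using WV V(2) by blast
  have "star_at z W"
    unfolding star_at_def
  proof (intro ballI)
    fix x and t :: real assume x: "x \<in> W" and t: "t \<in> {0..1}"
    have "z + s *\<^sub>R (z + t *\<^sub>R (x - z) - z) \<in> V" if "s \<in> {0..1}" for s
    proof -
      have "s * t \<in> {0..1}" using that t by (auto simp: mult_le_one)
      then have "z + (s * t) *\<^sub>R (x - z) \<in> V" using x by (auto simp: W_def)
      then show ?thesis by simp
    qed
    then show "z + t *\<^sub>R (x - z) \<in> W" by (simp add: W_def)
  qed
  moreover have "\<theta> = restr C \<Omega> p q (shrink W \<alpha>)"
    unfolding V(4) by (rule restr_cong) (use W\<Omega> in auto)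
  ultimately show thesis using that[OF W _ W\<Omega> shrink_superforms[OF V(1) W WV V(3)]] by blast
qed

lemma cocycle_vanishes:
  assumes "dprime_on C \<Omega> p q (restr C \<Omega> p q \<alpha>) = 0" "open W" "W \<inter> supp C = \<Omega>" "\<alpha> \<in> superforms p q W"
    and "\<sigma> \<in> C" "x \<in> \<sigma> \<inter> \<Omega>" "\<forall>i<Suc p. v i \<in> direction_space \<sigma>" "\<forall>j<q. w j \<in> direction_space \<sigma>"
  shows "exterior_derivative p W (slice w \<alpha>) x v = 0"
proof -
  have "restr C \<Omega> (Suc p) q (dprime p W \<alpha>) = 0"
    using assms(1) dprime_on_restr[OF C assms(2-4)] by simp
  then have "restr C \<Omega> (Suc p) q (dprime p W \<alpha>) \<sigma> x v w = 0" by simp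
  then show ?thesis using assms(5-8) by (simp add: restr_def dprime_eq_lift lift_def)
qed

text \<open>Within a cell the derivative along the ray from \<open>z\<close> vanishes, so on
  tangential \<open>w\<close> the value at \<open>x\<close> is the one at \<open>z\<close>. The
  cocycle thus comes from a single alternating \<open>q\<close>-form.\<close>

lemma fin_mod_star_0: "fin_mod (cocycles C \<Omega> 0 q) B"
proof -
  define G where "G = (\<lambda>\<eta>. restr C \<Omega> 0 q (\<lambda>x v w. \<eta> w))"
  have linG: "linear G" by (rule linearI) (auto simp: G_def restr_def fun_eq_iff)
  have "cocycles C \<Omega> 0 q \<subseteq> G ` alternating_forms q"
  proof
    fix \<theta> assume \<theta>: "\<theta> \<in> cocycles C \<Omega> 0 q"
    then have "\<theta> \<in> superforms_on C \<Omega> 0 q" by (simp add: cocycles_def)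
    then obtain W \<alpha> where W: "open W" "star_at z W" "W \<inter> supp C = \<Omega>" "\<alpha> \<in> superforms 0 q W"
      "\<theta> = restr C \<Omega> 0 q \<alpha>"
      by (rule star_representative)
    have d: "dprime_on C \<Omega> 0 q (restr C \<Omega> 0 q \<alpha>) = 0" using \<theta> W(5) by (simp add: cocycles_def)
    \<comment> \<open>A form of degree 0 ignores its vectors, so \<open>\<lambda>_. 0\<close> is a
      placeholder.\<close>
    have "\<alpha> x v w = \<alpha> z (\<lambda>_. 0) w"
      if \<sigma>: "\<sigma> \<in> C" "x \<in> \<sigma> \<inter> \<Omega>" and w: "\<forall>j<q. w j \<in> direction_space \<sigma>" for \<sigma> x v w
    proof -
      note sl = slice_smooth_forms[OF W(1,4), of w]
      have "((\<lambda>t. slice w \<alpha> (z + t *\<^sub>R (x - z)) v) has_real_derivative 0) (at t)"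
        if t: "0 \<le> t" "t \<le> 1" for t
      proof -
        define y where "y = z + t *\<^sub>R (x - z)"
        have y: "y \<in> \<sigma> \<inter> \<Omega>" using ray[OF \<sigma>(1), of x t] \<sigma> t by (simp add: y_def)
        \<comment> \<open>At \<open>t = 0\<close> the hypothesis \<open>ray\<close> says that
          \<open>z\<close> lies in every cell that meets \<open>\<Omega>\<close>.\<close>
        have "z \<in> \<sigma>" using ray[OF \<sigma>(1), of x 0] \<sigma> by simp
        then have "x - z \<in> direction_space \<sigma>" using \<sigma> by (auto intro: direction_space_diff)
        then have "exterior_derivative 0 W (slice w \<alpha>) y (ins 0 (x - z) v) = 0"
          using y w by (intro cocycle_vanishes[OF d W(1,3,4) \<sigma>(1)]) auto
        then have "dird (x - z) (\<lambda>y. slice w \<alpha> y v) y = 0"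
          using y W(3) by (auto simp: exterior_derivative_def)
        then show ?thesis
          using DERIV_line[OF smooth_form_differentiable[OF sl], of z t "x - z" v] y W(3)
          by (auto simp: y_def)
      qed
      from MVT2[OF zero_less_one this]
      have "slice w \<alpha> (z + 1 *\<^sub>R (x - z)) v = slice w \<alpha> (z + 0 *\<^sub>R (x - z)) v" by fastforce
      also have "slice w \<alpha> (z + 0 *\<^sub>R (x - z)) v = slice w \<alpha> z (\<lambda>_. 0)"
        using alternating_cong[OF smooth_form_alternating[OF sl]] by simp
      finally show ?thesis by simp
    qed
    then have "\<theta> = G (\<alpha> z (\<lambda>_. 0))" unfolding W(5) G_def restr_eq_iff by blast
    then show "\<theta> \<in> G ` alternating_forms q" using superform_alternating[OF W(4)] by blast
  qed
  moreover obtain T where T: "finite T" "alternating_forms q \<subseteq> span (T \<union> {0 :: (nat \<Rightarrow> 'a) \<Rightarrow> real})"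
    using fin_mod_alternating_forms unfolding fin_mod_def by blast
  ultimately have "cocycles C \<Omega> 0 q \<subseteq> span (G ` (T \<union> {0}))"
    unfolding span_linear_image[OF linG] by blast
  also have "\<dots> \<subseteq> span (G ` (T \<union> {0}) \<union> B)" by (rule span_mono) blast
  finally show ?thesis unfolding fin_mod_def using T(1) by (intro exI[of _ "G ` (T \<union> {0})"]) simp
qed

text \<open>The primitive is the homotopy operator applied to a representative on a star-shaped
  neighbourhood; the remaining term of \<open>homotopy_formula\<close> is shown to be 0 cell by
  cell.\<close>

lemma poincare_lemma: "cocycles C \<Omega> (Suc p) q \<subseteq> coboundaries C \<Omega> (Suc p) q"
proof
  fix \<theta> assume \<theta>: "\<theta> \<in> cocycles C \<Omega> (Suc p) q"
  then have "\<theta> \<in> superforms_on C \<Omega> (Suc p) q" by (simp add: cocycles_def)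
  then obtain W \<alpha> where W: "open W" "star_at z W" "W \<inter> supp C = \<Omega>" "\<alpha> \<in> superforms (Suc p) q W"
    "\<theta> = restr C \<Omega> (Suc p) q \<alpha>"
    by (rule star_representative)
  have d: "dprime_on C \<Omega> (Suc p) q (restr C \<Omega> (Suc p) q \<alpha>) = 0"
    using \<theta> W(5) by (simp add: cocycles_def)
  note hs = homotopy_smooth_forms[OF W(1,2)]
  define \<beta> where "\<beta> = lift (homotopy z p W) \<alpha>"
  have \<beta>: "\<beta> \<in> superforms p q W"
    unfolding \<beta>_def
  proof (rule lift_superforms[OF W(1) hs _ _ W(4)])
    fix \<omega> \<omega>' assume \<omega>: "\<omega> \<in> smooth_forms (Suc p) W" "\<omega>' \<in> smooth_forms (Suc p) W"
    show "homotopy z p W (\<omega> + \<omega>') = homotopy z p W \<omega> + homotopy z p W \<omega>'"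
      using \<omega>[THEN smooth_form_continuous[OF W(1,2)]]
      by (auto simp: fun_eq_iff homotopy_def ray_integral_add[OF W(2)] continuous_intros)
  next
    fix c \<omega>
    show "homotopy z p W (c *\<^sub>R \<omega>) = c *\<^sub>R homotopy z p W \<omega>"
      by (auto simp: fun_eq_iff homotopy_def ray_integral_cmult)
  qed
  have "\<theta> = restr C \<Omega> (Suc p) q (dprime p W \<beta>)"
    unfolding W(5) restr_eq_iff
  proof (intro ballI allI impI)
    fix \<sigma> x v w
    assume \<sigma>: "\<sigma> \<in> C" "x \<in> \<sigma> \<inter> \<Omega>"
      and vw: "(\<forall>i<Suc p. v i \<in> direction_space \<sigma>) \<and> (\<forall>j<q. w j \<in> direction_space \<sigma>)"
    have x: "x \<in> W" using \<sigma> W(3) by auto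
    have "z \<in> \<sigma>" using ray[OF \<sigma>(1), of x 0] \<sigma> by simp
    then have "x - z \<in> direction_space \<sigma>" using \<sigma> by (auto intro: direction_space_diff)
    then have dir: "ins 0 (x - z) v i \<in> direction_space \<sigma>" if "i < Suc (Suc p)" for i
      using that vw by (cases i) auto
    \<comment> \<open>The integrand of the error term is evaluated at points of
      \<open>\<sigma>\<close> on \<open>x - z\<close> and the \<open>v i\<close>, all tangent to
      \<open>\<sigma>\<close>, where closedness applies.\<close>
    have vanish: "exterior_derivative (Suc p) W (slice w \<alpha>) (z + t *\<^sub>R (x - z)) (ins 0 (x - z) v) = 0"
      if "t \<in> {0..1}" for t
      using ray[OF \<sigma>(1), of x t] \<sigma> that vw dir
      by (intro cocycle_vanishes[OF d W(1,3,4) \<sigma>(1)]) auto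
    have "integral {0..1} (\<lambda>t. t ^ Suc p * exterior_derivative (Suc p) W (slice w \<alpha>)
        (z + t *\<^sub>R (x - z)) (ins 0 (x - z) v)) = integral {0..1} (\<lambda>t::real. 0)"
      by (rule integral_cong) (simp add: vanish)
    then have "homotopy z (Suc p) W (exterior_derivative (Suc p) W (slice w \<alpha>)) x v = 0"
      using x by (simp add: homotopy_def ray_integral_def)
    moreover have "slice w \<beta> = homotopy z p W (slice w \<alpha>)"
      by (simp add: \<beta>_def lift_def fun_eq_iff)
    ultimately show "\<alpha> x v w = dprime p W \<beta> x v w"
      using homotopy_formula[OF W(1,2) slice_smooth_forms[OF W(1,4), of w] x, of v]
      by (simp add: dprime_eq_lift lift_def)
  qed
  then have "\<theta> = dprime_on C \<Omega> p q (restr C \<Omega> p q \<beta>)"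
    using dprime_on_restr[OF C W(1,3) \<beta>] by simp
  then show "\<theta> \<in> coboundaries C \<Omega> (Suc p) q"
    using superforms_onI[OF W(1,3) \<beta>] by (simp add: coboundaries_def)
qed

lemma fin_mod_star: "fin_mod (cocycles C \<Omega> p q) (coboundaries C \<Omega> p q)"
proof (cases p)
  case 0
  then show ?thesis using fin_mod_star_0 by simp
next
  case (Suc r)
  then show ?thesis
    using poincare_lemma[of r] span_superset[of "coboundaries C \<Omega> p q"]
    unfolding fin_mod_def by (intro exI[of _ "{}"]) auto
qed

end

section \<open>Centres of open stars and the finite cover\<close>

lemma Inter_cells: "finite F \<Longrightarrow> F \<noteq> {} \<Longrightarrow> F \<subseteq> C \<Longrightarrow> \<Inter>F \<in> C"
proof (induction F rule: finite_ne_induct)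
  case (insert \<sigma> F)
  then have "(\<sigma> \<inter> \<Inter>F) face_of \<sigma>" by (intro Int_cells_face_of) auto
  then show ?case using insert.prems face_of_cell[of \<sigma>] by simp
qed simp

text \<open>The centre is a relative interior point of the smallest cell \<open>m\<close> that
  contains \<open>A\<close>; \<open>A \<noteq> {}\<close> makes \<open>m\<close> nonempty.\<close>

lemma open_star_center:
  assumes A: "A \<noteq> {}" and ne: "open_star C A \<noteq> {}"
  obtains z where "z \<in> open_star C A"
    "\<And>\<sigma> x t. \<sigma> \<in> C \<Longrightarrow> x \<in> \<sigma> \<Longrightarrow> x \<in> open_star C A \<Longrightarrow> t \<in> {0..1}
      \<Longrightarrow> z + t *\<^sub>R (x - z) \<in> \<sigma> \<inter> open_star C A"
proof -
  have sub: "A \<subseteq> \<sigma>" if "\<sigma> \<in> C" "x \<in> \<sigma>" "x \<in> open_star C A" for \<sigma> x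
    using that by (auto simp: open_star_def)
  define m where "m = \<Inter>{\<sigma> \<in> C. A \<subseteq> \<sigma>}"
  obtain x0 where "x0 \<in> open_star C A" using ne by blast
  moreover from this obtain \<sigma>0 where "\<sigma>0 \<in> C" "x0 \<in> \<sigma>0" by (auto simp: open_star_def supp_def)
  ultimately have ex: "\<exists>\<sigma> x. \<sigma> \<in> C \<and> x \<in> \<sigma> \<and> x \<in> open_star C A" by blast
  then have "{\<sigma> \<in> C. A \<subseteq> \<sigma>} \<noteq> {}" using sub by blast
  then have m: "m \<in> C" unfolding m_def using finite_complex by (intro Inter_cells) auto
  have Am: "A \<subseteq> m" by (auto simp: m_def)
  have "convex m" using polyhedron_cell[OF m] by (rule polyhedron_imp_convex)
  then obtain z where z: "z \<in> rel_interior m" using A Am rel_interior_eq_empty[of m] by auto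
  have zm: "z \<in> m" using z rel_interior_subset by blast
  have "A \<subseteq> \<tau>" if \<tau>: "\<tau> \<in> C" "z \<in> \<tau>" for \<tau>
  proof -
    \<comment> \<open>A proper face misses the relative interior, so a cell through \<open>z\<close>
      contains all of \<open>m\<close>.\<close>
    have "m \<inter> \<tau> = m"
      using face_of_disjoint_rel_interior[OF Int_cells_face_of[OF m \<tau>(1)]] z zm \<tau>(2) by blast
    then show ?thesis using Am by blast
  qed
  then have z_star: "z \<in> open_star C A"
    using m zm by (auto simp: open_star_def supp_def)
  have "z + t *\<^sub>R (x - z) \<in> \<sigma> \<inter> open_star C A"
    if \<sigma>: "\<sigma> \<in> C" "x \<in> \<sigma>" and x: "x \<in> open_star C A" and t: "t \<in> {0..1}" for \<sigma> x t
  proof -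
    define y where "y = z + t *\<^sub>R (x - z)"
    have y_eq: "y = (1 - t) *\<^sub>R z + t *\<^sub>R x" by (simp add: y_def algebra_simps)
    have z\<sigma>: "z \<in> \<sigma>" using zm sub[OF \<sigma> x] \<sigma>(1) by (auto simp: m_def)
    have y\<sigma>: "y \<in> \<sigma>"
      unfolding y_eq using polyhedron_imp_convex[OF polyhedron_cell[OF \<sigma>(1)]] z\<sigma> \<sigma>(2) t
      by (auto intro: convexD)
    have "A \<subseteq> \<tau>" if \<tau>: "\<tau> \<in> C" "y \<in> \<tau>" for \<tau>
    proof (cases "y = z \<or> y = x")
      case True
      then show ?thesis using sub[OF \<tau>] z_star x by auto
    next
      case False
      then have "y \<in> open_segment z x"
        using t unfolding open_segment_def closed_segment_def by (auto simp: y_eq)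
      \<comment> \<open>A face of \<open>\<sigma>\<close> that meets the interior of a segment in
        \<open>\<sigma>\<close> contains its ends. So a cell through \<open>y\<close> also passes
        through \<open>x\<close> and must contain \<open>A\<close>.\<close>
      then have "x \<in> \<sigma> \<inter> \<tau>"
        using face_ofD[OF Int_cells_face_of[OF \<sigma>(1) \<tau>(1)]] z\<sigma> \<sigma>(2) y\<sigma> \<tau>(2) by blast
      then show ?thesis using sub[OF \<tau>(1) _ x] by simp
    qed
    then show ?thesis using y\<sigma> \<sigma>(1) by (auto simp: y_def[symmetric] open_star_def supp_def)
  qed
  then show thesis using that z_star by blast
qed

lemma fin_mod_empty: "fin_mod (cocycles C {} p q) (coboundaries C {} p q)"
proof -
  have "cocycles C {} p q \<subseteq> {0}"
    by (auto simp: cocycles_def fun_eq_iff superforms_on_outside)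
  then show ?thesis unfolding fin_mod_def by (intro exI[of _ "{}"]) (auto intro: span_zero)
qed

lemma fin_mod_open_star:
  assumes "A \<noteq> {}"
  shows "fin_mod (cocycles C (open_star C A) p q) (coboundaries C (open_star C A) p q)"
proof (cases "open_star C A = {}")
  case True
  then show ?thesis using fin_mod_empty by simp
next
  case False
  obtain K where "smooth_zero_set K" "open_star C A = supp C - K" using open_star_eq_Diff[of A] by (elim exE conjE)
  then have op: "rel_open C (open_star C A)" using rel_open_Diff_zero_set by simp
  show ?thesis
  proof (rule open_star_center[OF assms False])
    fix z assume "z \<in> open_star C A"
      "\<And>\<sigma> x t. \<sigma> \<in> C \<Longrightarrow> x \<in> \<sigma> \<Longrightarrow> x \<in> open_star C A \<Longrightarrow> t \<in> {0..1}
        \<Longrightarrow> z + t *\<^sub>R (x - z) \<in> \<sigma> \<inter> open_star C A"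
    with op show ?thesis by (rule fin_mod_star)
  qed
qed

text \<open>Brings a union of stars into the form required by \<open>splitting_complements\<close>;
  unions of stars correspond to intersections of zero sets.\<close>

lemma Union_open_star_eq_Diff:
  "\<exists>K. smooth_zero_set K \<and> (\<Union>A\<in>set As. open_star C A) = supp C - K"
proof (induction As)
  case Nil
  have "smooth_zero_set (UNIV :: 'a set)" using smooth_zero_set_Inter[of "{}"] by simp
  then show ?case by (intro exI[of _ UNIV]) simp
next
  case (Cons A As)
  obtain K where K: "smooth_zero_set K" "open_star C A = supp C - K"
    using open_star_eq_Diff[of A] by (elim exE conjE)
  obtain L where L: "smooth_zero_set L" "(\<Union>A\<in>set As. open_star C A) = supp C - L"
    using Cons by (elim exE conjE)
  show ?case
  proof (intro exI conjI)
    show "smooth_zero_set (K \<inter> L)" using K(1) L(1) by (rule smooth_zero_set_Int)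
    show "(\<Union>A\<in>set (A # As). open_star C A) = supp C - K \<inter> L"
      by (simp add: K(2) L(2) Diff_Int)
  qed
qed

text \<open>The induction is on the length and not on the list: intersecting with the first star
  replaces \<open>Bs\<close> by another list of the same length, made of the sets
  \<open>A \<union> B\<close>.\<close>

lemma fin_mod_Union_open_star:
  assumes "{} \<notin> set As"
  shows "fin_mod (cocycles C (\<Union>A\<in>set As. open_star C A) p q)
    (coboundaries C (\<Union>A\<in>set As. open_star C A) p q)"
  using assms
proof (induction "length As" arbitrary: As p)
  case 0
  then show ?case using fin_mod_empty by simp
next
  case (Suc n)
  then obtain A Bs where As: "As = A # Bs" "length Bs = n" by (cases As) auto
  obtain K where K: "smooth_zero_set K" "open_star C A = supp C - K"
    using open_star_eq_Diff[of A] by (elim exE conjE)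
  obtain L where L: "smooth_zero_set L" "(\<Union>A\<in>set Bs. open_star C A) = supp C - L"
    using Union_open_star_eq_Diff[of Bs] by (elim exE conjE)
  have Int: "open_star C A \<inter> (\<Union>A\<in>set Bs. open_star C A)
      = (\<Union>A\<in>set (map (\<lambda>B. A \<union> B) Bs). open_star C A)"
    by (simp add: open_star_Int[symmetric])
  have "fin_mod (cocycles C (open_star C A \<union> (\<Union>A\<in>set Bs. open_star C A)) p q)
      (coboundaries C (open_star C A \<union> (\<Union>A\<in>set Bs. open_star C A)) p q)"
  proof (rule fin_mod_union[OF C])
    show "rel_open C (open_star C A)" "rel_open C (\<Union>A\<in>set Bs. open_star C A)"
      unfolding K(2) L(2) using K(1) L(1) by (auto intro: rel_open_Diff_zero_set)
    show "splitting (open_star C A) (\<Union>A\<in>set Bs. open_star C A)"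
      unfolding K(2) L(2) by (rule splitting_complements[OF K(1) L(1)])
    show "fin_mod (cocycles C (open_star C A) p q) (coboundaries C (open_star C A) p q)" for p
      using Suc.prems As by (intro fin_mod_open_star) auto
    show "fin_mod (cocycles C (\<Union>A\<in>set Bs. open_star C A) p q)
        (coboundaries C (\<Union>A\<in>set Bs. open_star C A) p q)" for p
      using Suc.prems As by (intro Suc.hyps(1)) auto
    show "fin_mod (cocycles C (open_star C A \<inter> (\<Union>A\<in>set Bs. open_star C A)) p q)
        (coboundaries C (open_star C A \<inter> (\<Union>A\<in>set Bs. open_star C A)) p q)" for p
      unfolding Int using Suc.prems As by (intro Suc.hyps(1)) auto
  qed
  then show ?case by (simp add: As)
qed

text \<open>Singletons suffice, as \<open>x\<close> lies in the star of \<open>{x}\<close>. This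
  star depends only on which cells miss \<open>x\<close>, so only finitely many stars occur.\<close>

lemma supp_eq_Union_open_star:
  obtains As where "{} \<notin> set As" "(\<Union>A\<in>set As. open_star C A) = supp C"
proof -
  define st where "st = (\<lambda>x. open_star C {x})"
  have "st ` supp C \<subseteq> (\<lambda>T. supp C - \<Union>T) ` Pow C" by (auto simp: st_def open_star_def)
  then have "finite (st ` supp C)" using finite_complex by (meson finite_Pow_iff finite_imageI finite_subset)
  then obtain X where X: "finite X" "X \<subseteq> supp C" "st ` supp C = st ` X"
    using finite_subset_image[of "st ` supp C" st "supp C"] by auto
  obtain xs where xs: "set xs = X" using finite_list[OF X(1)] by blast
  have "(\<Union>x\<in>X. st x) = (\<Union>x\<in>supp C. st x)" using X(3) by simp
  also have "\<dots> = supp C" by (auto simp: st_def open_star_def)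
  finally show thesis
    by (intro that[of "map (\<lambda>x. {x}) xs"]) (auto simp: xs st_def)
qed

end

theorem theorem3p10:
  fixes C :: "'a::euclidean_space set set" and p q :: nat
  assumes "polyhedral_complex C"
  shows "finite_dimensional (cohomology C (supp C) p q)"
proof -
  have "rel_open C (supp C)" by simp
  moreover have "fin_mod (cocycles C (supp C) p q) (coboundaries C (supp C) p q)"
    using fin_mod_Union_open_star[OF assms] supp_eq_Union_open_star[OF assms] by metis
  ultimately show ?thesis
    unfolding cohomology_def
    by (intro finite_dimensional_quotient_space subspace_cocycles[OF assms]
        subspace_coboundaries[OF assms] coboundaries_subset_cocycles[OF assms])
qed

end
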